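(* Let $s\in\mathbb R$ and let $(s_n)_{n\in\mathbb N}$ be a sequence of real numbers such that $\mu n+s_n n^\gamma\in\mathbb N_0$ for all $n\in\mathbb N$ and $\lim_{n\to\infty}s_n=s$. Let $\mathbb Q_{n,s_n}$ be the distribution of $\bigl(\frac1{n^\gamma}X_{[j:n]}\bigr)_{j\in\mathbb N}$ under the conditional law $\mathbb P(\,\cdot\mid S_n=\mu n+s_nn^\gamma)$. Then $(\mathbb Q_{n,s_n})_{n\in\mathbb N}$ satisfies the large deviation principle on $\mathcal D$ with speed $n^{\gamma\alpha}$ and good rate function $I_s=F_s-\inf_{\mathcal D}F_s$. That is, $I_s$ is lower semicontinuous with compact sublevel sets, for every closed set $\mathcal A\subset\mathcal D$ $$\limsup_{n\to\infty}\frac1{n^{\gamma\alpha}}\log\mathbb P\Bigl(\Bigl(\frac{X_{[j:n]}}{n^\gamma}\Bigr)_{j\in\mathbb N}\in\mathcal A\,\Big|\,S_n=\mu n+s_nn^\gamma\Bigr)\le-\inf_{\mathcal A}I_s,$$ and for every open set $\mathcal O\subset\mathcal D$ $$\liminf_{n\to\infty}\frac1{n^{\gamma\alpha}}\log\mathbb P\Bigl(\Bigl(\frac{X_{[j:n]}}{n^\gamma}\Bigr)_{j\in\mathbb N}\in\mathcal O\,\Big|\,S_n=\mu n+s_nn^\gamma\Bigr)\ge-\inf_{\mathcal O}I_s.$$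
   Context: Notation: $\mathbb N=\{1,2,\ldots\}$, $\mathbb N_0=\mathbb N\cup\{0\}$, $\mathbb R_+=[0,\infty)$; $\log 0=-\infty$, $\inf\varnothing=+\infty$. Fix $\alpha\in(0,1)$, let $c=1/\sum_{k\in\mathbb N_0}\exp(-k^\alpha)$ and $\gamma=1/(2-\alpha)$. Let $X_1,X_2,\ldots$ be i.i.d. $\mathbb N_0$-valued random variables with $\mathbb P(X_i=k)=c\exp(-k^\alpha)$ for $k\in\mathbb N_0$, with expected value $\mu=\mathbb E[X_i]$ and variance $\sigma^2$. Put $S_n=X_1+\cdots+X_n$. Rearranging $X_1,\ldots,X_n$ in decreasing order gives the reversed order statistics $X_{[1:n]}\ge X_{[2:n]}\ge\cdots\ge X_{[n:n]}$; set $X_{[j:n]}=0$ for $j\ge n+1$. Let $\mathcal D\subset\mathbb R_+^{\mathbb N}$ be the set of decreasing sequences $x_1\ge x_2\ge\cdots$ (of numbers in $\mathbb R_+$), equipped with the trace of the product topology; open and closed subsets of $\mathcal D$ refer to this topology. For $s\in\mathbb R$ define $F_s:\mathcal D\to\mathbb R_+\cup\{\infty\}$ by $$F_s(x_1,x_2,\ldots)=\sum_{j=1}^\infty x_j^\alpha+\frac1{2\sigma^2}\Bigl(s-\sum_{j=1}^\infty x_j\Bigr)^2$$ (equal to $\infty$ if one of the sums diverges). *)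

theory Defs
  imports "HOL-Probability.Probability"
begin

subsection \<open>Large deviation principles\<close>

definition log_prob :: "real \<Rightarrow> ereal" where
  "log_prob p = (if p = 0 then - \<infinity> else ereal (ln p))"

definition lower_semicontinuous :: "'b topology \<Rightarrow> ('b \<Rightarrow> ereal) \<Rightarrow> bool" where
  "lower_semicontinuous T I \<longleftrightarrow> (\<forall>a. openin T {x \<in> topspace T. a < I x})"

definition good_rate_function :: "'b topology \<Rightarrow> ('b \<Rightarrow> ereal) \<Rightarrow> bool" where
  "good_rate_function T I \<longleftrightarrow>
     (\<forall>x \<in> topspace T. 0 \<le> I x) \<and>
     lower_semicontinuous T I \<and>
     (\<forall>a::real. compactin T {x \<in> topspace T. I x \<le> ereal a})"

text \<open>The infimum over the empty set is \<open>\<infinity>\<close> in \<^typ>\<open>ereal\<close>.\<close>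

definition large_deviation_principle ::
  "'b topology \<Rightarrow> (nat \<Rightarrow> 'b measure) \<Rightarrow> (nat \<Rightarrow> real) \<Rightarrow> ('b \<Rightarrow> ereal) \<Rightarrow> bool" where
  "large_deviation_principle T Q speed I \<longleftrightarrow>
     (\<forall>A. closedin T A \<longrightarrow>
        limsup (\<lambda>n. ereal (1 / speed n) * log_prob (measure (Q n) A)) \<le> - (INF x\<in>A. I x)) \<and>
     (\<forall>U. openin T U \<longrightarrow>
        - (INF x\<in>U. I x) \<le> liminf (\<lambda>n. ereal (1 / speed n) * log_prob (measure (Q n) U)))"

subsection \<open>Decreasing sequences and the functional \<open>F\<^sub>s\<close>\<close>

text \<open>Sequences \<open>(x\<^sub>1, x\<^sub>2, \<dots>)\<close> are functions on \<^typ>\<open>nat\<close>, with \<open>x j\<close> standing for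
  \<open>x\<^sub>j\<^sub>+\<^sub>1\<close>. The topology of the function type \<^typ>\<open>nat \<Rightarrow> real\<close> is the product topology.\<close>

definition decseqs :: "(nat \<Rightarrow> real) set" where
  "decseqs = {x. decseq x \<and> (\<forall>j. 0 \<le> x j)}"

text \<open>The parameter \<open>v\<close> is the variance \<open>\<sigma>\<^sup>2\<close>.\<close>

definition F :: "real \<Rightarrow> real \<Rightarrow> real \<Rightarrow> (nat \<Rightarrow> real) \<Rightarrow> ereal" where
  "F \<alpha> v s x =
     (if summable (\<lambda>j. x j powr \<alpha>) \<and> summable x
      then ereal ((\<Sum>j. x j powr \<alpha>) + (s - (\<Sum>j. x j))\<^sup>2 / (2 * v))
      else \<infinity>)"

definition rate_function :: "real \<Rightarrow> real \<Rightarrow> real \<Rightarrow> (nat \<Rightarrow> real) \<Rightarrow> ereal" where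
  "rate_function \<alpha> v s x = F \<alpha> v s x - (INF y\<in>decseqs. F \<alpha> v s y)"

subsection \<open>Partial sums, order statistics and the conditional law\<close>

definition partial_sum :: "(nat \<Rightarrow> 'a \<Rightarrow> nat) \<Rightarrow> nat \<Rightarrow> 'a \<Rightarrow> nat" where
  "partial_sum X n \<omega> = (\<Sum>i = 1..n. X i \<omega>)"

text \<open>The value \<open>X\<^sub>[\<^sub>j\<^sub>:\<^sub>n\<^sub>]\<close> for \<open>j \<ge> 1\<close>: the \<open>j\<close>-th largest of \<open>X\<^sub>1, \<dots>, X\<^sub>n\<close>.\<close>

definition rev_order_stat :: "(nat \<Rightarrow> 'a \<Rightarrow> nat) \<Rightarrow> nat \<Rightarrow> nat \<Rightarrow> 'a \<Rightarrow> nat" where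
  "rev_order_stat X j n \<omega> =
     (if j \<le> n then rev (sort (map (\<lambda>i. X i \<omega>) [1..<n + 1])) ! (j - 1) else 0)"

definition scaled_order_stats ::
  "(nat \<Rightarrow> 'a \<Rightarrow> nat) \<Rightarrow> real \<Rightarrow> nat \<Rightarrow> 'a \<Rightarrow> nat \<Rightarrow> real" where
  "scaled_order_stats X \<gamma> n \<omega> = (\<lambda>j. real (rev_order_stat X (j + 1) n \<omega>) / real n powr \<gamma>)"

text \<open>The law of the rescaled order statistics on the Borel sets of \<^const>\<open>decseqs\<close>,
  conditionally on \<open>S\<^sub>n = t\<close>.\<close>

definition cond_law ::
  "'a measure \<Rightarrow> (nat \<Rightarrow> 'a \<Rightarrow> nat) \<Rightarrow> real \<Rightarrow> nat \<Rightarrow> real \<Rightarrow> (nat \<Rightarrow> real) measure" where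
  "cond_law M X \<gamma> n t =
     distr (uniform_measure M {\<omega> \<in> space M. real (partial_sum X n \<omega>) = t})
           (restrict_space borel decseqs)
           (scaled_order_stats X \<gamma> n)"

text \<open>Open and closed subsets of \<^const>\<open>decseqs\<close> are measurable, and the measure that
  \<^const>\<open>cond_law\<close> gives them is the elementary conditional probability.\<close>

lemma scaled_order_stats_in_decseqs: "scaled_order_stats X \<gamma> n \<omega> \<in> decseqs"
proof -
  let ?l = "sort (map (\<lambda>i. X i \<omega>) [1..<n + 1])"
  have "rev_order_stat X (j' + 1) n \<omega> \<le> rev_order_stat X (j + 1) n \<omega>" if "j \<le> j'" for j j'
  proof (cases "j' + 1 \<le> n")
    case True
    then show ?thesis
      using that sorted_rev_nth_mono[of "rev ?l" j j'] by (simp add: rev_order_stat_def del: upt_Suc)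
  qed (simp add: rev_order_stat_def)
  then show ?thesis
    by (auto simp: decseqs_def decseq_def scaled_order_stats_def intro!: divide_right_mono)
qed

lemma measurable_scaled_order_stats:
  assumes "\<And>i. 1 \<le> i \<Longrightarrow> X i \<in> measurable M (count_space UNIV)"
  shows "scaled_order_stats X \<gamma> n \<in> measurable M (restrict_space borel decseqs)"
proof (rule measurable_restrict_space2)
  show "scaled_order_stats X \<gamma> n \<in> space M \<rightarrow> decseqs"
    using scaled_order_stats_in_decseqs by auto
  have 1: "(\<lambda>\<omega>. map (\<lambda>i. X i \<omega>) [1..<n + 1]) \<in> measurable M (count_space UNIV)"
  proof -
    have "(\<lambda>\<omega>. map (\<lambda>i. X i \<omega>) l) \<in> measurable M (count_space UNIV)" if "\<forall>i\<in>set l. 1 \<le> i" for l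
      using that
    proof (induction l)
      case (Cons a l)
      have [measurable]: "X a \<in> measurable M (count_space UNIV)"
        "(\<lambda>\<omega>. map (\<lambda>i. X i \<omega>) l) \<in> measurable M (count_space UNIV)"
        using Cons assms by auto
      have "(\<lambda>\<omega>. x # map (\<lambda>i. X i \<omega>) l) \<in> measurable M (count_space UNIV)" for x
        by (rule measurable_compose[where N = "count_space UNIV" and g = "\<lambda>l. x # l"]) simp_all
      then have "(\<lambda>\<omega>. X a \<omega> # map (\<lambda>i. X i \<omega>) l) \<in> measurable M (count_space UNIV)"
        by (rule measurable_compose_countable) simp
      then show ?case by simp
    qed simp
    from this[of "[1..<n+1]"] show ?thesis by (simp del: upt_Suc)
  qed
  have "(\<lambda>\<omega>. scaled_order_stats X \<gamma> n \<omega> j) \<in> borel_measurable M" for j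
  proof -
    have "(\<lambda>\<omega>. (\<lambda>l. real (if j + 1 \<le> n then rev (sort l) ! j else 0) / real n powr \<gamma>)
       (map (\<lambda>i. X i \<omega>) [1..<n + 1])) \<in> borel_measurable M"
      by (rule measurable_compose[OF 1]) simp
    then show ?thesis by (simp add: scaled_order_stats_def rev_order_stat_def cong: if_cong)
  qed
  then show "scaled_order_stats X \<gamma> n \<in> borel_measurable M"
    by (rule measurable_coordinatewise_then_product)
qed

lemma sets_closedin_or_openin_decseqs:
  assumes "closedin (top_of_set decseqs) A \<or> openin (top_of_set decseqs) A"
  shows "A \<in> sets (restrict_space borel decseqs)"
  using assms
proof
  assume "closedin (top_of_set decseqs) A"
  then obtain C where "closed C" "A = decseqs \<inter> C"
    unfolding closedin_closed by blast
  then show ?thesis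
    by (metis borel_closed imageI sets_restrict_space)
next
  assume "openin (top_of_set decseqs) A"
  then obtain U where "open U" "A = decseqs \<inter> U"
    unfolding openin_open by blast
  then show ?thesis
    by (metis borel_open imageI sets_restrict_space)
qed

lemma measure_cond_law:
  assumes "prob_space M" "\<And>i. 1 \<le> i \<Longrightarrow> X i \<in> measurable M (count_space UNIV)"
    and A: "A \<in> sets (restrict_space borel decseqs)"
  shows "measure (cond_law M X \<gamma> n t) A =
    \<P>(\<omega> in M. scaled_order_stats X \<gamma> n \<omega> \<in> A \<bar> real (partial_sum X n \<omega>) = t)"
proof -
  interpret prob_space M by fact
  note m = measurable_scaled_order_stats[of X M \<gamma> n, OF assms(2)]
  have [measurable]: "(\<lambda>\<omega>. real (partial_sum X n \<omega>)) \<in> borel_measurable M"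
    unfolding partial_sum_def of_nat_sum
    by (intro borel_measurable_sum measurable_compose[OF assms(2)]) auto
  have [measurable]: "Measurable.pred M (\<lambda>\<omega>. scaled_order_stats X \<gamma> n \<omega> \<in> A)"
    using m A by measurable
  show ?thesis
    using m A
    by (simp add: cond_law_def measure_distr measure_uniform_measure_eq_cond_prob[symmetric]
        vimage_def Int_def conj_commute)
qed

end

theory Submission
  imports Defs "HOL-Real_Asymp.Real_Asymp" "HOL-Combinatorics.List_Permutation"
begin

text \<open>Write \<open>m = n\<^sup>\<gamma>\<close> and \<open>r = n\<^bsup>\<gamma>\<alpha>\<^esup>\<close>, so that \<open>m\<^sup>\<alpha> = r\<close> and \<open>m\<^sup>2 / n = r\<close>: the cost of a single jump of
  size \<open>m\<close> and the Gaussian cost of a deviation of \<open>S\<^sub>n\<close> by \<open>m\<close> are of the same order. Everything rests on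
  one estimate: after truncating the variables at \<open>\<delta> m\<close>, with \<open>\<delta>\<close> small in terms of \<open>\<theta>\<close>, the
  moment generating function of \<open>S\<^sub>n - \<mu> n\<close> at \<open>\<theta> m / n\<close> is \<open>exp (r (\<theta>\<^sup>2 \<sigma>\<^sup>2 / 2 + o(1)))\<close>.

  Upper bound: near a point \<open>x\<close>, the \<open>k\<close> largest variables cost \<open>\<Sum>\<^sub>j\<^sub><\<^sub>k x\<^sub>j\<^sup>\<alpha>\<close> and sit at one of at most
  \<open>n\<^sup>k\<close> tuples of positions, while the others are below \<open>x\<^sub>k m\<close> and are handled by the Chernoff bound with
  \<open>\<theta> = (s - \<Sum>\<^sub>j x\<^sub>j) / \<sigma>\<^sup>2\<close>. Boundedness of the largest coordinate gives exponential tightness in the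
  product topology.

  Lower bound: prescribe the first \<open>k\<close> variables, let the bulk fluctuate within a small window, and use one further
  variable of size \<open>O(\<eta> m)\<close>, whose cost \<open>O(\<eta>\<^sup>\<alpha> r)\<close> is negligible, to hit the value of \<open>S\<^sub>n\<close> exactly.

  The conditional statement follows by dividing by \<open>P(S\<^sub>n = \<mu> n + s\<^sub>n n\<^sup>\<gamma>)\<close>, which is the unconditional
  estimate for the whole space.\<close>

subsection \<open>Goodness of the rate function\<close>

text \<open>The sum of the x_j is not continuous for the product topology: mass can escape into many
  small coordinates. For the rate function this is cured by \<alpha> < 1, which gives the sequences
  of a sublevel set a common summable majorant. For the random variables the same escape would be a
  deviation of S_n produced by many values of intermediate size. With a n = n / m n one has k / a n
  = k^\<alpha> (k / m n)^(1-\<alpha>), so below \<delta> * m n the tilt \<theta> k / a n is at most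
  |\<theta>| \<delta>^(1-\<alpha>) k^\<alpha>; for small \<delta> the decay exp(-k^\<alpha>) beats
  it and only the variance survives in the limit. A point x of finite cost has x_k tending to 0, so
  some k makes truncation at x_k admissible for the tilt that x requires. That tilt is the maximiser
  in the Legendre formula y^2/(2v) = sup_\<theta> (\<theta> y - \<theta>^2 v/2), where y is the part
  of s not carried by the jumps. In the lower bound the bulk is steered slightly below its target,
  because the variable that closes the gap cannot be negative.\<close>

lemma compact_box: "compact {x::nat \<Rightarrow> real. \<forall>j. x j \<in> {0..B j}}"
proof -
  have "compactin (product_topology (\<lambda>_. euclidean) UNIV) (Pi\<^sub>E UNIV (\<lambda>j::nat. {0..B j :: real}))"
    by (simp add: compactin_PiE)
  then show ?thesis
    by (simp add: euclidean_product_topology PiE_UNIV_domain Pi_def)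
qed

lemma tendsto_coordinate:
  fixes f :: "'a \<Rightarrow> nat \<Rightarrow> real"
  assumes "(f \<longlongrightarrow> l) G"
  shows "((\<lambda>n. f n j) \<longlongrightarrow> l j) G"
  using continuous_on_tendsto_compose[OF continuous_on_product_coordinates[of j] assms] by simp

lemma closed_decseqs: "closed decseqs"
  unfolding closed_sequential_limits
proof (intro allI impI, elim conjE)
  fix f l assume f: "\<forall>n. f n \<in> decseqs" and lim: "f \<longlonglongrightarrow> l"
  have *: "(\<lambda>n. f n j) \<longlonglongrightarrow> l j" for j
    by (rule tendsto_coordinate[OF lim])
  have "l j' \<le> l j" if "j \<le> j'" for j j'
    by (rule LIMSEQ_le[OF * *]) (use f that in \<open>auto simp: decseqs_def decseq_def\<close>)
  moreover have "0 \<le> l j" for j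
    by (rule LIMSEQ_le_const[OF *]) (use f in \<open>auto simp: decseqs_def\<close>)
  ultimately show "l \<in> decseqs" by (auto simp: decseqs_def decseq_def)
qed

lemma decseqs_zero [simp]: "(\<lambda>_. 0) \<in> decseqs"
  by (simp add: decseqs_def)

lemma F_nonneg: "0 < v \<Longrightarrow> 0 \<le> F \<alpha> v s x"
  by (auto simp: F_def intro!: add_nonneg_nonneg suminf_nonneg divide_nonneg_pos)

text \<open>The first j + 1 terms of a decreasing sequence are all at least x_j, so (j + 1)
  x_j^\<alpha> is at most the whole sum. The resulting majorant is the same for all points of a
  sublevel set of \<open>F\<close>.\<close>

lemma decseqs_le_if_powr_sum_le:
  assumes x: "x \<in> decseqs" and \<alpha>: "0 < \<alpha>" and "summable (\<lambda>j. x j powr \<alpha>)" "(\<Sum>j. x j powr \<alpha>) \<le> a"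
  shows "x j \<le> (a / real (j + 1)) powr (1 / \<alpha>)"
proof -
  have dec: "x j \<le> x i" "0 \<le> x i" if "i \<le> j" for i j
    using x that by (auto simp: decseqs_def decseq_def)
  have "real (j + 1) * x j powr \<alpha> = (\<Sum>i<j+1. x j powr \<alpha>)" by simp
  also have "\<dots> \<le> (\<Sum>i<j+1. x i powr \<alpha>)"
    by (intro sum_mono powr_mono2) (use dec \<alpha> in auto)
  also have "\<dots> \<le> (\<Sum>j. x j powr \<alpha>)"
    by (intro sum_le_suminf) (use assms in auto)
  finally have "x j powr \<alpha> \<le> a / real (j + 1)"
    using assms by (simp add: field_simps)
  then have "(x j powr \<alpha>) powr (1 / \<alpha>) \<le> (a / real (j + 1)) powr (1 / \<alpha>)"
    by (intro powr_mono2) (use \<alpha> in auto)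
  then show ?thesis using \<alpha> dec[of j j] by (simp add: powr_powr)
qed

text \<open>The exponent 1 / \<alpha> exceeds 1. This is what makes the sum of the x_j continuous on
  sublevel sets.\<close>

lemma summable_box:
  assumes "0 < \<alpha>" "\<alpha> < 1" "0 \<le> a"
  shows "summable (\<lambda>j. (a / real (j + 1)) powr (1 / \<alpha>))"
proof -
  have "summable (\<lambda>j. real j powr (- (1 / \<alpha>)))"
    using assms by (subst summable_real_powr_iff) (simp add: field_simps)
  then have "summable (\<lambda>j. real (Suc j) powr (- (1 / \<alpha>)))"
    by (subst summable_Suc_iff)
  then have "summable (\<lambda>j. a powr (1 / \<alpha>) * real (Suc j) powr (- (1 / \<alpha>)))"
    by (rule summable_mult)
  then show ?thesis using assms
    by (simp add: powr_divide powr_minus field_simps)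
qed

lemma F_le_iff:
  "F \<alpha> v s x \<le> ereal a \<longleftrightarrow> summable (\<lambda>j. x j powr \<alpha>) \<and> summable x \<and>
    (\<Sum>j. x j powr \<alpha>) + (s - (\<Sum>j. x j))\<^sup>2 / (2 * v) \<le> a"
  by (auto simp: F_def)

text \<open>The two sums pass to the limit differently. The x_j have the summable majorant
  \<open>b\<close>, so Tannery's theorem gives convergence of their sum. The bound on the powers
  x_j^\<alpha> is only the harmonic a / (j + 1); for them finite partial sums are taken to the
  limit, which yields an inequality in the right direction.\<close>

lemma closed_sublevel_F:
  assumes \<alpha>: "0 < \<alpha>" "\<alpha> < 1" and v: "0 < v"
  shows "closed {x \<in> decseqs. F \<alpha> v s x \<le> ereal a}"
  unfolding closed_sequential_limits
proof (intro allI impI, elim conjE)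
  fix f l assume f: "\<forall>n. f n \<in> {x \<in> decseqs. F \<alpha> v s x \<le> ereal a}" and lim: "f \<longlonglongrightarrow> l"
  have co: "(\<lambda>n. f n j) \<longlonglongrightarrow> l j" for j
    by (rule tendsto_coordinate[OF lim])
  have ld: "l \<in> decseqs"
    using closed_decseqs f lim unfolding closed_sequential_limits by blast
  have fn: "f n \<in> decseqs" "summable (\<lambda>j. f n j powr \<alpha>)" "summable (f n)"
    "(\<Sum>j. f n j powr \<alpha>) + (s - (\<Sum>j. f n j))\<^sup>2 / (2 * v) \<le> a" for n
    using f by (auto simp: F_le_iff)
  have sa: "(\<Sum>j. f n j powr \<alpha>) \<le> a" "0 \<le> (\<Sum>j. f n j powr \<alpha>)" for n
    using fn(4)[of n] v by (auto intro!: suminf_nonneg fn intro: order.trans[rotated])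
  then have a: "0 \<le> a" using order.trans by blast
  have nn: "0 \<le> f n j" for n j using fn(1) by (auto simp: decseqs_def)
  define b where "b j = (a / real (j + 1)) powr (1 / \<alpha>)" for j
  have fb: "f n j \<le> b j" for n j
    unfolding b_def by (intro decseqs_le_if_powr_sum_le fn \<alpha> sa)
  have "eventually (\<lambda>n. summable (\<lambda>k. norm (f n k))) sequentially \<and> summable (\<lambda>n. norm (l n)) \<and>
      (\<lambda>n. \<Sum>k. f n k) \<longlonglongrightarrow> suminf l"
  proof (rule tannerys_theorem[where M = b])
    show "\<forall>\<^sub>F (k, n) in at_top \<times>\<^sub>F sequentially. norm (f n k) \<le> b k"
      using fb nn by (intro always_eventually) auto
    show "summable b" unfolding b_def using summable_box[OF \<alpha> a] .
  qed (use co in auto)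
  then have l: "summable l" and S: "(\<lambda>n. \<Sum>k. f n k) \<longlonglongrightarrow> suminf l"
    by (auto intro: summable_norm_cancel)
  have part: "(\<Sum>j<k. l j powr \<alpha>) \<le> a - (s - (\<Sum>j. l j))\<^sup>2 / (2 * v)" for k
  proof (rule LIMSEQ_le)
    show "(\<lambda>n. \<Sum>j<k. f n j powr \<alpha>) \<longlonglongrightarrow> (\<Sum>j<k. l j powr \<alpha>)"
      by (intro tendsto_sum tendsto_powr' co tendsto_const) (use \<alpha> nn in auto)
    show "(\<lambda>n. a - (s - (\<Sum>j. f n j))\<^sup>2 / (2 * v)) \<longlonglongrightarrow> a - (s - (\<Sum>j. l j))\<^sup>2 / (2 * v)"
      by (intro tendsto_intros S) (use v in auto)
    have "(\<Sum>j<k. f n j powr \<alpha>) \<le> a - (s - (\<Sum>j. f n j))\<^sup>2 / (2 * v)" for n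
      using sum_le_suminf[OF fn(2), of "{..<k}" n] fn(4)[of n] by simp
    then show "\<exists>N. \<forall>n\<ge>N. (\<Sum>j<k. f n j powr \<alpha>) \<le> a - (s - (\<Sum>j. f n j))\<^sup>2 / (2 * v)"
      by blast
  qed
  have la: "summable (\<lambda>j. l j powr \<alpha>)"
  proof (rule summableI_nonneg_bounded)
    show "(\<Sum>j<k. l j powr \<alpha>) \<le> a - (s - (\<Sum>j. l j))\<^sup>2 / (2 * v)" for k by (rule part)
  qed simp
  have "(\<Sum>j. l j powr \<alpha>) \<le> a - (s - (\<Sum>j. l j))\<^sup>2 / (2 * v)"
    by (rule suminf_le_const[OF la part])
  then show "l \<in> {x \<in> decseqs. F \<alpha> v s x \<le> ereal a}"
    using ld la l by (simp add: F_le_iff)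
qed

lemma compact_sublevel_F:
  assumes \<alpha>: "0 < \<alpha>" "\<alpha> < 1" and v: "0 < v"
  shows "compact {x \<in> decseqs. F \<alpha> v s x \<le> ereal a}"
proof -
  let ?S = "{x \<in> decseqs. F \<alpha> v s x \<le> ereal a}"
  have "?S \<subseteq> {x. \<forall>j. x j \<in> {0..(a / real (j + 1)) powr (1 / \<alpha>)}}"
  proof safe
    fix x j assume x: "x \<in> decseqs" "F \<alpha> v s x \<le> ereal a"
    then have "(\<Sum>j. x j powr \<alpha>) \<le> a" "summable (\<lambda>j. x j powr \<alpha>)"
      using v by (auto simp: F_le_iff intro: order.trans[rotated])
    with decseqs_le_if_powr_sum_le[OF x(1) \<alpha>(1)] x(1)
    show "x j \<in> {0..(a / real (j + 1)) powr (1 / \<alpha>)}" by (auto simp: decseqs_def)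
  qed
  then show ?thesis
    using compact_Int_closed[OF compact_box closed_sublevel_F[OF assms],
        of "\<lambda>j. (a / real (j + 1)) powr (1 / \<alpha>)" s a]
    by (simp only: inf.absorb2)
qed

text \<open>The zero sequence has finite cost, so subtracting the infimum is a shift by a real
  number and never meets \<infinity> - \<infinity>.\<close>

lemma INF_F_real:
  assumes "0 < v"
  obtains i where "(INF y\<in>decseqs. F \<alpha> v s y) = ereal i"
proof -
  have "0 \<le> (INF y\<in>decseqs. F \<alpha> v s y)"
    using F_nonneg[OF assms] by (intro INF_greatest)
  moreover have "(INF y\<in>decseqs. F \<alpha> v s y) \<le> F \<alpha> v s (\<lambda>_. 0)"
    by (intro INF_lower) simp
  moreover have "F \<alpha> v s (\<lambda>_. 0) < \<infinity>" by (simp add: F_def)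
  ultimately show ?thesis
    using that by (cases "INF y\<in>decseqs. F \<alpha> v s y") auto
qed

lemma good_rate_function_rate_function:
  assumes \<alpha>: "0 < \<alpha>" "\<alpha> < 1" and v: "0 < v"
  shows "good_rate_function (top_of_set decseqs) (rate_function \<alpha> v s)"
proof -
  obtain i where i: "(INF y\<in>decseqs. F \<alpha> v s y) = ereal i"
    using INF_F_real[OF v] .
  have rate: "rate_function \<alpha> v s x = F \<alpha> v s x - ereal i" for x
    by (simp add: rate_function_def i)
  have le_iff: "rate_function \<alpha> v s x \<le> ereal a \<longleftrightarrow> F \<alpha> v s x \<le> ereal (a + i)" for x a
    unfolding rate by (simp add: ereal_minus_le)
  have nonneg: "0 \<le> rate_function \<alpha> v s x" if "x \<in> decseqs" for x
  proof -
    have "ereal i \<le> F \<alpha> v s x" using that i[symmetric] by (simp add: INF_lower)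
    then show ?thesis unfolding rate by (cases "F \<alpha> v s x") auto
  qed
  have "openin (top_of_set decseqs) {x \<in> decseqs. a < rate_function \<alpha> v s x}" for a
  proof (cases a)
    case (real b)
    have "{x \<in> decseqs. a < rate_function \<alpha> v s x} =
        decseqs \<inter> - {x \<in> decseqs. F \<alpha> v s x \<le> ereal (b + i)}"
      using real le_iff[of _ b] by (auto simp: not_le[symmetric])
    then show ?thesis
      using closed_sublevel_F[OF assms] by (auto intro!: openin_open_Int)
  next
    case PInf
    then show ?thesis by simp
  next
    case MInf
    have "{x \<in> decseqs. a < rate_function \<alpha> v s x} = decseqs"
      using nonneg MInf by force
    then show ?thesis by simp
  qed
  moreover have "compactin (top_of_set decseqs) {x \<in> decseqs. rate_function \<alpha> v s x \<le> ereal a}" for a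
    unfolding le_iff using compact_sublevel_F[OF assms]
    by (auto simp: compactin_subtopology)
  ultimately show ?thesis
    using nonneg by (simp add: good_rate_function_def lower_semicontinuous_def)
qed

text \<open>Basic open sets constrain finitely many coordinates, so the lower bound has to control
  only finitely many order statistics.\<close>

lemma open_fun_nhd:
  fixes x :: "nat \<Rightarrow> real"
  assumes "open U" "x \<in> U"
  obtains J e where "0 < e" "\<And>y. (\<And>j. j < J \<Longrightarrow> \<bar>y j - x j\<bar> < e) \<Longrightarrow> y \<in> U"
proof -
  have "openin (product_topology (\<lambda>_. euclidean) UNIV) U"
    using assms by (simp add: euclidean_product_topology)
  from product_topology_open_contains_basis[OF this \<open>x \<in> U\<close>]
  obtain Y where Y: "\<And>i. x i \<in> Y i" "\<And>i. open (Y i)" "finite {i. Y i \<noteq> UNIV}" "Pi\<^sub>E UNIV Y \<subseteq> U"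
    by (auto simp: PiE_UNIV_domain)
  have "\<exists>e>0. ball (x i) e \<subseteq> Y i" for i
    using Y openE by blast
  then obtain d where d: "\<And>i. 0 < d i" "\<And>i. ball (x i) (d i) \<subseteq> Y i"
    by metis
  define I where "I = {i. Y i \<noteq> UNIV}"
  \<comment> \<open>The inserted 1 keeps the minimum meaningful when no coordinate is
    constrained.\<close>
  define e where "e = Min (insert 1 (d ` I))"
  have "0 < e" "\<And>i. i \<in> I \<Longrightarrow> e \<le> d i"
    using Y(3) d by (auto simp: e_def I_def)
  moreover obtain J where J: "I \<subseteq> {..<J}"
    using Y(3) unfolding I_def by (meson finite_nat_iff_bounded)
  moreover have "y \<in> U" if "\<And>j. j < J \<Longrightarrow> \<bar>y j - x j\<bar> < e" for y
  proof -
    have "y i \<in> Y i" for i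
    proof (cases "i \<in> I")
      case True
      then have "dist (x i) (y i) < d i"
        using that[of i] J calculation(2)[OF True] by (auto simp: dist_real_def)
      then show ?thesis using d(2)[of i] by auto
    qed (auto simp: I_def)
    then show ?thesis using Y(4) by (auto simp: PiE_UNIV_domain)
  qed
  ultimately show ?thesis using that by blast
qed

subsection \<open>The stretched exponential law and its scales\<close>

text \<open>The factor (1 + k)^2 covers the integrands used later: moments up to the second and the
  quadratic remainder of the exponential.\<close>

lemma summable_poly_stretched_exp:
  fixes \<alpha> q :: real
  assumes "0 < \<alpha>" "0 < q"
  shows "summable (\<lambda>k. (1 + real k)\<^sup>2 * exp (- q * (real k powr \<alpha>)))"
proof (rule summable_comparison_test_bigo)
  show "summable (\<lambda>k. norm (real k powr (- 2)))"
    using summable_real_powr_iff[of "-2"] by simp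
  show "(\<lambda>k. (1 + real k)\<^sup>2 * exp (- q * (real k powr \<alpha>))) \<in> O(\<lambda>k. real k powr (- 2))"
    using assms by real_asymp
qed

locale stretched_exponential = prob_space M for M :: "'a measure" +
  fixes X :: "nat \<Rightarrow> 'a \<Rightarrow> nat" and \<alpha> c \<gamma> \<mu> v :: real
  assumes alpha: "0 < \<alpha>" "\<alpha> < 1"
    and c: "c = 1 / (\<Sum>k. exp (- (real k powr \<alpha>)))"
    and gamma: "\<gamma> = 1 / (2 - \<alpha>)"
    and indep: "indep_vars (\<lambda>_. count_space UNIV) X {1..}"
    and dist: "\<And>i k. 1 \<le> i \<Longrightarrow> \<P>(\<omega> in M. X i \<omega> = k) = c * exp (- (real k powr \<alpha>))"
    and mean: "\<mu> = expectation (\<lambda>\<omega>. real (X 1 \<omega>))"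
    and var: "v = variance (\<lambda>\<omega>. real (X 1 \<omega>))"
begin

lemma X_measurable [measurable]: "1 \<le> i \<Longrightarrow> X i \<in> measurable M (count_space UNIV)"
  using indep by (auto simp: indep_vars_def)

lemma c_pos: "0 < c"
proof -
  have s: "summable (\<lambda>k. exp (- (real k powr \<alpha>)))"
  proof (rule summable_comparison_test)
    show "summable (\<lambda>k. (1 + real k)\<^sup>2 * exp (- 1 * (real k powr \<alpha>)))"
      by (intro summable_poly_stretched_exp alpha) simp
    have "exp (- (real k powr \<alpha>)) \<le> (1 + real k)\<^sup>2 * exp (- 1 * (real k powr \<alpha>))" for k
    proof -
      have "1 \<le> (1 + real k)\<^sup>2" by (simp add: power2_eq_square algebra_simps)
      then show ?thesis by simp
    qed
    then show "\<exists>N. \<forall>n\<ge>N. norm (exp (- (real n powr \<alpha>))) \<le> (1 + real n)\<^sup>2 * exp (- 1 * (real n powr \<alpha>))"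
      by auto
  qed
  then show ?thesis unfolding c
    using suminf_pos[OF s] by simp
qed

section \<open>Integrals against the stretched exponential law\<close>

lemma distr_X:
  assumes "1 \<le> i"
  shows "distr M (count_space UNIV) (X i) =
    density (count_space UNIV) (\<lambda>k. ennreal (c * exp (- (real k powr \<alpha>))))"
proof (rule measure_eqI_countable[where A = UNIV])
  fix k
  have "emeasure (distr M (count_space UNIV) (X i)) {k} = emeasure M {\<omega> \<in> space M. X i \<omega> = k}"
    using assms by (subst emeasure_distr) (auto intro!: arg_cong[where f = "emeasure M"])
  also have "\<dots> = ennreal (c * exp (- (real k powr \<alpha>)))"
    using dist[OF assms, of k] by (simp add: emeasure_eq_measure)
  also have "\<dots> = emeasure (density (count_space UNIV) (\<lambda>k. ennreal (c * exp (- (real k powr \<alpha>))))) {k}"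
    by (simp add: emeasure_density nn_integral_count_space_indicator[symmetric])
  finally show "emeasure (distr M (count_space UNIV) (X i)) {k} = \<dots>" .
qed auto

lemma integrable_X:
  fixes g :: "nat \<Rightarrow> real"
  assumes "1 \<le> i" "summable (\<lambda>k. \<bar>g k\<bar> * exp (- (real k powr \<alpha>)))"
  shows "integrable M (\<lambda>\<omega>. g (X i \<omega>))"
proof -
  have "integrable (distr M (count_space UNIV) (X i)) g"
    unfolding distr_X[OF assms(1)]
    using summable_mult[OF assms(2), of c] c_pos
    by (subst integrable_density)
      (auto simp: integrable_count_space_nat_iff abs_mult ac_simps)
  then show ?thesis
    using assms(1) by (subst (asm) integrable_distr_eq) auto
qed

lemma expectation_X:
  fixes g :: "nat \<Rightarrow> real"
  assumes "1 \<le> i"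
  shows "expectation (\<lambda>\<omega>. g (X i \<omega>)) = expectation (\<lambda>\<omega>. g (X 1 \<omega>))"
proof -
  have "expectation (\<lambda>\<omega>. g (X j \<omega>)) = integral\<^sup>L (distr M (count_space UNIV) (X j)) g" if "1 \<le> j" for j
    using that by (subst integral_distr) auto
  then show ?thesis using assms distr_X by simp
qed

text \<open>The integrand may use up a fraction q < 1 of the exponent k^\<alpha>: q = 0 for moments,
  q = 1/2 for tilted weights, q = 1 - \<eta> for tails.\<close>

lemma integrable_X_bound:
  fixes g :: "nat \<Rightarrow> real"
  assumes "1 \<le> i" "q < 1" "\<And>k. \<bar>g k\<bar> \<le> C * (1 + real k)\<^sup>2 * exp (q * real k powr \<alpha>)"
  shows "integrable M (\<lambda>\<omega>. g (X i \<omega>))"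
proof (rule integrable_X[OF assms(1)])
  have "summable (\<lambda>k. C * ((1 + real k)\<^sup>2 * exp (- (1 - q) * (real k powr \<alpha>))))"
    using assms by (intro summable_mult summable_poly_stretched_exp alpha) auto
  moreover have "\<bar>g k\<bar> * exp (- (real k powr \<alpha>)) \<le> C * ((1 + real k)\<^sup>2 * exp (- (1 - q) * (real k powr \<alpha>)))" for k
  proof -
    have "\<bar>g k\<bar> * exp (- (real k powr \<alpha>)) \<le> C * (1 + real k)\<^sup>2 * exp (q * real k powr \<alpha>) * exp (- (real k powr \<alpha>))"
      by (intro mult_right_mono assms) auto
    also have "\<dots> = C * ((1 + real k)\<^sup>2 * exp (- (1 - q) * (real k powr \<alpha>)))"
      by (simp add: algebra_simps exp_add[symmetric])
    finally show ?thesis .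
  qed
  ultimately show "summable (\<lambda>k. \<bar>g k\<bar> * exp (- (real k powr \<alpha>)))"
    by (metis (no_types, lifting) abs_ge_zero abs_mult_pos abs_of_nonneg exp_ge_zero mult_nonneg_nonneg
      real_norm_def summable_comparison_test')
qed

lemma integrable_poly:
  fixes g :: "nat \<Rightarrow> real"
  assumes "1 \<le> i" "\<And>k. \<bar>g k\<bar> \<le> C * (1 + real k)\<^sup>2"
  shows "integrable M (\<lambda>\<omega>. g (X i \<omega>))"
  by (rule integrable_X_bound[where q = 0 and C = C]) (use assms in auto)

lemma integrable_Xi: "1 \<le> i \<Longrightarrow> integrable M (\<lambda>\<omega>. real (X i \<omega>))"
  by (rule integrable_poly[where C = 1]) (auto simp: power2_eq_square algebra_simps)

lemma integrable_sq: "1 \<le> i \<Longrightarrow> integrable M (\<lambda>\<omega>. (real (X i \<omega>) - \<mu>)\<^sup>2)"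
proof (rule integrable_poly[where C = "(1 + \<bar>\<mu>\<bar>)\<^sup>2" and g = "\<lambda>k. (real k - \<mu>)\<^sup>2"])
  fix k
  have "\<bar>real k - \<mu>\<bar> \<le> (1 + \<bar>\<mu>\<bar>) * (1 + real k)"
  proof -
    have "\<bar>real k - \<mu>\<bar> \<le> real k + \<bar>\<mu>\<bar>" "0 \<le> \<bar>\<mu>\<bar> * real k" by auto
    then show ?thesis by (simp only: distrib_left distrib_right)
  qed
  then have "\<bar>real k - \<mu>\<bar>\<^sup>2 \<le> ((1 + \<bar>\<mu>\<bar>) * (1 + real k))\<^sup>2"
    by (rule power_mono) simp
  then show "\<bar>(real k - \<mu>)\<^sup>2\<bar> \<le> (1 + \<bar>\<mu>\<bar>)\<^sup>2 * (1 + real k)\<^sup>2"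
    by (simp add: power_mult_distrib)
qed

lemma mean_nonneg: "0 \<le> \<mu>"
  unfolding mean by (rule integral_nonneg_AE) simp

lemma var_eq: "v = expectation (\<lambda>\<omega>. (real (X 1 \<omega>) - \<mu>)\<^sup>2)"
  by (simp add: var mean)

text \<open>A vanishing variance would make X_1 almost surely equal to \<mu>, but both 0 and 1 have
  positive probability.\<close>

lemma var_pos: "0 < v"
proof -
  have "v \<noteq> 0"
  proof
    assume "v = 0"
    then have "AE \<omega> in M. (real (X 1 \<omega>) - \<mu>)\<^sup>2 = 0"
      unfolding var_eq using integrable_sq[of 1] by (subst (asm) integral_nonneg_eq_0_iff_AE) auto
    then have ae: "AE \<omega> in M. real (X 1 \<omega>) = \<mu>" by simp
    have "\<mu> = real k" for k
    proof (rule ccontr)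
      assume "\<mu> \<noteq> real k"
      then have "AE \<omega> in M. X 1 \<omega> \<noteq> k" using ae by auto
      then have "\<P>(\<omega> in M. X 1 \<omega> = k) = 0"
        by (subst prob_eq_0) auto
      then show False using dist[of 1 k] c_pos by simp
    qed
    from this[of 0] this[of 1] show False by simp
  qed
  moreover have "0 \<le> v" unfolding var_eq by (rule integral_nonneg_AE) simp
  ultimately show ?thesis by simp
qed

section \<open>The scales m, r and a\<close>

definition m :: "nat \<Rightarrow> real" where "m n = real n powr \<gamma>"
definition r :: "nat \<Rightarrow> real" where "r n = real n powr (\<gamma> * \<alpha>)"
text \<open>The tilt \<theta> m / n equals \<theta> / a. The identities m = r * a and n = r * a^2
  below turn every exponent into a multiple of r.\<close>

definition a :: "nat \<Rightarrow> real" where "a n = real n / m n"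

lemma gamma_bounds: "1 / 2 < \<gamma>" "\<gamma> < 1"
  using alpha by (auto simp: gamma field_simps)

lemma gamma_eq: "2 * \<gamma> = 1 + \<gamma> * \<alpha>"
  using alpha by (simp add: gamma field_simps)

lemma m_pos: "1 \<le> n \<Longrightarrow> 1 \<le> m n"
  using gamma_bounds by (simp add: m_def ge_one_powr_ge_zero)

lemma r_pos: "1 \<le> n \<Longrightarrow> 1 \<le> r n"
  using gamma_bounds alpha by (simp add: r_def ge_one_powr_ge_zero)

lemma r_eq: "r n = m n powr \<alpha>"
  by (simp add: r_def m_def powr_powr)

lemma a_powr: "1 \<le> n \<Longrightarrow> a n = m n powr (1 - \<alpha>)"
proof -
  assume n: "1 \<le> n"
  have "a n = real n powr (1 - \<gamma>)"
    using n by (simp add: a_def m_def powr_diff)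
  also have "1 - \<gamma> = \<gamma> * (1 - \<alpha>)" using gamma_eq by (simp add: algebra_simps)
  finally show ?thesis by (simp add: m_def powr_powr)
qed

lemma a_pos: "1 \<le> n \<Longrightarrow> 1 \<le> a n"
  using m_pos[of n] alpha by (simp add: a_powr ge_one_powr_ge_zero)

lemma m_sq: "1 \<le> n \<Longrightarrow> m n * m n = real n * r n"
proof -
  assume n: "1 \<le> n"
  have "m n * m n = real n powr (1 + \<gamma> * \<alpha>)"
    using gamma_eq by (simp add: m_def powr_add[symmetric])
  then show ?thesis using n by (simp add: r_def powr_add)
qed

lemma m_eq: "1 \<le> n \<Longrightarrow> m n = r n * a n"
  using m_sq[of n] m_pos[of n] r_pos[of n] by (simp add: a_def field_simps)

lemma n_eq: "1 \<le> n \<Longrightarrow> real n = r n * (a n)\<^sup>2"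
  using m_eq[of n] m_pos[of n] r_pos[of n] by (simp add: a_def field_simps power2_eq_square)

lemma m_at_top: "filterlim m at_top sequentially"
  unfolding m_def using gamma_bounds by real_asymp

lemma r_at_top: "filterlim r at_top sequentially"
proof -
  have "0 < \<gamma> * \<alpha>" using gamma_bounds alpha by simp
  then show ?thesis unfolding r_def by real_asymp
qed

lemma a_at_top: "filterlim a at_top sequentially"
proof -
  have "filterlim (\<lambda>n. real n powr (1 - \<gamma>)) at_top sequentially"
    using gamma_bounds by real_asymp
  moreover have "eventually (\<lambda>n. real n powr (1 - \<gamma>) = a n) sequentially"
    using eventually_ge_at_top[of 1] by eventually_elim (simp add: a_def m_def powr_diff)
  ultimately show ?thesis by (rule filterlim_cong[OF refl refl, THEN iffD1, rotated])
qed

text \<open>Makes the n^k choices of positions for the k largest variables negligible at speed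
  r.\<close>

lemma ln_over_r: "(\<lambda>n. ln (real n) / r n) \<longlonglongrightarrow> 0"
proof -
  have "0 < \<gamma> * \<alpha>" using gamma_bounds alpha by simp
  then show ?thesis unfolding r_def by real_asymp
qed

end

subsection \<open>The truncated moment generating function\<close>

text \<open>Lagrange form of the remainder. Its quadratic factor is there to cancel the a^2 in the
  dominated convergence below.\<close>

lemma exp_minus_one_minus_le:
  fixes u :: real
  shows "\<bar>exp u - 1 - u\<bar> \<le> u\<^sup>2 * exp \<bar>u\<bar>"
proof -
  obtain t where t: "\<bar>t\<bar> \<le> \<bar>u\<bar>" "exp u = (\<Sum>k<2. u ^ k / fact k) + exp t / fact 2 * u ^ 2"
    using Maclaurin_exp_le[of u 2] by blast
  then have "exp u - 1 - u = exp t * u\<^sup>2 / 2"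
    by (simp add: numeral_2_eq_2)
  moreover have "exp t * u\<^sup>2 / 2 \<le> exp \<bar>u\<bar> * u\<^sup>2"
  proof -
    have "exp t * u\<^sup>2 \<le> exp \<bar>u\<bar> * u\<^sup>2" "0 \<le> exp t * u\<^sup>2"
      using t(1) by (auto intro!: mult_right_mono)
    then show ?thesis by linarith
  qed
  moreover have "0 \<le> exp t * u\<^sup>2 / 2" by simp
  ultimately show ?thesis by (simp only: abs_of_nonneg mult.commute)
qed

lemma tendsto_scaled_exp_remainder:
  fixes b :: real
  shows "((\<lambda>a. a\<^sup>2 * (exp (b / a) - 1 - b / a)) \<longlongrightarrow> b\<^sup>2 / 2) at_top"
  unfolding power2_eq_square by real_asymp

context stretched_exponential
begin

text \<open>Without the cut-off the expectation would be infinite for \<theta> > 0, because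
  k^\<alpha> grows more slowly than k. Putting the indicator into the weight lets a product of
  weights carry the event that all its variables are truncated.\<close>

definition trunc_weight :: "real \<Rightarrow> real \<Rightarrow> nat \<Rightarrow> nat \<Rightarrow> real" where
  "trunc_weight \<theta> \<delta> n k = (if real k \<le> \<delta> * m n then exp (\<theta> * (real k - \<mu>) / a n) else 0)"

definition trunc_mgf :: "real \<Rightarrow> real \<Rightarrow> nat \<Rightarrow> real" where
  "trunc_mgf \<theta> \<delta> n = expectation (\<lambda>\<omega>. trunc_weight \<theta> \<delta> n (X 1 \<omega>))"

lemma trunc_weight_nonneg: "0 \<le> trunc_weight \<theta> \<delta> n k"
  by (simp add: trunc_weight_def)

text \<open>The constant 1/2 in the condition on \<delta> leaves half of the decay exp(-k^\<alpha>)
  for integrability uniformly in n. The centring costs only a bounded term, since a n \<ge>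
  1.\<close>

lemma exponent_bound:
  assumes n: "1 \<le> n" and \<delta>: "0 < \<delta>" "\<bar>\<theta>\<bar> * \<delta> powr (1 - \<alpha>) \<le> 1 / 2" and k: "real k \<le> \<delta> * m n"
  shows "\<bar>\<theta> * (real k - \<mu>) / a n\<bar> \<le> real k powr \<alpha> / 2 + \<bar>\<theta>\<bar> * \<mu>"
proof -
  have "real k / a n \<le> \<delta> powr (1 - \<alpha>) * real k powr \<alpha>"
  proof (cases "k = 0")
    case False
    have "real k = real k powr (1 - \<alpha>) * real k powr \<alpha>"
      using False by (simp add: powr_add[symmetric])
    also have "\<dots> \<le> (\<delta> * m n) powr (1 - \<alpha>) * real k powr \<alpha>"
      using k alpha by (intro mult_right_mono powr_mono2) auto
    also have "\<dots> = \<delta> powr (1 - \<alpha>) * a n * real k powr \<alpha>"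
      using \<delta> m_pos[OF n] by (simp add: powr_mult a_powr[OF n])
    finally show ?thesis using a_pos[OF n] by (simp add: field_simps)
  qed (use \<delta> in auto)
  then have "\<bar>\<theta>\<bar> * (real k / a n) \<le> \<bar>\<theta>\<bar> * \<delta> powr (1 - \<alpha>) * real k powr \<alpha>"
    by (metis abs_ge_zero mult.assoc mult_left_mono)
  also have "\<dots> \<le> 1 / 2 * real k powr \<alpha>"
    by (intro mult_right_mono \<delta>) simp
  finally have 1: "\<bar>\<theta>\<bar> * (real k / a n) \<le> real k powr \<alpha> / 2" by simp
  have "\<bar>\<theta>\<bar> * (\<mu> / a n) \<le> \<bar>\<theta>\<bar> * \<mu>"
    using a_pos[OF n] mean_nonneg mult_left_mono[of 1 "a n" \<mu>]
    by (intro mult_left_mono) (auto simp: divide_le_eq)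
  moreover have "\<bar>\<theta> * (real k - \<mu>) / a n\<bar> \<le> \<bar>\<theta>\<bar> * (real k / a n) + \<bar>\<theta>\<bar> * (\<mu> / a n)"
  proof -
    have "\<bar>\<theta> * (real k - \<mu>) / a n\<bar> = \<bar>\<theta>\<bar> * (\<bar>real k - \<mu>\<bar> / a n)"
      using a_pos[OF n] by (simp add: abs_mult)
    also have "\<dots> \<le> \<bar>\<theta>\<bar> * ((real k + \<mu>) / a n)"
      using a_pos[OF n] mean_nonneg by (intro mult_left_mono divide_right_mono) auto
    finally show ?thesis by (simp add: algebra_simps add_divide_distrib)
  qed
  ultimately show ?thesis using 1 by linarith
qed

lemma trunc_weight_le:
  assumes n: "1 \<le> n" and \<delta>: "0 < \<delta>" "\<bar>\<theta>\<bar> * \<delta> powr (1 - \<alpha>) \<le> 1 / 2"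
  shows "trunc_weight \<theta> \<delta> n k \<le> exp (\<bar>\<theta>\<bar> * \<mu>) * exp (1 / 2 * real k powr \<alpha>)"
proof (cases "real k \<le> \<delta> * m n")
  case True
  from exponent_bound[OF n \<delta> True]
  have "\<theta> * (real k - \<mu>) / a n \<le> \<bar>\<theta>\<bar> * \<mu> + 1 / 2 * real k powr \<alpha>" by linarith
  then show ?thesis using True
    by (simp add: trunc_weight_def exp_add[symmetric])
qed (simp add: trunc_weight_def)

lemma integrable_trunc_weight:
  assumes n: "1 \<le> n" and \<delta>: "0 < \<delta>" "\<bar>\<theta>\<bar> * \<delta> powr (1 - \<alpha>) \<le> 1 / 2" and i: "1 \<le> i"
  shows "integrable M (\<lambda>\<omega>. trunc_weight \<theta> \<delta> n (X i \<omega>))"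
proof (rule integrable_X_bound[OF i, where q = "1/2" and C = "exp (\<bar>\<theta>\<bar> * \<mu>)"])
  fix k
  have "1 \<le> (1 + real k)\<^sup>2" by (simp add: power2_eq_square algebra_simps)
  then have "exp (\<bar>\<theta>\<bar> * \<mu>) * 1 * exp (1 / 2 * real k powr \<alpha>)
     \<le> exp (\<bar>\<theta>\<bar> * \<mu>) * (1 + real k)\<^sup>2 * exp (1 / 2 * real k powr \<alpha>)"
    by (intro mult_right_mono mult_left_mono) auto
  then show "\<bar>trunc_weight \<theta> \<delta> n k\<bar> \<le> exp (\<bar>\<theta>\<bar> * \<mu>) * (1 + real k)\<^sup>2 * exp (1 / 2 * real k powr \<alpha>)"
    using trunc_weight_le[OF n \<delta>, of k] trunc_weight_nonneg[of \<theta> \<delta> n k] by linarith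
qed simp

text \<open>Dominated convergence: on \<open>k \<le> \<delta> m\<close> the condition on \<open>\<delta>\<close> keeps the exponent below \<open>k\<^sup>\<alpha> / 2\<close>,
  half the decay rate of the law of \<open>X\<^sub>1\<close>, and on \<open>k > \<delta> m\<close> the factor \<open>a\<^sup>2\<close> is at most
  \<open>(k / \<delta>)\<^sup>2\<close>.\<close>

lemma tendsto_trunc_mgf_minus_1:
  assumes \<delta>: "0 < \<delta>" "\<bar>\<theta>\<bar> * \<delta> powr (1 - \<alpha>) \<le> 1 / 2"
  shows "(\<lambda>n. (a n)\<^sup>2 * (trunc_mgf \<theta> \<delta> n - 1)) \<longlonglongrightarrow> \<theta>\<^sup>2 * v / 2"
proof -
  \<comment> \<open>The subtracted first order term has mean zero by the choice of \<mu>, so the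
    expectation of \<open>g n (X 1 \<omega>)\<close> is the quantity whose limit is sought.\<close>
  define g where "g n k = (a n)\<^sup>2 * (trunc_weight \<theta> \<delta> n k - 1 - \<theta> * (real k - \<mu>) / a n)" for n k
  \<comment> \<open>The first summand serves k \<le> \<delta> * m n, through the Taylor remainder;
    the other two serve larger k, where the weight vanishes.\<close>
  define B where "B k = (\<theta> * (real k - \<mu>))\<^sup>2 * (exp (\<bar>\<theta>\<bar> * \<mu>) * exp (1 / 2 * real k powr \<alpha>)) +
     (1 + real k / \<delta>)\<^sup>2 + (1 + real k / \<delta>) * \<bar>\<theta> * (real k - \<mu>)\<bar>" for k
  have lin: "\<bar>real k - \<mu>\<bar> \<le> (1 + \<mu>) * (1 + real k)" for k
  proof -
    have "\<bar>real k - \<mu>\<bar> \<le> real k + \<mu>" "0 \<le> \<mu> * real k" using mean_nonneg by auto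
    then show ?thesis by (simp only: distrib_left distrib_right)
  qed
  have lin2: "1 + real k / \<delta> \<le> (1 + 1 / \<delta>) * (1 + real k)" for k
  proof -
    have "0 \<le> real k / \<delta>" "0 \<le> 1 / \<delta>" using \<delta> by auto
    then show ?thesis by (simp add: distrib_left distrib_right)
  qed
  have B_int: "integrable M (\<lambda>\<omega>. B (X 1 \<omega>))"
  proof (rule integrable_X_bound[where q = "1/2" and
      C = "\<theta>\<^sup>2 * (1 + \<mu>)\<^sup>2 * exp (\<bar>\<theta>\<bar> * \<mu>) + (1 + 1 / \<delta>)\<^sup>2 + (1 + 1 / \<delta>) * \<bar>\<theta>\<bar> * (1 + \<mu>)"])
    fix k
    let ?e = "exp (1 / 2 * real k powr \<alpha>)"
    have e: "1 \<le> ?e" by simp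
    have sq: "(real k - \<mu>)\<^sup>2 \<le> (1 + \<mu>)\<^sup>2 * (1 + real k)\<^sup>2"
      using power_mono[OF lin[of k], of 2] by (simp add: power_mult_distrib)
    have "(\<theta> * (real k - \<mu>))\<^sup>2 * (exp (\<bar>\<theta>\<bar> * \<mu>) * ?e)
        \<le> (\<theta>\<^sup>2 * (1 + \<mu>)\<^sup>2 * (1 + real k)\<^sup>2) * (exp (\<bar>\<theta>\<bar> * \<mu>) * ?e)"
      using mult_left_mono[OF sq, of "\<theta>\<^sup>2"]
      by (intro mult_right_mono) (auto simp: power_mult_distrib mult_ac)
    moreover have "(1 + real k / \<delta>)\<^sup>2 \<le> (1 + 1 / \<delta>)\<^sup>2 * (1 + real k)\<^sup>2 * ?e"
    proof -
      have "(1 + real k / \<delta>)\<^sup>2 \<le> ((1 + 1 / \<delta>) * (1 + real k))\<^sup>2"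
        using lin2 \<delta> by (intro power_mono) auto
      also have "\<dots> = (1 + 1 / \<delta>)\<^sup>2 * (1 + real k)\<^sup>2 * 1" by (simp add: power_mult_distrib)
      also have "\<dots> \<le> (1 + 1 / \<delta>)\<^sup>2 * (1 + real k)\<^sup>2 * ?e"
        by (intro mult_left_mono e) auto
      finally show ?thesis .
    qed
    moreover have "(1 + real k / \<delta>) * \<bar>\<theta> * (real k - \<mu>)\<bar>
       \<le> ((1 + 1 / \<delta>) * \<bar>\<theta>\<bar> * (1 + \<mu>)) * (1 + real k)\<^sup>2 * ?e"
    proof -
      have "(1 + real k / \<delta>) * (\<bar>\<theta>\<bar> * \<bar>real k - \<mu>\<bar>)
          \<le> ((1 + 1 / \<delta>) * (1 + real k)) * (\<bar>\<theta>\<bar> * ((1 + \<mu>) * (1 + real k)))"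
        using lin lin2 \<delta> by (intro mult_mono) auto
      also have "\<dots> = ((1 + 1 / \<delta>) * \<bar>\<theta>\<bar> * (1 + \<mu>)) * (1 + real k)\<^sup>2 * 1"
        by (simp add: power2_eq_square mult_ac)
      also have "\<dots> \<le> ((1 + 1 / \<delta>) * \<bar>\<theta>\<bar> * (1 + \<mu>)) * (1 + real k)\<^sup>2 * ?e"
        using mean_nonneg \<delta> by (intro mult_left_mono e) auto
      finally show ?thesis by (simp add: abs_mult)
    qed
    ultimately have "B k \<le> (\<theta>\<^sup>2 * (1 + \<mu>)\<^sup>2 * (1 + real k)\<^sup>2) * (exp (\<bar>\<theta>\<bar> * \<mu>) * ?e)
          + (1 + 1 / \<delta>)\<^sup>2 * (1 + real k)\<^sup>2 * ?e
          + ((1 + 1 / \<delta>) * \<bar>\<theta>\<bar> * (1 + \<mu>)) * (1 + real k)\<^sup>2 * ?e"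
      unfolding B_def by (intro add_mono)
    also have "\<dots> = (\<theta>\<^sup>2 * (1 + \<mu>)\<^sup>2 * exp (\<bar>\<theta>\<bar> * \<mu>) + (1 + 1 / \<delta>)\<^sup>2 + (1 + 1 / \<delta>) * \<bar>\<theta>\<bar> * (1 + \<mu>))
        * (1 + real k)\<^sup>2 * ?e"
      by (simp add: algebra_simps)
    finally show "\<bar>B k\<bar> \<le> \<dots>" using \<delta> by (simp add: B_def)
  qed auto
  have bound: "\<bar>g n k\<bar> \<le> B k" if n: "1 \<le> n" for n k
  proof (cases "real k \<le> \<delta> * m n")
    case True
    let ?b = "\<theta> * (real k - \<mu>)"
    have a: "a n \<noteq> 0" using a_pos[OF n] by simp
    have "\<bar>g n k\<bar> = (a n)\<^sup>2 * \<bar>exp (?b / a n) - 1 - ?b / a n\<bar>"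
      using True by (simp add: g_def trunc_weight_def abs_mult)
    also have "\<dots> \<le> (a n)\<^sup>2 * ((?b / a n)\<^sup>2 * exp \<bar>?b / a n\<bar>)"
      by (intro mult_left_mono exp_minus_one_minus_le) simp
    also have "\<dots> = ?b\<^sup>2 * exp \<bar>?b / a n\<bar>"
      using a by (simp add: power_divide)
    also have "\<dots> \<le> ?b\<^sup>2 * exp (real k powr \<alpha> / 2 + \<bar>\<theta>\<bar> * \<mu>)"
      using exponent_bound[OF n \<delta> True] by (intro mult_left_mono) auto
    also have "\<dots> = ?b\<^sup>2 * (exp (\<bar>\<theta>\<bar> * \<mu>) * exp (1 / 2 * real k powr \<alpha>))"
      by (simp add: exp_add mult_ac)
    also have "\<dots> \<le> B k" using \<delta> by (simp add: B_def)
    finally show ?thesis .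
  next
    case False
    let ?b = "\<theta> * (real k - \<mu>)"
    have a: "1 \<le> a n" using a_pos[OF n] by simp
    have "m n \<le> real k / \<delta>" using False \<delta> by (simp add: field_simps)
    moreover have "a n \<le> m n"
      using m_eq[OF n] r_pos[OF n] a by (simp add: mult_le_cancel_right1)
    ultimately have ak: "a n \<le> 1 + real k / \<delta>" by simp
    have "\<bar>g n k\<bar> = \<bar>- (a n)\<^sup>2 - a n * ?b\<bar>"
    proof -
      have "(a n)\<^sup>2 * (0 - 1 - ?b / a n) = - (a n)\<^sup>2 - a n * ?b"
        using a by (simp add: power2_eq_square field_simps)
      then show ?thesis using False by (simp add: g_def trunc_weight_def)
    qed
    also have "\<dots> \<le> (a n)\<^sup>2 + a n * \<bar>?b\<bar>"
      using a abs_triangle_ineq4[of "- (a n)\<^sup>2" "a n * ?b"] by (simp add: abs_mult)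
    also have "\<dots> \<le> (1 + real k / \<delta>)\<^sup>2 + (1 + real k / \<delta>) * \<bar>?b\<bar>"
      using a ak by (intro add_mono mult_right_mono power_mono) auto
    also have "\<dots> \<le> B k" by (simp add: B_def)
    finally show ?thesis .
  qed
  have lim: "(\<lambda>n. g n k) \<longlonglongrightarrow> (\<theta> * (real k - \<mu>))\<^sup>2 / 2" for k
  proof (rule Lim_transform_eventually)
    show "(\<lambda>n. (a n)\<^sup>2 * (exp (\<theta> * (real k - \<mu>) / a n) - 1 - \<theta> * (real k - \<mu>) / a n))
        \<longlonglongrightarrow> (\<theta> * (real k - \<mu>))\<^sup>2 / 2"
      using filterlim_compose[OF tendsto_scaled_exp_remainder a_at_top] .
    have "eventually (\<lambda>n. real k / \<delta> \<le> m n) sequentially"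
      using m_at_top by (simp add: filterlim_at_top)
    then show "\<forall>\<^sub>F n in sequentially. (a n)\<^sup>2 * (exp (\<theta> * (real k - \<mu>) / a n) - 1 - \<theta> * (real k - \<mu>) / a n) = g n k"
      by eventually_elim (use \<delta> in \<open>simp add: g_def trunc_weight_def field_simps\<close>)
  qed
  \<comment> \<open>The majorant holds for n \<ge> 1 only, hence the shift of the index.\<close>
  have lim1: "(\<lambda>n. g (n + 1) k) \<longlonglongrightarrow> (\<theta> * (real k - \<mu>))\<^sup>2 / 2" for k
    by (rule LIMSEQ_ignore_initial_segment[OF lim])
  have "(\<lambda>n. expectation (\<lambda>\<omega>. g (n + 1) (X 1 \<omega>))) \<longlonglongrightarrow> expectation (\<lambda>\<omega>. (\<theta> * (real (X 1 \<omega>) - \<mu>))\<^sup>2 / 2)"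
  proof (rule integral_dominated_convergence[where w = "\<lambda>\<omega>. B (X 1 \<omega>)"])
    show "AE \<omega> in M. (\<lambda>n. g (n + 1) (X 1 \<omega>)) \<longlonglongrightarrow> (\<theta> * (real (X 1 \<omega>) - \<mu>))\<^sup>2 / 2"
      by (intro AE_I2 lim1)
    show "AE \<omega> in M. norm (g (n + 1) (X 1 \<omega>)) \<le> B (X 1 \<omega>)" for n
      using bound[of "n + 1"] by simp
  qed (use B_int in auto)
  moreover have "expectation (\<lambda>\<omega>. g (n + 1) (X 1 \<omega>)) = (a (n + 1))\<^sup>2 * (trunc_mgf \<theta> \<delta> (n + 1) - 1)" for n
  proof -
    have "expectation (\<lambda>\<omega>. \<theta> * (real (X 1 \<omega>) - \<mu>) / a (n + 1)) = 0"
      using integrable_Xi[of 1] by (simp add: mean prob_space)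
    then show ?thesis
      using integrable_trunc_weight[OF _ \<delta>, of "n + 1" 1] integrable_Xi[of 1]
      by (simp add: g_def trunc_mgf_def prob_space)
  qed
  moreover have "expectation (\<lambda>\<omega>. (\<theta> * (real (X 1 \<omega>) - \<mu>))\<^sup>2 / 2) = \<theta>\<^sup>2 * v / 2"
    by (simp add: power_mult_distrib var_eq)
  ultimately have "(\<lambda>n. (a (n + 1))\<^sup>2 * (trunc_mgf \<theta> \<delta> (n + 1) - 1)) \<longlonglongrightarrow> \<theta>\<^sup>2 * v / 2"
    by simp
  then show ?thesis by (rule LIMSEQ_offset)
qed

text \<open>As a n tends to infinity, p = \<open>trunc_mgf \<theta> \<delta> n\<close> tends to 1,
  and (p - 1) / p \<le> ln p \<le> p - 1 transfers the limit from p - 1 to ln p. Since n = r * a^2,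
  the n-th power of p then has exponent r (\<theta>^2 v / 2 + o(1)).\<close>

lemma tendsto_ln_trunc_mgf:
  assumes \<delta>: "0 < \<delta>" "\<bar>\<theta>\<bar> * \<delta> powr (1 - \<alpha>) \<le> 1 / 2"
  shows "(\<lambda>n. (a n)\<^sup>2 * ln (trunc_mgf \<theta> \<delta> n)) \<longlonglongrightarrow> \<theta>\<^sup>2 * v / 2"
    and "eventually (\<lambda>n. 0 < trunc_mgf \<theta> \<delta> n) sequentially"
proof -
  note lim = tendsto_trunc_mgf_minus_1[OF \<delta>]
  have "(\<lambda>n. (a n)\<^sup>2 * (trunc_mgf \<theta> \<delta> n - 1) * inverse ((a n)\<^sup>2)) \<longlonglongrightarrow> \<theta>\<^sup>2 * v / 2 * 0"
    by (intro tendsto_mult lim tendsto_inverse_0_at_top filterlim_pow_at_top a_at_top) simp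
  moreover have "eventually (\<lambda>n. (a n)\<^sup>2 * (trunc_mgf \<theta> \<delta> n - 1) * inverse ((a n)\<^sup>2) = trunc_mgf \<theta> \<delta> n - 1) sequentially"
    using eventually_ge_at_top[of 1]
  proof eventually_elim
    case (elim n)
    with a_pos[of n] show ?case by simp
  qed
  ultimately have "(\<lambda>n. trunc_mgf \<theta> \<delta> n - 1) \<longlonglongrightarrow> 0"
    using Lim_transform_eventually by fastforce
  from tendsto_add[OF this tendsto_const[of 1]]
  have one: "(\<lambda>n. trunc_mgf \<theta> \<delta> n) \<longlonglongrightarrow> 1" by simp
  then show pos: "eventually (\<lambda>n. 0 < trunc_mgf \<theta> \<delta> n) sequentially"
    by (rule order_tendstoD) simp
  show "(\<lambda>n. (a n)\<^sup>2 * ln (trunc_mgf \<theta> \<delta> n)) \<longlonglongrightarrow> \<theta>\<^sup>2 * v / 2"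
  proof (rule tendsto_sandwich[OF _ _ _ lim])
    show "\<forall>\<^sub>F n in sequentially. (a n)\<^sup>2 * ln (trunc_mgf \<theta> \<delta> n) \<le> (a n)\<^sup>2 * (trunc_mgf \<theta> \<delta> n - 1)"
      using pos by eventually_elim (intro mult_left_mono ln_le_minus_one, auto)
    show "\<forall>\<^sub>F n in sequentially. (a n)\<^sup>2 * (trunc_mgf \<theta> \<delta> n - 1) / trunc_mgf \<theta> \<delta> n \<le> (a n)\<^sup>2 * ln (trunc_mgf \<theta> \<delta> n)"
      using pos
    proof eventually_elim
      case (elim n)
      let ?p = "trunc_mgf \<theta> \<delta> n"
      have "ln (1 / ?p) \<le> 1 / ?p - 1" using elim by (intro ln_le_minus_one) simp
      then have "(?p - 1) / ?p \<le> ln ?p" using elim by (simp add: ln_div field_simps)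
      from mult_left_mono[OF this, of "(a n)\<^sup>2"] show ?case by simp
    qed
    show "(\<lambda>n. (a n)\<^sup>2 * (trunc_mgf \<theta> \<delta> n - 1) / trunc_mgf \<theta> \<delta> n) \<longlonglongrightarrow> \<theta>\<^sup>2 * v / 2"
      using tendsto_divide[OF lim one] by simp
  qed
qed

end

subsection \<open>Order statistics\<close>

lemma rev_order_stat_permutation:
  obtains \<pi> where "bij_betw \<pi> {..<n} {1..n}"
    "\<And>j. j < n \<Longrightarrow> rev_order_stat X (j + 1) n \<omega> = X (\<pi> j) \<omega>"
proof -
  let ?l = "map (\<lambda>i. X i \<omega>) [1..<n + 1]"
  obtain f where f: "bij_betw f {..<n} {..<n}" "\<And>j. j < n \<Longrightarrow> rev (sort ?l) ! j = ?l ! f j"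
    using permutation_Ex_bij[of "rev (sort ?l)" ?l] by (auto simp del: upt_Suc)
  \<comment> \<open>\<open>Suc\<close> moves list positions 0, ..., n - 1 to variable indices 1,
    ..., n.\<close>
  have "bij_betw (Suc \<circ> f) {..<n} {1..n}"
    using f(1) by (rule bij_betw_trans) (auto simp: bij_betw_def lessThan_atLeast0 image_Suc_atLeastLessThan
      atLeastLessThanSuc_atLeastAtMost)
  moreover have "rev_order_stat X (j + 1) n \<omega> = X ((Suc \<circ> f) j) \<omega>" if "j < n" for j
  proof -
    have "f j < n" using f(1) that by (auto simp: bij_betw_def)
    then show ?thesis using f(2)[OF that] that by (simp add: rev_order_stat_def del: upt_Suc)
  qed
  ultimately show ?thesis using that by blast
qed

lemma rev_order_stat_zero: "n \<le> j \<Longrightarrow> rev_order_stat X (j + 1) n \<omega> = 0"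
  by (simp add: rev_order_stat_def)

lemma rev_order_stat_antimono:
  assumes "i \<le> j"
  shows "rev_order_stat X (j + 1) n \<omega> \<le> rev_order_stat X (i + 1) n \<omega>"
proof (cases "n = 0")
  case False
  \<comment> \<open>With exponent 0 the scaling divides by \<open>real n powr 0\<close>, which is 1
    for n > 0 but 0 for n = 0; hence the case distinction.\<close>
  have "scaled_order_stats X 0 n \<omega> j \<le> scaled_order_stats X 0 n \<omega> i"
    using scaled_order_stats_in_decseqs[of X 0 n \<omega>] assms by (auto simp: decseqs_def decseq_def)
  then show ?thesis using False by (simp add: scaled_order_stats_def)
qed (simp add: rev_order_stat_def)

text \<open>If the statistic of rank j + 1 were below u, every variable reaching u would have one of
  the first j ranks. This and its dual below locate order statistics by counting alone.\<close>

lemma rev_order_stat_geI: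
  assumes "j < card {i \<in> {1..n}. u \<le> real (X i \<omega>)}"
  shows "u \<le> real (rev_order_stat X (j + 1) n \<omega>)"
proof (rule ccontr)
  assume *: "\<not> u \<le> real (rev_order_stat X (j + 1) n \<omega>)"
  obtain \<pi> where \<pi>: "bij_betw \<pi> {..<n} {1..n}"
    "\<And>j. j < n \<Longrightarrow> rev_order_stat X (j + 1) n \<omega> = X (\<pi> j) \<omega>"
    using rev_order_stat_permutation[of n X \<omega>] by blast
  have "{i \<in> {1..n}. u \<le> real (X i \<omega>)} \<subseteq> \<pi> ` {..<j}"
  proof safe
    fix i assume i: "i \<in> {1..n}" "u \<le> real (X i \<omega>)"
    then have "i \<in> \<pi> ` {..<n}" using bij_betw_imp_surj_on[OF \<pi>(1)] by simp
    then obtain l where l: "l < n" "i = \<pi> l" by auto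
    have "l < j"
    proof (rule ccontr)
      assume "\<not> l < j"
      then have "rev_order_stat X (l + 1) n \<omega> \<le> rev_order_stat X (j + 1) n \<omega>"
        by (intro rev_order_stat_antimono) simp
      then show False using * i l \<pi>(2)[OF l(1)] by simp
    qed
    then show "i \<in> \<pi> ` {..<j}" using l by auto
  qed
  then have "card {i \<in> {1..n}. u \<le> real (X i \<omega>)} \<le> card (\<pi> ` {..<j})"
    by (intro card_mono) auto
  also have "\<dots> \<le> j"
    using card_image_le[of "{..<j}" \<pi>] by simp
  finally have "card {i \<in> {1..n}. u \<le> real (X i \<omega>)} \<le> j" .
  then show False using assms by simp
qed

lemma rev_order_stat_leI:
  assumes "0 \<le> u" "card {i \<in> {1..n}. u < real (X i \<omega>)} \<le> j"
  shows "real (rev_order_stat X (j + 1) n \<omega>) \<le> u"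
proof (rule ccontr)
  assume *: "\<not> real (rev_order_stat X (j + 1) n \<omega>) \<le> u"
  \<comment> \<open>Beyond rank n the statistic is 0 by convention, which cannot exceed u \<ge>
    0.\<close>
  then have j: "j < n" using assms(1) rev_order_stat_zero[of n j X \<omega>] by (cases "j < n") auto
  obtain \<pi> where \<pi>: "bij_betw \<pi> {..<n} {1..n}"
    "\<And>j. j < n \<Longrightarrow> rev_order_stat X (j + 1) n \<omega> = X (\<pi> j) \<omega>"
    using rev_order_stat_permutation[of n X \<omega>] by blast
  have "\<pi> ` {..j} \<subseteq> {i \<in> {1..n}. u < real (X i \<omega>)}"
  proof safe
    fix l assume l: "l \<le> j"
    then show "\<pi> l \<in> {1..n}" using \<pi>(1) j by (auto simp: bij_betw_def)
    have "rev_order_stat X (j + 1) n \<omega> \<le> rev_order_stat X (l + 1) n \<omega>"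
      using l by (rule rev_order_stat_antimono)
    then show "u < real (X (\<pi> l) \<omega>)" using * \<pi>(2)[of l] l j by simp
  qed
  then have "card (\<pi> ` {..j}) \<le> card {i \<in> {1..n}. u < real (X i \<omega>)}"
    by (intro card_mono) auto
  moreover have "inj_on \<pi> {..j}"
    using \<pi>(1) j by (auto simp: bij_betw_def intro: inj_on_subset)
  ultimately show False using assms(2) by (simp add: card_image)
qed

text \<open>The positions of the k largest variables are recorded by an extensional f, so that f
  ranges over a finite set of at most n^k functions and a union bound is possible.\<close>

lemma rev_order_stat_selection:
  assumes "k \<le> n"
  obtains f where "f \<in> {..<k} \<rightarrow>\<^sub>E {1..n}" "inj_on f {..<k}"
    "\<And>j. j < k \<Longrightarrow> X (f j) \<omega> = rev_order_stat X (j + 1) n \<omega>"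
    "\<And>i. i \<in> {1..n} - f ` {..<k} \<Longrightarrow> X i \<omega> \<le> rev_order_stat X (k + 1) n \<omega>"
proof -
  obtain \<pi> where \<pi>: "bij_betw \<pi> {..<n} {1..n}"
    "\<And>j. j < n \<Longrightarrow> rev_order_stat X (j + 1) n \<omega> = X (\<pi> j) \<omega>"
    using rev_order_stat_permutation[of n X \<omega>] by blast
  show ?thesis
  proof (rule that[of "restrict \<pi> {..<k}"])
    show "restrict \<pi> {..<k} \<in> {..<k} \<rightarrow>\<^sub>E {1..n}"
      using \<pi>(1) assms by (auto simp: bij_betw_def)
    show "inj_on (restrict \<pi> {..<k}) {..<k}"
      using \<pi>(1) assms by (auto simp: bij_betw_def intro: inj_on_subset)
    show "X (restrict \<pi> {..<k} j) \<omega> = rev_order_stat X (j + 1) n \<omega>" if "j < k" for j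
      using that assms \<pi>(2)[of j] by simp
    fix i assume i: "i \<in> {1..n} - restrict \<pi> {..<k} ` {..<k}"
    then have "i \<in> \<pi> ` {..<n}" using bij_betw_imp_surj_on[OF \<pi>(1)] by simp
    then obtain l where l: "l < n" "i = \<pi> l" by auto
    with i have "k \<le> l" by (auto simp: image_def not_less[symmetric])
    from rev_order_stat_antimono[OF this, of X n \<omega>] l \<pi>(2)[of l]
    show "X i \<omega> \<le> rev_order_stat X (k + 1) n \<omega>" by simp
  qed
qed

subsection \<open>Upper bound\<close>

context stretched_exponential
begin

lemma expectation_prod_X:
  fixes g :: "nat \<Rightarrow> nat \<Rightarrow> real"
  assumes "finite I" "I \<subseteq> {1..}" "\<And>i. i \<in> I \<Longrightarrow> integrable M (\<lambda>\<omega>. g i (X i \<omega>))"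
  shows "integrable M (\<lambda>\<omega>. \<Prod>i\<in>I. g i (X i \<omega>))"
    and "expectation (\<lambda>\<omega>. \<Prod>i\<in>I. g i (X i \<omega>)) = (\<Prod>i\<in>I. expectation (\<lambda>\<omega>. g i (X i \<omega>)))"
proof -
  have "indep_vars (\<lambda>_. borel) (\<lambda>i \<omega>. g i (X i \<omega>)) I"
    by (rule indep_vars_compose2[OF indep_vars_subset[OF indep assms(2)]]) simp
  then show "integrable M (\<lambda>\<omega>. \<Prod>i\<in>I. g i (X i \<omega>))"
    "expectation (\<lambda>\<omega>. \<Prod>i\<in>I. g i (X i \<omega>)) = (\<Prod>i\<in>I. expectation (\<lambda>\<omega>. g i (X i \<omega>)))"
    using assms by (auto intro!: indep_vars_integrable indep_vars_lebesgue_integral)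
qed

definition tail :: "real \<Rightarrow> real" where
  "tail u = \<P>(\<omega> in M. u \<le> real (X 1 \<omega>))"

text \<open>Markov's inequality for exp (q X_1^\<alpha>) with q < 1; at q = 1 its expectation is
  infinite. The loss \<eta> in the rate is removed at the very end of the upper bound.\<close>

lemma tail_le:
  assumes "0 < \<eta>"
  obtains K where "0 < K" "\<And>u. 0 \<le> u \<Longrightarrow> tail u \<le> K * exp (- (1 - \<eta>) * u powr \<alpha>)"
proof -
  \<comment> \<open>For \<eta> \<ge> 1 the exponent claimed is nonnegative and q = 0
    suffices.\<close>
  define q where "q = max 0 (1 - \<eta>)"
  define K where "K = expectation (\<lambda>\<omega>. exp (q * real (X 1 \<omega>) powr \<alpha>))"
  have int: "integrable M (\<lambda>\<omega>. exp (q * real (X 1 \<omega>) powr \<alpha>))"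
  proof (rule integrable_X_bound[where q = q and C = 1])
    fix k
    have "1 \<le> (1 + real k)\<^sup>2" by (simp add: power2_eq_square algebra_simps)
    then show "\<bar>exp (q * real k powr \<alpha>)\<bar> \<le> 1 * (1 + real k)\<^sup>2 * exp (q * real k powr \<alpha>)" by simp
  qed (use assms in \<open>auto simp: q_def\<close>)
  have "tail u \<le> max 1 K * exp (- (1 - \<eta>) * u powr \<alpha>)" if u: "0 \<le> u" for u
  proof -
    have "tail u \<le> \<P>(\<omega> in M. exp (q * u powr \<alpha>) \<le> exp (q * real (X 1 \<omega>) powr \<alpha>))"
      unfolding tail_def
    proof (rule finite_measure_mono)
      show "{\<omega> \<in> space M. u \<le> real (X 1 \<omega>)} \<subseteq> {\<omega> \<in> space M. exp (q * u powr \<alpha>) \<le> exp (q * real (X 1 \<omega>) powr \<alpha>)}"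
        using u alpha by (auto intro!: mult_left_mono powr_mono2 simp: q_def)
    qed auto
    also have "\<dots> \<le> K / exp (q * u powr \<alpha>)"
      unfolding K_def by (rule integral_Markov_inequality_measure[OF int, where A = "{}"]) auto
    also have "\<dots> = K * exp (- q * u powr \<alpha>)" by (simp add: exp_minus field_simps)
    also have "\<dots> \<le> max 1 K * exp (- (1 - \<eta>) * u powr \<alpha>)"
    proof (rule mult_mono)
      show "exp (- q * u powr \<alpha>) \<le> exp (- (1 - \<eta>) * u powr \<alpha>)"
        using mult_right_mono[of "1 - \<eta>" q "u powr \<alpha>"] by (simp add: q_def left_diff_distrib)
    qed auto
    finally show ?thesis .
  qed
  then show ?thesis using that[of "max 1 K"] by simp
qed

lemma partial_sum_split:
  assumes "f \<in> {..<k} \<rightarrow>\<^sub>E {1..n}" "inj_on f {..<k}"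
  shows "real (partial_sum X n \<omega>) = (\<Sum>j<k. real (X (f j) \<omega>)) + (\<Sum>i\<in>{1..n} - f ` {..<k}. real (X i \<omega>))"
proof -
  have "f ` {..<k} \<subseteq> {1..n}" using assms(1) by auto
  from sum.subset_diff[OF this, of "\<lambda>i. real (X i \<omega>)"] show ?thesis
    using assms(2) by (simp add: partial_sum_def sum.reindex)
qed

lemma partial_sum_measurable [measurable]: "(\<lambda>\<omega>. real (partial_sum X n \<omega>)) \<in> borel_measurable M"
  unfolding partial_sum_def of_nat_sum
  by (intro borel_measurable_sum measurable_compose[OF X_measurable]) auto

lemma scaled_order_stats_measurable [measurable]:
  "scaled_order_stats X \<gamma> n \<in> borel_measurable M"
proof -
  have "scaled_order_stats X \<gamma> n \<in> measurable M (restrict_space borel decseqs)"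
    by (rule measurable_scaled_order_stats) (rule X_measurable)
  then show ?thesis by (simp add: measurable_restrict_space2_iff)
qed

lemma scaled_order_stats_coordinate_measurable [measurable]:
  "(\<lambda>\<omega>. scaled_order_stats X \<gamma> n \<omega> j) \<in> borel_measurable M"
  by (rule measurable_product_then_coordinatewise) measurable

text \<open>The indicator of \<open>E\<close> is at most a sum over selections f of products of
  functions of single variables: a tail indicator at each selected position, a tilted truncated
  weight elsewhere. Independence then factorises the expectation, with the same value for every
  f.\<close>

lemma prob_order_stats_le:
  fixes x :: "nat \<Rightarrow> real" and s :: real
  assumes n: "1 \<le> n" "k \<le> n" and \<delta>: "0 < \<delta>" "\<bar>\<theta>\<bar> * \<delta> powr (1 - \<alpha>) \<le> 1 / 2" and \<epsilon>: "0 < \<epsilon>"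
  defines "E \<equiv> {\<omega> \<in> space M. (\<forall>j<k. \<bar>scaled_order_stats X \<gamma> n \<omega> j - x j\<bar> < \<epsilon>) \<and>
    scaled_order_stats X \<gamma> n \<omega> k \<le> \<delta> \<and> real (partial_sum X n \<omega>) = \<mu> * real n + s * real n powr \<gamma>}"
  shows "prob E \<le> real n ^ k * (\<Prod>j<k. tail (m n * max 0 (x j - \<epsilon>))) * trunc_mgf \<theta> \<delta> n ^ (n - k) *
    exp (r n * (- \<theta> * (s - (\<Sum>j<k. x j)) - \<theta> * \<mu> * k / (a n * r n) + \<bar>\<theta>\<bar> * k * \<epsilon>))"
proof -
  \<comment> \<open>On \<open>E\<close> the unselected variables sum to \<mu> n + s m minus the k
    largest, so the product of their weights is the exponential of \<theta> / a times s m + k \<mu>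
    minus the k largest, which are known up to an error k \<epsilon> m in total. \<open>C\<close>
    dominates the reciprocal of that product; recall a * r = m.\<close>
  define C where "C = exp (r n * (- \<theta> * (s - (\<Sum>j<k. x j)) - \<theta> * \<mu> * k / (a n * r n) + \<bar>\<theta>\<bar> * k * \<epsilon>))"
  \<comment> \<open>The cut at 0 drops the constraint for coordinates up to \<epsilon>, where the
    tail is 1.\<close>
  define u where "u j = m n * max 0 (x j - \<epsilon>)" for j
  define Fs where "Fs = {f \<in> {..<k} \<rightarrow>\<^sub>E {1..n}. inj_on f {..<k}}"
  \<comment> \<open>At a selected position the inverse of f recovers the rank and with it the
    threshold.\<close>
  define h where "h f i y = (if i \<in> f ` {..<k} then of_bool (u (inv_into {..<k} f i) \<le> real y)
     else trunc_weight \<theta> \<delta> n y)" for f :: "nat \<Rightarrow> nat" and i y :: nat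
  have finF: "finite Fs" unfolding Fs_def by (intro finite_subset[OF _ finite_PiE[of "{..<k}" "\<lambda>_. {1..n}"]]) auto
  have cardF: "card Fs \<le> n ^ k"
  proof -
    have "card Fs \<le> card ({..<k} \<rightarrow>\<^sub>E {1..n})"
      unfolding Fs_def by (intro card_mono finite_PiE) auto
    then show ?thesis by (simp add: card_PiE)
  qed
  have h_nonneg: "0 \<le> h f i y" for f i y by (simp add: h_def trunc_weight_nonneg)
  have h_int: "integrable M (\<lambda>\<omega>. h f i (X i \<omega>))" if "1 \<le> i" for f i
  proof (cases "i \<in> f ` {..<k}")
    case True
    then show ?thesis unfolding h_def using that
      by (simp, intro integrable_poly[where C = 1]) (auto simp: power2_eq_square algebra_simps)
  next
    case False
    then show ?thesis unfolding h_def using integrable_trunc_weight[OF n(1) \<delta> that] by simp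
  qed
  have h_exp: "expectation (\<lambda>\<omega>. \<Prod>i\<in>{1..n}. h f i (X i \<omega>)) = (\<Prod>j<k. tail (u j)) * trunc_mgf \<theta> \<delta> n ^ (n - k)"
    if f: "f \<in> Fs" for f
  proof -
    have sub: "f ` {..<k} \<subseteq> {1..n}" and inj: "inj_on f {..<k}" using f by (auto simp: Fs_def)
    have "expectation (\<lambda>\<omega>. \<Prod>i\<in>{1..n}. h f i (X i \<omega>)) = (\<Prod>i\<in>{1..n}. expectation (\<lambda>\<omega>. h f i (X i \<omega>)))"
      by (rule expectation_prod_X) (use h_int in auto)
    also have "\<dots> = (\<Prod>i\<in>{1..n}. expectation (\<lambda>\<omega>. h f i (X 1 \<omega>)))"
      by (intro prod.cong refl expectation_X) auto
    also have "\<dots> = (\<Prod>i\<in>{1..n} - f ` {..<k}. expectation (\<lambda>\<omega>. h f i (X 1 \<omega>))) *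
        (\<Prod>i\<in>f ` {..<k}. expectation (\<lambda>\<omega>. h f i (X 1 \<omega>)))"
      by (rule prod.subset_diff[OF sub]) simp
    also have "(\<Prod>i\<in>{1..n} - f ` {..<k}. expectation (\<lambda>\<omega>. h f i (X 1 \<omega>))) =
        (\<Prod>i\<in>{1..n} - f ` {..<k}. trunc_mgf \<theta> \<delta> n)"
      by (intro prod.cong) (auto simp: h_def trunc_mgf_def)
    also have "\<dots> = trunc_mgf \<theta> \<delta> n ^ (n - k)"
      using sub inj by (simp add: card_Diff_subset card_image)
    also have "(\<Prod>i\<in>f ` {..<k}. expectation (\<lambda>\<omega>. h f i (X 1 \<omega>))) =
        (\<Prod>j<k. expectation (\<lambda>\<omega>. h f (f j) (X 1 \<omega>)))"
      using inj by (simp add: prod.reindex)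
    also have "\<dots> = (\<Prod>j<k. tail (u j))"
    proof (intro prod.cong refl)
      fix j assume "j \<in> {..<k}"
      then have "expectation (\<lambda>\<omega>. h f (f j) (X 1 \<omega>)) = expectation (\<lambda>\<omega>. of_bool (u j \<le> real (X 1 \<omega>)))"
        using inj by (simp add: h_def)
      also have "\<dots> = expectation (indicator {\<omega> \<in> space M. u j \<le> real (X 1 \<omega>)})"
        by (intro Bochner_Integration.integral_cong) (auto simp: indicator_def)
      also have "\<dots> = tail (u j)" by (simp add: tail_def)
      finally show "expectation (\<lambda>\<omega>. h f (f j) (X 1 \<omega>)) = tail (u j)" .
    qed
    finally show ?thesis by (simp add: mult.commute)
  qed
  have pt: "indicator E \<omega> \<le> (\<Sum>f\<in>Fs. C * (\<Prod>i\<in>{1..n}. h f i (X i \<omega>)))" if "\<omega> \<in> space M" for \<omega>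
  proof (cases "\<omega> \<in> E")
    case False
    then show ?thesis using h_nonneg
      by (auto simp: C_def intro!: sum_nonneg mult_nonneg_nonneg prod_nonneg)
  next
    case True
    obtain f where f: "f \<in> {..<k} \<rightarrow>\<^sub>E {1..n}" "inj_on f {..<k}"
      "\<And>j. j < k \<Longrightarrow> X (f j) \<omega> = rev_order_stat X (j + 1) n \<omega>"
      "\<And>i. i \<in> {1..n} - f ` {..<k} \<Longrightarrow> X i \<omega> \<le> rev_order_stat X (k + 1) n \<omega>"
      using rev_order_stat_selection[OF n(2), of X \<omega>] by blast
    have mp: "1 \<le> m n" using m_pos[OF n(1)] .
    have sub: "f ` {..<k} \<subseteq> {1..n}" using f(1) by auto
    have so: "scaled_order_stats X \<gamma> n \<omega> j = real (rev_order_stat X (j + 1) n \<omega>) / m n" for j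
      by (simp add: scaled_order_stats_def m_def)
    have E1: "\<bar>real (X (f j) \<omega>) - m n * x j\<bar> \<le> m n * \<epsilon>" if "j < k" for j
    proof -
      have "\<bar>real (X (f j) \<omega>) / m n - x j\<bar> < \<epsilon>"
        using True that f(3)[OF that] by (auto simp: E_def so)
      then have "m n * \<bar>real (X (f j) \<omega>) / m n - x j\<bar> \<le> m n * \<epsilon>" using mp by simp
      also have "m n * \<bar>real (X (f j) \<omega>) / m n - x j\<bar> = \<bar>m n * (real (X (f j) \<omega>) / m n - x j)\<bar>"
        using mp by (simp add: abs_mult)
      also have "m n * (real (X (f j) \<omega>) / m n - x j) = real (X (f j) \<omega>) - m n * x j"
        using mp by (simp add: field_simps)
      finally show ?thesis .
    qed
    have E2: "real (X i \<omega>) \<le> \<delta> * m n" if "i \<in> {1..n} - f ` {..<k}" for i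
    proof -
      have "real (rev_order_stat X (k + 1) n \<omega>) \<le> \<delta> * m n"
        using True mp by (auto simp: E_def so field_simps)
      then show ?thesis using f(4)[OF that] by simp
    qed
    let ?R = "{1..n} - f ` {..<k}"
    have cardR: "real (card ?R) = real n - real k"
      using sub f(2) n(2) by (simp add: card_Diff_subset card_image of_nat_diff)
    have "(\<Prod>i\<in>{1..n}. h f i (X i \<omega>)) = (\<Prod>i\<in>?R. h f i (X i \<omega>)) * (\<Prod>i\<in>f ` {..<k}. h f i (X i \<omega>))"
      by (rule prod.subset_diff[OF sub]) simp
    also have "(\<Prod>i\<in>f ` {..<k}. h f i (X i \<omega>)) = 1"
    proof (intro prod.neutral ballI)
      fix i assume "i \<in> f ` {..<k}"
      then obtain j where j: "j < k" "i = f j" by auto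
      have "u j \<le> real (X (f j) \<omega>)"
      proof (cases "x j - \<epsilon> \<le> 0")
        case False
        then have "u j = m n * x j - m n * \<epsilon>" by (simp add: u_def algebra_simps)
        then show ?thesis using E1[OF j(1)] by simp
      qed (simp add: u_def)
      then show "h f i (X i \<omega>) = 1" using j f(2) by (simp add: h_def)
    qed
    also have "(\<Prod>i\<in>?R. h f i (X i \<omega>)) = (\<Prod>i\<in>?R. exp (\<theta> * (real (X i \<omega>) - \<mu>) / a n))"
      by (intro prod.cong refl) (use E2 in \<open>auto simp: h_def trunc_weight_def\<close>)
    also have "\<dots> = exp (\<Sum>i\<in>?R. \<theta> * (real (X i \<omega>) - \<mu>) / a n)"
      by (simp add: exp_sum)
    also have "(\<Sum>i\<in>?R. \<theta> * (real (X i \<omega>) - \<mu>) / a n) = \<theta> / a n * ((\<Sum>i\<in>?R. real (X i \<omega>)) - (real n - real k) * \<mu>)"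
      by (simp add: sum_divide_distrib[symmetric] sum_distrib_left[symmetric] sum_subtractf cardR[symmetric])
    also have "(\<Sum>i\<in>?R. real (X i \<omega>)) = \<mu> * real n + s * m n - (\<Sum>j<k. real (X (f j) \<omega>))"
      using partial_sum_split[OF f(1,2), of \<omega>] True by (simp add: E_def m_def)
    finally have P: "(\<Prod>i\<in>{1..n}. h f i (X i \<omega>)) = exp (\<theta> / a n * (s * m n - (\<Sum>j<k. real (X (f j) \<omega>)) + real k * \<mu>))"
      by (simp add: algebra_simps)
    have ap: "1 \<le> a n" "1 \<le> r n" using a_pos[OF n(1)] r_pos[OF n(1)] .
    have "\<bar>(\<Sum>j<k. real (X (f j) \<omega>)) - m n * (\<Sum>j<k. x j)\<bar> = \<bar>\<Sum>j<k. real (X (f j) \<omega>) - m n * x j\<bar>"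
      by (simp add: sum_subtractf sum_distrib_left)
    also have "\<dots> \<le> (\<Sum>j<k. m n * \<epsilon>)"
      by (rule order.trans[OF sum_abs sum_mono]) (use E1 in auto)
    finally have D: "\<bar>(\<Sum>j<k. real (X (f j) \<omega>)) - m n * (\<Sum>j<k. x j)\<bar> \<le> real k * m n * \<epsilon>" by simp
    have "\<theta> * ((\<Sum>j<k. real (X (f j) \<omega>)) - m n * (\<Sum>j<k. x j)) \<le> \<bar>\<theta>\<bar> * (real k * m n * \<epsilon>)"
      using mult_left_mono[OF D abs_ge_zero[of \<theta>]] by (simp add: abs_mult[symmetric])
    then have "0 \<le> \<bar>\<theta>\<bar> * (real k * m n * \<epsilon>) - \<theta> * ((\<Sum>j<k. real (X (f j) \<omega>)) - m n * (\<Sum>j<k. x j))" by simp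
    then have "0 \<le> (\<bar>\<theta>\<bar> * (real k * m n * \<epsilon>) - \<theta> * ((\<Sum>j<k. real (X (f j) \<omega>)) - m n * (\<Sum>j<k. x j))) / a n"
      using ap by simp
    also have "\<dots> = r n * (- \<theta> * (s - (\<Sum>j<k. x j)) - \<theta> * \<mu> * k / (a n * r n) + \<bar>\<theta>\<bar> * k * \<epsilon>)
      + \<theta> / a n * (s * m n - (\<Sum>j<k. real (X (f j) \<omega>)) + real k * \<mu>)"
      using ap by (simp add: m_eq[OF n(1)] field_simps)
    finally have "1 \<le> C * (\<Prod>i\<in>{1..n}. h f i (X i \<omega>))"
      unfolding P C_def exp_add[symmetric] by simp
    also have "\<dots> \<le> (\<Sum>f\<in>Fs. C * (\<Prod>i\<in>{1..n}. h f i (X i \<omega>)))"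
      using f(1,2) h_nonneg finF
      by (intro member_le_sum) (auto simp: Fs_def C_def intro!: mult_nonneg_nonneg prod_nonneg)
    finally show ?thesis using True by simp
  qed
  have hp_int: "integrable M (\<lambda>\<omega>. \<Prod>i\<in>{1..n}. h f i (X i \<omega>))" for f
    by (rule expectation_prod_X) (use h_int in auto)
  have Em: "E \<in> events"
  proof -
    show ?thesis unfolding E_def by measurable
  qed
  have "prob E = expectation (indicator E)" using Em by simp
  also have "\<dots> \<le> expectation (\<lambda>\<omega>. \<Sum>f\<in>Fs. C * (\<Prod>i\<in>{1..n}. h f i (X i \<omega>)))"
    using pt hp_int by (intro integral_mono integrable_real_indicator[OF Em]) (auto simp: less_top[symmetric])
  also have "\<dots> = (\<Sum>f\<in>Fs. C * ((\<Prod>j<k. tail (u j)) * trunc_mgf \<theta> \<delta> n ^ (n - k)))"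
    using hp_int h_exp by (subst Bochner_Integration.integral_sum) (auto intro!: sum.cong)
  also have "\<dots> = real (card Fs) * (C * ((\<Prod>j<k. tail (u j)) * trunc_mgf \<theta> \<delta> n ^ (n - k)))"
    by simp
  also have "\<dots> \<le> real n ^ k * (C * ((\<Prod>j<k. tail (u j)) * trunc_mgf \<theta> \<delta> n ^ (n - k)))"
  proof (rule mult_right_mono)
    show "real (card Fs) \<le> real n ^ k" using cardF by (metis of_nat_le_iff of_nat_power)
    show "0 \<le> C * ((\<Prod>j<k. tail (u j)) * trunc_mgf \<theta> \<delta> n ^ (n - k))"
      by (auto simp: C_def tail_def trunc_mgf_def trunc_weight_nonneg intro!: mult_nonneg_nonneg prod_nonneg zero_le_power integral_nonneg_AE)
  qed
  finally show ?thesis by (simp add: C_def u_def mult_ac)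
qed

end

section \<open>Asymptotic upper bound for the joint probabilities\<close>

locale conditioned_stretched_exponential = stretched_exponential M X \<alpha> c \<gamma> \<mu> v
  for M :: "'a measure" and X :: "nat \<Rightarrow> 'a \<Rightarrow> nat" and \<alpha> c \<gamma> \<mu> v :: real +
  fixes s_seq :: "nat \<Rightarrow> real" and s :: real
  assumes lattice: "\<And>n. 1 \<le> n \<Longrightarrow> \<mu> * real n + s_seq n * real n powr \<gamma> \<in> \<nat>"
    and lim: "s_seq \<longlonglongrightarrow> s"
begin

text \<open>The unnormalised probabilities: both bounds are proved for them with rate
  \<open>F\<close>, and the infimum of \<open>F\<close> appears only on dividing by
  \<open>joint n decseqs\<close>.\<close>

definition joint :: "nat \<Rightarrow> (nat \<Rightarrow> real) set \<Rightarrow> real" where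
  "joint n A = \<P>(\<omega> in M. scaled_order_stats X \<gamma> n \<omega> \<in> A \<and>
     real (partial_sum X n \<omega>) = \<mu> * real n + s_seq n * real n powr \<gamma>)"

lemma over_r: "(\<lambda>n. C / r n) \<longlonglongrightarrow> 0"
  by (rule tendsto_divide_0[OF tendsto_const]) (simp add: r_at_top filterlim_at_top_imp_at_infinity)

lemma over_n: "(\<lambda>n. C / real n) \<longlonglongrightarrow> 0"
  by real_asymp

lemma prob_order_stats_eventually_le:
  fixes x :: "nat \<Rightarrow> real"
  assumes \<delta>: "0 < \<delta>" "\<bar>\<theta>\<bar> * \<delta> powr (1 - \<alpha>) \<le> 1 / 2" and \<epsilon>: "0 < \<epsilon>" and \<eta>: "0 < \<eta>"
    and b: "b < (1 - \<eta>) * (\<Sum>j<k. max 0 (x j - \<epsilon>) powr \<alpha>) - \<theta>\<^sup>2 * v / 2 + \<theta> * (s - (\<Sum>j<k. x j)) - \<bar>\<theta>\<bar> * k * \<epsilon>"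
  shows "eventually (\<lambda>n. \<P>(\<omega> in M. (\<forall>j<k. \<bar>scaled_order_stats X \<gamma> n \<omega> j - x j\<bar> < \<epsilon>) \<and>
      scaled_order_stats X \<gamma> n \<omega> k \<le> \<delta> \<and>
      real (partial_sum X n \<omega>) = \<mu> * real n + s_seq n * real n powr \<gamma>) \<le> exp (- r n * b)) sequentially"
proof -
  obtain K where K: "0 < K" "\<And>u. 0 \<le> u \<Longrightarrow> tail u \<le> K * exp (- (1 - \<eta>) * u powr \<alpha>)"
    using tail_le[OF \<eta>] by blast
  define T where "T = (\<Sum>j<k. max 0 (x j - \<epsilon>) powr \<alpha>)"
  define \<phi> where "\<phi> n = trunc_mgf \<theta> \<delta> n" for n
  \<comment> \<open>r n * L n is the logarithm of the bound of \<open>prob_order_stats_le\<close>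
    once each tail is replaced by K exp(...). The terms from n^k, K^k and the k missing means vanish
    in the limit.\<close>
  define L where "L n = k * (ln (real n) / r n) + k * ln K / r n - (1 - \<eta>) * T + (a n)\<^sup>2 * ln (\<phi> n) * (1 - k / real n)
     + (- \<theta> * (s_seq n - (\<Sum>j<k. x j)) - \<theta> * \<mu> * k / r n * inverse (a n) + \<bar>\<theta>\<bar> * k * \<epsilon>)" for n
  have "L \<longlonglongrightarrow> real k * 0 + 0 - (1 - \<eta>) * T + \<theta>\<^sup>2 * v / 2 * (1 - 0) + (- \<theta> * (s - (\<Sum>j<k. x j)) - 0 * 0 + \<bar>\<theta>\<bar> * k * \<epsilon>)"
    unfolding L_def \<phi>_def
    by (intro tendsto_intros ln_over_r over_r over_n tendsto_ln_trunc_mgf(1)[OF \<delta>] lim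
      tendsto_inverse_0_at_top a_at_top)
  then have "eventually (\<lambda>n. L n < - b) sequentially"
    by (rule order_tendstoD) (use b in \<open>simp add: T_def\<close>)
  moreover have "eventually (\<lambda>n. 0 < \<phi> n) sequentially"
    unfolding \<phi>_def by (rule tendsto_ln_trunc_mgf(2)[OF \<delta>])
  ultimately show ?thesis
    using eventually_ge_at_top[of "max 1 k"]
  proof eventually_elim
    case (elim n)
    then have n: "1 \<le> n" "k \<le> n" by auto
    have r1: "1 \<le> r n" and a1: "1 \<le> a n" and m1: "1 \<le> m n" using r_pos a_pos m_pos n by auto
    let ?D = "exp (r n * (- \<theta> * (s_seq n - (\<Sum>j<k. x j)) - \<theta> * \<mu> * k / (a n * r n) + \<bar>\<theta>\<bar> * k * \<epsilon>))"
    have P: "(\<Prod>j<k. tail (m n * max 0 (x j - \<epsilon>))) \<le> exp (k * ln K - (1 - \<eta>) * r n * T)"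
    proof -
      have "(\<Prod>j<k. tail (m n * max 0 (x j - \<epsilon>))) \<le> (\<Prod>j<k. K * exp (- (1 - \<eta>) * (r n * max 0 (x j - \<epsilon>) powr \<alpha>)))"
      proof (rule prod_mono, rule conjI)
        fix j
        show "0 \<le> tail (m n * max 0 (x j - \<epsilon>))" by (simp add: tail_def)
        have "(m n * max 0 (x j - \<epsilon>)) powr \<alpha> = r n * max 0 (x j - \<epsilon>) powr \<alpha>"
          using m1 by (simp add: powr_mult r_eq)
        then show "tail (m n * max 0 (x j - \<epsilon>)) \<le> K * exp (- (1 - \<eta>) * (r n * max 0 (x j - \<epsilon>) powr \<alpha>))"
          using K(2)[of "m n * max 0 (x j - \<epsilon>)"] m1 by simp
      qed
      also have "\<dots> = K ^ k * exp (\<Sum>j<k. - (1 - \<eta>) * (r n * max 0 (x j - \<epsilon>) powr \<alpha>))"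
        by (simp add: prod.distrib exp_sum)
      also have "(\<Sum>j<k. - (1 - \<eta>) * (r n * max 0 (x j - \<epsilon>) powr \<alpha>)) = - (1 - \<eta>) * r n * T"
        by (simp only: T_def sum_distrib_left mult.assoc)
      also have "K ^ k = exp (k * ln K)" using K(1) by (simp add: exp_of_nat_mult)
      finally show ?thesis by (simp add: exp_add[symmetric] algebra_simps)
    qed
    have N: "real n ^ k = exp (k * ln (real n))" using n by (simp add: exp_of_nat_mult)
    have "real (n - k) * ln (\<phi> n) = r n * ((a n)\<^sup>2 * ln (\<phi> n) * (1 - k / real n))"
    proof -
      have "real (n - k) = real n * (1 - k / real n)" using n by (simp add: of_nat_diff field_simps)
      also have "\<dots> = r n * (a n)\<^sup>2 * (1 - k / real n)" using n_eq[OF n(1)] by simp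
      finally show ?thesis by (simp add: mult_ac)
    qed
    then have Q: "\<phi> n ^ (n - k) = exp (r n * ((a n)\<^sup>2 * ln (\<phi> n) * (1 - k / real n)))"
      using elim(2) by (metis exp_ln exp_of_nat_mult)
    have "\<P>(\<omega> in M. (\<forall>j<k. \<bar>scaled_order_stats X \<gamma> n \<omega> j - x j\<bar> < \<epsilon>) \<and>
      scaled_order_stats X \<gamma> n \<omega> k \<le> \<delta> \<and>
      real (partial_sum X n \<omega>) = \<mu> * real n + s_seq n * real n powr \<gamma>)
      \<le> real n ^ k * (\<Prod>j<k. tail (m n * max 0 (x j - \<epsilon>))) * \<phi> n ^ (n - k) * ?D"
      unfolding \<phi>_def by (rule prob_order_stats_le[OF n \<delta> \<epsilon>])
    also have "\<dots> \<le> real n ^ k * exp (k * ln K - (1 - \<eta>) * r n * T) * \<phi> n ^ (n - k) * ?D"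
      using elim(2) by (intro mult_right_mono mult_left_mono P) auto
    also have "\<dots> = exp (r n * L n)"
      unfolding N Q exp_add[symmetric] L_def using r1 a1 by (simp add: field_simps)
    also have "\<dots> \<le> exp (- r n * b)"
      using elim(1) r1 mult_left_mono[of "L n" "- b" "r n"] by simp
    finally show ?case .
  qed
qed

text \<open>For a decreasing sequence x_j = x_j^(1-\<alpha>) x_j^\<alpha> \<le> x_0^(1-\<alpha>)
  x_j^\<alpha>. Hence on \<open>decseqs\<close> the power sum alone decides whether \<open>F\<close>
  is finite.\<close>

lemma summable_if_powr_summable:
  assumes x: "x \<in> decseqs" and sum: "summable (\<lambda>j. x j powr \<alpha>)"
  shows "summable x"
proof (rule summable_comparison_test)
  show "summable (\<lambda>j. x 0 powr (1 - \<alpha>) * x j powr \<alpha>)" by (intro summable_mult sum)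
  have "norm (x j) \<le> x 0 powr (1 - \<alpha>) * x j powr \<alpha>" for j
  proof (cases "x j = 0")
    case False
    have xj: "0 \<le> x j" "x j \<le> x 0" using x by (auto simp: decseqs_def decseq_def)
    then have "x j = x j powr (1 - \<alpha>) * x j powr \<alpha>" using False by (simp add: powr_add[symmetric])
    also have "\<dots> \<le> x 0 powr (1 - \<alpha>) * x j powr \<alpha>"
      using xj alpha by (intro mult_right_mono powr_mono2) auto
    finally show ?thesis using xj by simp
  qed simp
  then show "\<exists>N. \<forall>n\<ge>N. norm (x n) \<le> x 0 powr (1 - \<alpha>) * x n powr \<alpha>" by blast
qed

text \<open>Legendre duality with \<theta> = y / v for y = s minus the sum of the x_j, then k so
  large that partial sums replace the sums and x_k is small. If the power sum diverges, finitely
  many jumps already cost more than b and \<theta> = 0 does. The strict inequality for x_k leaves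
  room to truncate at x_k + \<epsilon>.\<close>

lemma tilt_exists:
  assumes x: "x \<in> decseqs" and b: "ereal b < F \<alpha> v s x"
  obtains k \<theta> where "b < (\<Sum>j<k. x j powr \<alpha>) - \<theta>\<^sup>2 * v / 2 + \<theta> * (s - (\<Sum>j<k. x j))"
    "\<bar>\<theta>\<bar> * x k powr (1 - \<alpha>) < 1 / 2"
proof (cases "summable (\<lambda>j. x j powr \<alpha>)")
  case False
  have "\<exists>k. b < (\<Sum>j<k. x j powr \<alpha>)"
  proof (rule ccontr)
    assume "\<not> ?thesis"
    then have "summable (\<lambda>j. x j powr \<alpha>)"
      by (intro summableI_nonneg_bounded[where x = b]) (auto simp: not_less)
    then show False using False by simp
  qed
  then show ?thesis using that[of _ 0] by auto
next
  case True
  have sx: "summable x" by (rule summable_if_powr_summable[OF x True])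
  define \<theta> where "\<theta> = (s - (\<Sum>j. x j)) / v"
  have "(\<lambda>k. (\<Sum>j<k. x j powr \<alpha>) - \<theta>\<^sup>2 * v / 2 + \<theta> * (s - (\<Sum>j<k. x j)))
     \<longlonglongrightarrow> (\<Sum>j. x j powr \<alpha>) - \<theta>\<^sup>2 * v / 2 + \<theta> * (s - (\<Sum>j. x j))"
    by (intro tendsto_intros summable_LIMSEQ True sx)
  moreover have "b < (\<Sum>j. x j powr \<alpha>) - \<theta>\<^sup>2 * v / 2 + \<theta> * (s - (\<Sum>j. x j))"
  proof -
    have "(s - (\<Sum>j. x j))\<^sup>2 / (2 * v) = - \<theta>\<^sup>2 * v / 2 + \<theta> * (s - (\<Sum>j. x j))"
      using var_pos by (simp add: \<theta>_def power2_eq_square)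
    then show ?thesis using b True sx by (simp add: F_def)
  qed
  ultimately have "eventually (\<lambda>k. b < (\<Sum>j<k. x j powr \<alpha>) - \<theta>\<^sup>2 * v / 2 + \<theta> * (s - (\<Sum>j<k. x j))) sequentially"
    by (rule order_tendstoD)
  moreover have "eventually (\<lambda>k. \<bar>\<theta>\<bar> * x k powr (1 - \<alpha>) < 1 / 2) sequentially"
  proof (rule order_tendstoD)
    show "(\<lambda>k. \<bar>\<theta>\<bar> * x k powr (1 - \<alpha>)) \<longlonglongrightarrow> \<bar>\<theta>\<bar> * 0 powr (1 - \<alpha>)"
      by (intro tendsto_intros tendsto_powr' summable_LIMSEQ_zero[OF sx])
        (use alpha x in \<open>auto simp: decseqs_def\<close>)
  qed simp
  ultimately have "eventually (\<lambda>k. b < (\<Sum>j<k. x j powr \<alpha>) - \<theta>\<^sup>2 * v / 2 + \<theta> * (s - (\<Sum>j<k. x j))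
     \<and> \<bar>\<theta>\<bar> * x k powr (1 - \<alpha>) < 1 / 2) sequentially"
    by (rule eventually_conj)
  from eventually_happens'[OF trivial_limit_sequentially this] show ?thesis using that by blast
qed

lemma local_upper_bound:
  assumes x: "x \<in> decseqs" and b: "ereal b < F \<alpha> v s x"
  obtains V where "open V" "x \<in> V" "eventually (\<lambda>n. joint n V \<le> exp (- r n * b)) sequentially"
proof -
  obtain k \<theta> where k: "b < (\<Sum>j<k. x j powr \<alpha>) - \<theta>\<^sup>2 * v / 2 + \<theta> * (s - (\<Sum>j<k. x j))"
    "\<bar>\<theta>\<bar> * x k powr (1 - \<alpha>) < 1 / 2"
    using tilt_exists[OF x b] by blast
  have nn: "0 \<le> x j" for j using x by (auto simp: decseqs_def)
  \<comment> \<open>One \<epsilon> plays three parts: radius of the neighbourhood, loss \<eta> in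
    the tail bound, and slack in the truncation level x_k + \<epsilon>.\<close>
  have "((\<lambda>\<epsilon>. (1 - \<epsilon>) * (\<Sum>j<k. max 0 (x j - \<epsilon>) powr \<alpha>) - \<theta>\<^sup>2 * v / 2 + \<theta> * (s - (\<Sum>j<k. x j)) - \<bar>\<theta>\<bar> * k * \<epsilon>) \<longlongrightarrow>
     (1 - 0) * (\<Sum>j<k. max 0 (x j - 0) powr \<alpha>) - \<theta>\<^sup>2 * v / 2 + \<theta> * (s - (\<Sum>j<k. x j)) - \<bar>\<theta>\<bar> * k * 0) (at_right 0)"
    by (intro tendsto_intros tendsto_powr') (use alpha in auto)
  then have "eventually (\<lambda>\<epsilon>. b < (1 - \<epsilon>) * (\<Sum>j<k. max 0 (x j - \<epsilon>) powr \<alpha>) - \<theta>\<^sup>2 * v / 2 + \<theta> * (s - (\<Sum>j<k. x j)) - \<bar>\<theta>\<bar> * k * \<epsilon>) (at_right 0)"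
    by (rule order_tendstoD) (use k nn in \<open>simp add: max_def\<close>)
  moreover have "((\<lambda>\<epsilon>. \<bar>\<theta>\<bar> * (x k + \<epsilon>) powr (1 - \<alpha>)) \<longlongrightarrow> \<bar>\<theta>\<bar> * (x k + 0) powr (1 - \<alpha>)) (at_right 0)"
    by (intro tendsto_intros tendsto_powr')
      (use alpha nn in \<open>auto intro!: eventually_at_rightI[of 0 1] add_nonneg_nonneg\<close>)
  then have "eventually (\<lambda>\<epsilon>. \<bar>\<theta>\<bar> * (x k + \<epsilon>) powr (1 - \<alpha>) < 1 / 2) (at_right 0)"
    by (rule order_tendstoD) (use k in simp)
  moreover have "eventually (\<lambda>\<epsilon>::real. 0 < \<epsilon>) (at_right 0)"
    by (simp add: eventually_at_right_less)
  ultimately have "eventually (\<lambda>\<epsilon>. b < (1 - \<epsilon>) * (\<Sum>j<k. max 0 (x j - \<epsilon>) powr \<alpha>) - \<theta>\<^sup>2 * v / 2 + \<theta> * (s - (\<Sum>j<k. x j)) - \<bar>\<theta>\<bar> * k * \<epsilon> \<and>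
     \<bar>\<theta>\<bar> * (x k + \<epsilon>) powr (1 - \<alpha>) < 1 / 2 \<and> 0 < \<epsilon>) (at_right 0)"
    by (intro eventually_conj)
  then obtain \<epsilon> where \<epsilon>: "0 < \<epsilon>" "\<bar>\<theta>\<bar> * (x k + \<epsilon>) powr (1 - \<alpha>) < 1 / 2"
    "b < (1 - \<epsilon>) * (\<Sum>j<k. max 0 (x j - \<epsilon>) powr \<alpha>) - \<theta>\<^sup>2 * v / 2 + \<theta> * (s - (\<Sum>j<k. x j)) - \<bar>\<theta>\<bar> * k * \<epsilon>"
    using eventually_happens'[OF trivial_limit_at_right_real] by blast
  \<comment> \<open>The last condition is one-sided: coordinate k is used only to bound all the
    remaining variables.\<close>
  define V where "V = (\<Inter>j\<in>{..<k}. {y. \<bar>y j - x j\<bar> < \<epsilon>}) \<inter> {y. y k < x k + \<epsilon>}"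
  have V: "y \<in> V \<longleftrightarrow> (\<forall>j<k. \<bar>y j - x j\<bar> < \<epsilon>) \<and> y k < x k + \<epsilon>" for y by (auto simp: V_def)
  have "open V" unfolding V_def
    by (intro open_Int open_INT ballI open_Collect_less continuous_intros continuous_on_product_coordinates) auto
  moreover have "x \<in> V" using \<epsilon> by (simp add: V)
  moreover have "eventually (\<lambda>n. joint n V \<le> exp (- r n * b)) sequentially"
  proof -
    have "0 < x k + \<epsilon>" using \<epsilon>(1) nn[of k] by simp
    from prob_order_stats_eventually_le[OF this less_imp_le[OF \<epsilon>(2)] \<epsilon>(1) \<epsilon>(1) \<epsilon>(3)]
    show ?thesis
    proof eventually_elim
      case (elim n)
      show ?case
        by (rule order.trans[OF _ elim], unfold joint_def, rule finite_measure_mono) (auto simp: V)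
    qed
  qed
  ultimately show ?thesis using that by blast
qed

lemma prob_ge_eq_tail:
  assumes "1 \<le> i"
  shows "\<P>(\<omega> in M. u \<le> real (X i \<omega>)) = tail u"
proof -
  have "\<P>(\<omega> in M. u \<le> real (X j \<omega>)) = expectation (\<lambda>\<omega>. of_bool (u \<le> real (X j \<omega>)))" if "1 \<le> j" for j
  proof -
    have "{\<omega> \<in> space M. u \<le> real (X j \<omega>)} \<in> events" using that by measurable
    then have "\<P>(\<omega> in M. u \<le> real (X j \<omega>)) = expectation (indicator {\<omega> \<in> space M. u \<le> real (X j \<omega>)})" by simp
    also have "\<dots> = expectation (\<lambda>\<omega>. of_bool (u \<le> real (X j \<omega>)))"
      by (intro Bochner_Integration.integral_cong) (auto simp: indicator_def)
    finally show ?thesis .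
  qed
  then show ?thesis
    using expectation_X[OF assms, of "\<lambda>k. of_bool (u \<le> real k)"] assms by (simp add: tail_def)
qed

lemma exponential_tightness:
  obtains C where "0 \<le> C"
    "eventually (\<lambda>n. \<P>(\<omega> in M. C < scaled_order_stats X \<gamma> n \<omega> 0) \<le> exp (- r n * b)) sequentially"
proof -
  obtain K where K: "0 < K" "\<And>u. 0 \<le> u \<Longrightarrow> tail u \<le> K * exp (- (1 - 1 / 2) * u powr \<alpha>)"
    using tail_le[of "1/2"] by auto
  \<comment> \<open>Chosen so that C^\<alpha> / 2 = |b| + 1; the surplus 1 absorbs the factor n * K
    of the union bound.\<close>
  define C where "C = (2 * \<bar>b\<bar> + 2) powr (1 / \<alpha>)"
  have C: "0 \<le> C" "C powr \<alpha> = 2 * \<bar>b\<bar> + 2" using alpha by (auto simp: C_def powr_powr)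
  have "(\<lambda>n. ln (real n) / r n + ln K / r n) \<longlonglongrightarrow> 0 + 0"
    by (intro tendsto_intros ln_over_r over_r)
  then have "eventually (\<lambda>n. ln (real n) / r n + ln K / r n < 1) sequentially"
    by (rule order_tendstoD) simp
  then have "eventually (\<lambda>n. \<P>(\<omega> in M. C < scaled_order_stats X \<gamma> n \<omega> 0) \<le> exp (- r n * b)) sequentially"
    using eventually_ge_at_top[of 1]
  proof eventually_elim
    case (elim n)
    have m1: "1 \<le> m n" and r1: "1 \<le> r n" using m_pos r_pos elim by auto
    have "{\<omega> \<in> space M. C < scaled_order_stats X \<gamma> n \<omega> 0} \<subseteq> (\<Union>i\<in>{1..n}. {\<omega> \<in> space M. m n * C \<le> real (X i \<omega>)})"
    proof
      fix \<omega> assume w: "\<omega> \<in> {\<omega> \<in> space M. C < scaled_order_stats X \<gamma> n \<omega> 0}"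
      obtain f where f: "bij_betw f {..<n} {1..n}" "\<And>j. j < n \<Longrightarrow> rev_order_stat X (j + 1) n \<omega> = X (f j) \<omega>"
        using rev_order_stat_permutation[of n X \<omega>] by blast
      have "f 0 \<in> {1..n}" "X (f 0) \<omega> = rev_order_stat X (0 + 1) n \<omega>"
        using bij_betw_apply[OF f(1), of 0] f(2)[of 0] elim(2) by auto
      moreover have "C < real (rev_order_stat X (0 + 1) n \<omega>) / m n"
        using w by (simp add: scaled_order_stats_def m_def)
      then have "m n * C \<le> real (rev_order_stat X (0 + 1) n \<omega>)" using m1 by (simp add: field_simps)
      ultimately show "\<omega> \<in> (\<Union>i\<in>{1..n}. {\<omega> \<in> space M. m n * C \<le> real (X i \<omega>)})"
        using w by (auto intro!: bexI[of _ "f 0"])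
    qed
    then have "\<P>(\<omega> in M. C < scaled_order_stats X \<gamma> n \<omega> 0) \<le> prob (\<Union>i\<in>{1..n}. {\<omega> \<in> space M. m n * C \<le> real (X i \<omega>)})"
      by (rule finite_measure_mono) auto
    also have "\<dots> \<le> (\<Sum>i\<in>{1..n}. \<P>(\<omega> in M. m n * C \<le> real (X i \<omega>)))"
      by (rule finite_measure_subadditive_finite) auto
    also have "\<dots> = real n * tail (m n * C)"
      by (simp add: prob_ge_eq_tail)
    also have "\<dots> \<le> real n * (K * exp (- (1 - 1 / 2) * (m n * C) powr \<alpha>))"
      using m1 C by (intro mult_left_mono K) auto
    also have "(m n * C) powr \<alpha> = r n * (2 * \<bar>b\<bar> + 2)"
      using C m1 by (simp add: powr_mult r_eq)
    also have "- (1 - 1 / 2) * (r n * (2 * \<bar>b\<bar> + 2)) = - (r n * (\<bar>b\<bar> + 1))" by (simp add: field_simps)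
    also have "real n * (K * exp (- (r n * (\<bar>b\<bar> + 1)))) = exp (ln (real n) + ln K - r n * (\<bar>b\<bar> + 1))"
      using K(1) elim by (simp only: diff_conv_add_uminus exp_add) simp
    also have "\<dots> \<le> exp (- r n * b)"
    proof -
      have "ln (real n) + ln K \<le> r n" using elim(1) r1 by (simp add: add_divide_distrib[symmetric])
      moreover have "r n * b \<le> r n * \<bar>b\<bar>" using r1 by (intro mult_left_mono) auto
      ultimately show ?thesis by (simp add: algebra_simps)
    qed
    finally show ?case .
  qed
  then show ?thesis using that C(1) by blast
qed

lemma joint_nonneg: "0 \<le> joint n A"
  by (simp add: joint_def)

text \<open>Taking a real b strictly below the infimum covers an infinite infimum as well. The part
  of A inside a compact box is covered by finitely many local neighbourhoods, the rest is left to
  exponential tightness, and the gap between b and b' absorbs the number of pieces.\<close>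

lemma upper_bound:
  assumes A: "closedin (top_of_set decseqs) A" and b: "ereal b < (INF x\<in>A. F \<alpha> v s x)"
  shows "eventually (\<lambda>n. joint n A \<le> exp (- r n * b)) sequentially"
proof -
  obtain b' where b': "b < b'" "ereal b' < (INF x\<in>A. F \<alpha> v s x)"
    using ereal_dense2[OF b] by auto
  have Ad: "A \<subseteq> decseqs" and Ac: "closed A"
    using A closed_decseqs by (auto dest: closedin_imp_subset intro: closedin_closed_trans)
  obtain C where C: "0 \<le> C"
    "eventually (\<lambda>n. \<P>(\<omega> in M. C < scaled_order_stats X \<gamma> n \<omega> 0) \<le> exp (- r n * b')) sequentially"
    using exponential_tightness by blast
  define K where "K = {x. \<forall>j. x j \<in> {0..C}} \<inter> A"
  have "compact K" unfolding K_def by (rule compact_Int_closed[OF compact_box Ac])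
  have "\<exists>V. open V \<and> x \<in> V \<and> eventually (\<lambda>n. joint n V \<le> exp (- r n * b')) sequentially" if "x \<in> A" for x
  proof -
    have "ereal b' < F \<alpha> v s x" using b'(2) INF_lower[OF that, of "F \<alpha> v s"] by (rule less_le_trans)
    then show ?thesis using local_upper_bound[of x b'] that Ad by blast
  qed
  then obtain V where V: "\<And>x. x \<in> A \<Longrightarrow> open (V x)" "\<And>x. x \<in> A \<Longrightarrow> x \<in> V x"
    "\<And>x. x \<in> A \<Longrightarrow> eventually (\<lambda>n. joint n (V x) \<le> exp (- r n * b')) sequentially"
    by metis
  have "\<And>x. x \<in> K \<Longrightarrow> open (V x)" "K \<subseteq> (\<Union>x\<in>K. V x)" using V by (auto simp: K_def)
  from compactE_image[OF \<open>compact K\<close> this]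
  obtain D where D: "D \<subseteq> K" "finite D" "K \<subseteq> (\<Union>x\<in>D. V x)" by blast
  have DA: "x \<in> A" if "x \<in> D" for x using D that by (auto simp: K_def)
  have "eventually (\<lambda>n. \<forall>x\<in>D. joint n (V x) \<le> exp (- r n * b')) sequentially"
    using D(2) V(3) DA by (simp add: eventually_ball_finite)
  moreover have "eventually (\<lambda>n. ln (real (card D) + 1) / (b' - b) \<le> r n) sequentially"
    using r_at_top by (simp add: filterlim_at_top)
  ultimately show ?thesis using C(2)
  proof eventually_elim
    case (elim n)
    let ?t = "\<lambda>\<omega>. real (partial_sum X n \<omega>) = \<mu> * real n + s_seq n * real n powr \<gamma>"
    let ?E = "\<lambda>x. {\<omega> \<in> space M. scaled_order_stats X \<gamma> n \<omega> \<in> V x \<and> ?t \<omega>}"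
    let ?T = "{\<omega> \<in> space M. C < scaled_order_stats X \<gamma> n \<omega> 0}"
    have meas: "?E x \<in> events" if "x \<in> D" for x
    proof -
      have [measurable]: "V x \<in> sets borel" using V(1)[OF DA[OF that]] by simp
      show ?thesis by measurable
    qed
    have "{\<omega> \<in> space M. scaled_order_stats X \<gamma> n \<omega> \<in> A \<and> ?t \<omega>} \<subseteq> (\<Union>x\<in>D. ?E x) \<union> ?T"
    proof (intro subsetI)
      fix \<omega> assume w0: "\<omega> \<in> {\<omega> \<in> space M. scaled_order_stats X \<gamma> n \<omega> \<in> A \<and> ?t \<omega>}"
      show "\<omega> \<in> (\<Union>x\<in>D. ?E x) \<union> ?T"
      proof (cases "C < scaled_order_stats X \<gamma> n \<omega> 0")
        case True
        then show ?thesis using w0 by auto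
      next
        case False
        with w0 have w: "\<omega> \<in> space M" "scaled_order_stats X \<gamma> n \<omega> \<in> A" "?t \<omega>" "\<not> C < scaled_order_stats X \<gamma> n \<omega> 0"
          by auto
        have "scaled_order_stats X \<gamma> n \<omega> j \<in> {0..C}" for j
        proof -
          have "0 \<le> scaled_order_stats X \<gamma> n \<omega> j" "scaled_order_stats X \<gamma> n \<omega> j \<le> scaled_order_stats X \<gamma> n \<omega> 0"
            using scaled_order_stats_in_decseqs[of X \<gamma> n \<omega>] by (auto simp: decseqs_def decseq_def)
          then show ?thesis using w(4) by auto
        qed
        then have "scaled_order_stats X \<gamma> n \<omega> \<in> K" using w by (auto simp: K_def)
        then have "\<omega> \<in> (\<Union>x\<in>D. ?E x)" using D(3) w by auto
        then show ?thesis by blast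
      qed
    qed
    then have "joint n A \<le> prob ((\<Union>x\<in>D. ?E x) \<union> ?T)"
      unfolding joint_def by (rule finite_measure_mono) (use meas D(2) in \<open>auto intro!: sets.Un sets.finite_UN\<close>)
    also have "\<dots> \<le> prob (\<Union>x\<in>D. ?E x) + prob ?T"
      by (rule measure_Un_le) (use meas D(2) in \<open>auto intro!: sets.finite_UN\<close>)
    also have "prob (\<Union>x\<in>D. ?E x) \<le> (\<Sum>x\<in>D. joint n (V x))"
      unfolding joint_def by (rule finite_measure_subadditive_finite[OF D(2)]) (use meas in auto)
    also have "\<dots> \<le> (\<Sum>x\<in>D. exp (- r n * b'))" using elim(1) by (intro sum_mono) auto
    also have "(\<Sum>x\<in>D. exp (- r n * b')) + prob ?T \<le> (real (card D) + 1) * exp (- r n * b')"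
      using elim(3) by (simp add: algebra_simps)
    also have "\<dots> = exp (ln (real (card D) + 1) - r n * b')"
      by (simp add: exp_diff exp_minus field_simps)
    also have "\<dots> \<le> exp (- r n * b)"
    proof -
      have "ln (real (card D) + 1) \<le> r n * (b' - b)" using elim(2) b'(1) by (simp add: pos_divide_le_eq)
      then show ?thesis by (simp add: algebra_simps)
    qed
    finally show ?case by simp
  qed
qed

end

subsection \<open>Moderate deviations of the bulk\<close>

context stretched_exponential
begin

lemma trunc_mgf_power_tendsto:
  assumes \<delta>: "0 < \<delta>" "\<bar>\<theta>\<bar> * \<delta> powr (1 - \<alpha>) \<le> 1 / 2" and \<epsilon>: "0 < \<epsilon>"
  shows "eventually (\<lambda>n. exp (r n * (\<theta>\<^sup>2 * v / 2 - \<epsilon>)) \<le> trunc_mgf \<theta> \<delta> n ^ (n - k)) sequentially"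
    and "eventually (\<lambda>n. trunc_mgf \<theta> \<delta> n ^ (n - k) \<le> exp (r n * (\<theta>\<^sup>2 * v / 2 + \<epsilon>))) sequentially"
proof -
  define L where "L n = (a n)\<^sup>2 * ln (trunc_mgf \<theta> \<delta> n) * (1 - k / real n)" for n
  have "(\<lambda>n. k / real n) \<longlonglongrightarrow> 0" by real_asymp
  then have lim: "L \<longlonglongrightarrow> \<theta>\<^sup>2 * v / 2 * (1 - 0)"
    unfolding L_def by (intro tendsto_intros tendsto_ln_trunc_mgf(1)[OF \<delta>])
  have eq: "eventually (\<lambda>n. trunc_mgf \<theta> \<delta> n ^ (n - k) = exp (r n * L n) \<and> 1 \<le> r n) sequentially"
    using eventually_ge_at_top[of "max 1 k"] tendsto_ln_trunc_mgf(2)[OF \<delta>]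
  proof eventually_elim
    case (elim n)
    then have n: "1 \<le> n" "k \<le> n" by auto
    have "real (n - k) = real n * (1 - k / real n)" using n by (simp add: of_nat_diff field_simps)
    also have "\<dots> = r n * (a n)\<^sup>2 * (1 - k / real n)" using n_eq[OF n(1)] by simp
    finally have "real (n - k) * ln (trunc_mgf \<theta> \<delta> n) = r n * L n" by (simp add: L_def mult_ac)
    then show ?case using elim(2) r_pos[OF n(1)] by (metis exp_ln exp_of_nat_mult)
  qed
  have "eventually (\<lambda>n. \<theta>\<^sup>2 * v / 2 - \<epsilon> < L n) sequentially"
    using lim by (rule order_tendstoD) (use \<epsilon> in simp)
  with eq show "eventually (\<lambda>n. exp (r n * (\<theta>\<^sup>2 * v / 2 - \<epsilon>)) \<le> trunc_mgf \<theta> \<delta> n ^ (n - k)) sequentially"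
    by eventually_elim (auto intro!: mult_left_mono)
  have "eventually (\<lambda>n. L n < \<theta>\<^sup>2 * v / 2 + \<epsilon>) sequentially"
    using lim by (rule order_tendstoD) (use \<epsilon> in simp)
  with eq show "eventually (\<lambda>n. trunc_mgf \<theta> \<delta> n ^ (n - k) \<le> exp (r n * (\<theta>\<^sup>2 * v / 2 + \<epsilon>))) sequentially"
    by eventually_elim (auto intro!: mult_left_mono)
qed

text \<open>The deviation y is that of the variables after the first k from their own mean, in units
  of m. The truncation keeps the tilted weights integrable and the bulk away from the leading order
  statistics. A predicate of f instead of an outcome can be seen to read only the indices above
  k.\<close>

definition window :: "nat \<Rightarrow> real \<Rightarrow> real \<Rightarrow> real \<Rightarrow> nat \<Rightarrow> (nat \<Rightarrow> nat) \<Rightarrow> bool" where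
  "window k y \<eta> \<delta> n f \<longleftrightarrow> (\<forall>i\<in>{k+1..n}. real (f i) \<le> \<delta> * m n) \<and>
     \<bar>(\<Sum>i\<in>{k+1..n}. real (f i)) - \<mu> * (real n - real k) - y * m n\<bar> \<le> \<eta> * m n"

lemma window_measurable [measurable]: "Measurable.pred M (\<lambda>\<omega>. window k y \<eta> \<delta> n (\<lambda>i. X i \<omega>))"
proof -
  have [measurable]: "(\<lambda>\<omega>. real (X i \<omega>)) \<in> borel_measurable M" if "i \<in> {k+1..n}" for i
    by (rule measurable_compose[OF X_measurable]) (use that in auto)
  show ?thesis unfolding window_def by measurable
qed

text \<open>No change of measure is needed: the exponentially weighted mass outside the window is
  negligible by two Chernoff bounds, so the window carries almost all of it.\<close>

lemma window_mgf_le: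
  fixes y \<eta> \<delta> \<theta> \<kappa> :: real
  assumes n: "1 \<le> n" "k \<le> n" and \<delta>: "0 < \<delta>" "(\<bar>\<theta>\<bar> + \<kappa>) * \<delta> powr (1 - \<alpha>) \<le> 1 / 2" and \<kappa>: "0 \<le> \<kappa>"
  shows "trunc_mgf \<theta> \<delta> n ^ (n - k) \<le>
    exp (r n * (\<theta> * y + \<bar>\<theta>\<bar> * \<eta>)) * \<P>(\<omega> in M. window k y \<eta> \<delta> n (\<lambda>i. X i \<omega>)) +
    exp (- r n * (\<kappa> * (y + \<eta>))) * trunc_mgf (\<theta> + \<kappa>) \<delta> n ^ (n - k) +
    exp (r n * (\<kappa> * (y - \<eta>))) * trunc_mgf (\<theta> - \<kappa>) \<delta> n ^ (n - k)"
proof -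
  define w where "w \<theta> \<omega> = (\<Prod>i\<in>{k+1..n}. trunc_weight \<theta> \<delta> n (X i \<omega>))" for \<theta> \<omega>
  have cond: "\<bar>\<theta>'\<bar> * \<delta> powr (1 - \<alpha>) \<le> 1 / 2" if "\<bar>\<theta>'\<bar> \<le> \<bar>\<theta>\<bar> + \<kappa>" for \<theta>'
    by (rule order.trans[OF mult_right_mono[OF that] \<delta>(2)]) simp
  have w_int: "integrable M (w \<theta>')" and w_exp: "expectation (w \<theta>') = trunc_mgf \<theta>' \<delta> n ^ (n - k)"
    if "\<bar>\<theta>'\<bar> \<le> \<bar>\<theta>\<bar> + \<kappa>" for \<theta>'
  proof -
    have i: "integrable M (\<lambda>\<omega>. trunc_weight \<theta>' \<delta> n (X i \<omega>))" if "i \<in> {k+1..n}" for i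
      by (rule integrable_trunc_weight[OF n(1) \<delta>(1) cond[OF \<open>\<bar>\<theta>'\<bar> \<le> \<bar>\<theta>\<bar> + \<kappa>\<close>]]) (use that in auto)
    show "integrable M (w \<theta>')" unfolding w_def
      by (rule expectation_prod_X(1)) (use i in auto)
    have "expectation (w \<theta>') = (\<Prod>i\<in>{k+1..n}. expectation (\<lambda>\<omega>. trunc_weight \<theta>' \<delta> n (X i \<omega>)))"
      unfolding w_def by (rule expectation_prod_X(2)) (use i in auto)
    also have "\<dots> = (\<Prod>i\<in>{k+1..n}. trunc_mgf \<theta>' \<delta> n)"
      unfolding trunc_mgf_def by (intro prod.cong refl expectation_X) auto
    finally show "expectation (w \<theta>') = trunc_mgf \<theta>' \<delta> n ^ (n - k)" by simp
  qed
  let ?W = "{\<omega> \<in> space M. window k y \<eta> \<delta> n (\<lambda>i. X i \<omega>)}"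
  let ?e1 = "exp (r n * (\<theta> * y + \<bar>\<theta>\<bar> * \<eta>))" and ?e2 = "exp (- r n * (\<kappa> * (y + \<eta>)))"
    and ?e3 = "exp (r n * (\<kappa> * (y - \<eta>)))"
  have w_nonneg: "0 \<le> w \<theta>' \<omega>" for \<theta>' \<omega> by (simp add: w_def prod_nonneg trunc_weight_nonneg)
  have r1: "1 \<le> r n" and a1: "1 \<le> a n" using n r_pos a_pos by auto
  have pt: "w \<theta> \<omega> \<le> ?e1 * indicator ?W \<omega> + ?e2 * w (\<theta> + \<kappa>) \<omega> + ?e3 * w (\<theta> - \<kappa>) \<omega>" if "\<omega> \<in> space M" for \<omega>
  proof (cases "\<forall>i\<in>{k+1..n}. real (X i \<omega>) \<le> \<delta> * m n")
    case False
    then have "w \<theta> \<omega> = 0" by (auto simp: w_def trunc_weight_def intro!: prod_zero)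
    then show ?thesis using w_nonneg by (simp add: add_nonneg_nonneg)
  next
    case True
    define z where "z = ((\<Sum>i\<in>{k+1..n}. real (X i \<omega>)) - \<mu> * (real n - real k)) / m n"
    have m1: "1 \<le> m n" using m_pos n by auto
    \<comment> \<open>On the truncation event every tilt is a function of the single number
      z.\<close>
    have w: "w \<theta>' \<omega> = exp (r n * (\<theta>' * z))" for \<theta>'
    proof -
      have "w \<theta>' \<omega> = (\<Prod>i\<in>{k+1..n}. exp (\<theta>' * (real (X i \<omega>) - \<mu>) / a n))"
        unfolding w_def using True by (intro prod.cong) (auto simp: trunc_weight_def)
      also have "\<dots> = exp (\<Sum>i\<in>{k+1..n}. \<theta>' * (real (X i \<omega>) - \<mu>) / a n)" by (simp add: exp_sum)
      also have "(\<Sum>i\<in>{k+1..n}. \<theta>' * (real (X i \<omega>) - \<mu>) / a n) = \<theta>' / a n * ((\<Sum>i\<in>{k+1..n}. real (X i \<omega>)) - \<mu> * (real n - real k))"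
        using n by (simp add: sum_divide_distrib[symmetric] sum_distrib_left[symmetric] sum_subtractf of_nat_diff)
      also have "\<dots> = \<theta>' / a n * (z * m n)" using m1 by (simp add: z_def)
      also have "\<dots> = r n * (\<theta>' * z)" using a1 by (simp add: m_eq[OF n(1)])
      finally show ?thesis .
    qed
    have W: "\<omega> \<in> ?W \<longleftrightarrow> \<bar>z - y\<bar> \<le> \<eta>"
    proof -
      have "(\<Sum>i\<in>{k+1..n}. real (X i \<omega>)) - \<mu> * (real n - real k) - y * m n = (z - y) * m n"
        using m1 by (simp add: z_def field_simps)
      then show ?thesis using True that m1 by (simp add: window_def abs_mult)
    qed
    have nonneg: "0 \<le> ?e1 * indicator ?W \<omega>" "0 \<le> ?e2 * w (\<theta> + \<kappa>) \<omega>" "0 \<le> ?e3 * w (\<theta> - \<kappa>) \<omega>"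
      using w_nonneg by (auto intro!: mult_nonneg_nonneg)
    \<comment> \<open>Outside the window the tilt is moved by \<kappa> towards the side on which z
      lies; this multiplies the weight by exp (r \<kappa> d), with d > 0 the distance of z from the
      window.\<close>
    consider "\<bar>z - y\<bar> \<le> \<eta>" | "y + \<eta> < z" | "z < y - \<eta>" by linarith
    then show ?thesis
    proof cases
      case 1
      have "\<theta> * (z - y) \<le> \<bar>\<theta>\<bar> * \<eta>"
      proof -
        have "\<theta> * (z - y) \<le> \<bar>\<theta>\<bar> * \<bar>z - y\<bar>" by (metis abs_ge_self abs_mult)
        also have "\<dots> \<le> \<bar>\<theta>\<bar> * \<eta>" using 1 by (intro mult_left_mono) auto
        finally show ?thesis .
      qed
      then have "\<theta> * z \<le> \<theta> * y + \<bar>\<theta>\<bar> * \<eta>" by (simp add: algebra_simps)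
      then have "w \<theta> \<omega> \<le> ?e1 * indicator ?W \<omega>"
        using r1 1 W by (simp add: w)
      then show ?thesis using nonneg by linarith
    next
      case 2
      have "\<kappa> * (y + \<eta>) \<le> \<kappa> * z" using 2 \<kappa> by (intro mult_left_mono) auto
      then have "r n * (\<theta> * z) \<le> r n * (- (\<kappa> * (y + \<eta>)) + (\<theta> + \<kappa>) * z)"
        using r1 by (intro mult_left_mono) (auto simp: algebra_simps)
      then have "w \<theta> \<omega> \<le> ?e2 * w (\<theta> + \<kappa>) \<omega>"
        unfolding w exp_add[symmetric] by (simp add: algebra_simps)
      then show ?thesis using nonneg by linarith
    next
      case 3
      have "\<kappa> * z \<le> \<kappa> * (y - \<eta>)" using 3 \<kappa> by (intro mult_left_mono) auto
      then have "r n * (\<theta> * z) \<le> r n * (\<kappa> * (y - \<eta>) + (\<theta> - \<kappa>) * z)"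
        using r1 by (intro mult_left_mono) (auto simp: algebra_simps)
      then have "w \<theta> \<omega> \<le> ?e3 * w (\<theta> - \<kappa>) \<omega>"
        unfolding w exp_add[symmetric] by (simp add: algebra_simps)
      then show ?thesis using nonneg by linarith
    qed
  qed
  have Wm: "?W \<in> events" by measurable
  have iW: "integrable M (indicator ?W :: _ \<Rightarrow> real)"
    using Wm by (intro integrable_real_indicator) (auto simp: less_top[symmetric])
  have "trunc_mgf \<theta> \<delta> n ^ (n - k) = expectation (w \<theta>)" using w_exp[of \<theta>] \<kappa> by simp
  also have "\<dots> \<le> expectation (\<lambda>\<omega>. ?e1 * indicator ?W \<omega> + ?e2 * w (\<theta> + \<kappa>) \<omega> + ?e3 * w (\<theta> - \<kappa>) \<omega>)"
    using \<kappa> by (intro integral_mono pt Bochner_Integration.integrable_add integrable_mult_right w_int iW) auto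
  also have "\<dots> = ?e1 * prob ?W + ?e2 * expectation (w (\<theta> + \<kappa>)) + ?e3 * expectation (w (\<theta> - \<kappa>))"
    using \<kappa> iW w_int[of "\<theta> + \<kappa>"] w_int[of "\<theta> - \<kappa>"] Wm by simp
  also have "expectation (w (\<theta> + \<kappa>)) = trunc_mgf (\<theta> + \<kappa>) \<delta> n ^ (n - k)" using \<kappa> by (intro w_exp) auto
  also have "expectation (w (\<theta> - \<kappa>)) = trunc_mgf (\<theta> - \<kappa>) \<delta> n ^ (n - k)" using \<kappa> by (intro w_exp) auto
  finally show ?thesis .
qed

text \<open>With \<theta> = y / v the total weighted mass has exponent y^2/(2v). Moving the tilt by
  \<kappa> changes the exponent of either outer part to that value plus \<kappa>^2 v / 2 - \<kappa>
  \<eta>, minimal at \<kappa> = \<eta> / v with gain \<eta>^2/(2v). So the outer parts are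
  exponentially smaller, and inside the window the weight is at most exp (r (\<theta> y + |\<theta>|
  \<eta>)).\<close>

lemma window_lower_bound:
  fixes y \<eta> \<delta> \<epsilon> :: real
  assumes \<eta>: "0 < \<eta>" and \<epsilon>: "0 < \<epsilon>" and \<delta>: "0 < \<delta>" "(\<bar>y / v\<bar> + \<eta> / v) * \<delta> powr (1 - \<alpha>) \<le> 1 / 2"
  shows "eventually (\<lambda>n. exp (- r n * (y\<^sup>2 / (2 * v) + \<bar>y / v\<bar> * \<eta> + \<epsilon>)) \<le>
    \<P>(\<omega> in M. window k y \<eta> \<delta> n (\<lambda>i. X i \<omega>))) sequentially"
proof -
  define \<theta> where "\<theta> = y / v"
  define \<kappa> where "\<kappa> = \<eta> / v"
  define A where "A = y\<^sup>2 / (2 * v)"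
  \<comment> \<open>The bound 4 e \<le> \<eta>^2/(2v) places the outer parts below exp (r (A - 3
    e)), against exp (r (A - e)) for the whole; \<epsilon> / 2 lets the final loss 2 e stay within
    \<epsilon>.\<close>
  define e where "e = min (\<epsilon> / 2) (\<eta>\<^sup>2 / (8 * v))"
  have v: "0 < v" by (rule var_pos)
  have e: "0 < e" "2 * e \<le> \<epsilon>" "4 * e \<le> \<eta>\<^sup>2 / (2 * v)"
    using \<epsilon> \<eta> v by (auto simp: e_def min_def field_simps)
  have \<kappa>: "0 < \<kappa>" using \<eta> v by (simp add: \<kappa>_def)
  have \<delta>': "(\<bar>\<theta>\<bar> + \<kappa>) * \<delta> powr (1 - \<alpha>) \<le> 1 / 2" using \<delta> by (simp add: \<theta>_def \<kappa>_def)
  have cond: "\<bar>\<theta>'\<bar> * \<delta> powr (1 - \<alpha>) \<le> 1 / 2" if "\<bar>\<theta>'\<bar> \<le> \<bar>\<theta>\<bar> + \<kappa>" for \<theta>'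
    by (rule order.trans[OF mult_right_mono[OF that] \<delta>']) simp
  have A: "\<theta>\<^sup>2 * v / 2 = A" "\<theta> * y = 2 * A"
    "(\<theta> + \<kappa>)\<^sup>2 * v / 2 = A + \<kappa> * (y + \<eta>) - \<eta>\<^sup>2 / (2 * v)"
    "(\<theta> - \<kappa>)\<^sup>2 * v / 2 = A - \<kappa> * (y - \<eta>) - \<eta>\<^sup>2 / (2 * v)"
    using v by (simp_all add: A_def \<theta>_def \<kappa>_def power2_eq_square field_simps)
  have 1: "eventually (\<lambda>n. exp (r n * (A - e)) \<le> trunc_mgf \<theta> \<delta> n ^ (n - k)) sequentially"
    using trunc_mgf_power_tendsto(1)[OF \<delta>(1) cond e(1), of \<theta> k] \<kappa> by (simp add: A)
  have 2: "eventually (\<lambda>n. trunc_mgf (\<theta> + \<kappa>) \<delta> n ^ (n - k) \<le> exp (r n * (A + \<kappa> * (y + \<eta>) - \<eta>\<^sup>2 / (2 * v) + e))) sequentially"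
    using trunc_mgf_power_tendsto(2)[OF \<delta>(1) cond e(1), of "\<theta> + \<kappa>" k] \<kappa> by (simp add: A)
  have 3: "eventually (\<lambda>n. trunc_mgf (\<theta> - \<kappa>) \<delta> n ^ (n - k) \<le> exp (r n * (A - \<kappa> * (y - \<eta>) - \<eta>\<^sup>2 / (2 * v) + e))) sequentially"
    using trunc_mgf_power_tendsto(2)[OF \<delta>(1) cond e(1), of "\<theta> - \<kappa>" k] \<kappa> by (simp add: A)
  have 4: "eventually (\<lambda>n. ln 4 / e \<le> r n) sequentially"
    using r_at_top by (simp add: filterlim_at_top)
  show ?thesis
    using 1 2 3 4 eventually_ge_at_top[of "max 1 k"]
  proof eventually_elim
    case (elim n)
    let ?P = "\<P>(\<omega> in M. window k y \<eta> \<delta> n (\<lambda>i. X i \<omega>))"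
    have n: "1 \<le> n" "k \<le> n" using elim by auto
    have r1: "1 \<le> r n" using r_pos n by auto
    have small: "exp (- r n * e) \<le> 1 / 4"
    proof -
      have "ln 4 \<le> r n * e" using elim(4) e by (simp add: field_simps)
      then have "exp (- r n * e) \<le> exp (- ln (4::real))" by simp
      then show ?thesis by (simp add: exp_minus)
    qed
    have up: "exp (- r n * (\<kappa> * (y + \<eta>))) * trunc_mgf (\<theta> + \<kappa>) \<delta> n ^ (n - k) \<le> exp (r n * (A - 3 * e))"
    proof -
      have "exp (- r n * (\<kappa> * (y + \<eta>))) * trunc_mgf (\<theta> + \<kappa>) \<delta> n ^ (n - k)
         \<le> exp (- r n * (\<kappa> * (y + \<eta>))) * exp (r n * (A + \<kappa> * (y + \<eta>) - \<eta>\<^sup>2 / (2 * v) + e))"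
        using elim(2) by (intro mult_left_mono) auto
      also have "\<dots> = exp (r n * (A - \<eta>\<^sup>2 / (2 * v) + e))"
        by (simp add: exp_add[symmetric] algebra_simps)
      also have "\<dots> \<le> exp (r n * (A - 3 * e))" using e r1 by simp
      finally show ?thesis .
    qed
    have down: "exp (r n * (\<kappa> * (y - \<eta>))) * trunc_mgf (\<theta> - \<kappa>) \<delta> n ^ (n - k) \<le> exp (r n * (A - 3 * e))"
    proof -
      have "exp (r n * (\<kappa> * (y - \<eta>))) * trunc_mgf (\<theta> - \<kappa>) \<delta> n ^ (n - k)
         \<le> exp (r n * (\<kappa> * (y - \<eta>))) * exp (r n * (A - \<kappa> * (y - \<eta>) - \<eta>\<^sup>2 / (2 * v) + e))"
        using elim(3) by (intro mult_left_mono) auto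
      also have "\<dots> = exp (r n * (A - \<eta>\<^sup>2 / (2 * v) + e))"
        by (simp add: exp_add[symmetric] algebra_simps)
      also have "\<dots> \<le> exp (r n * (A - 3 * e))" using e r1 by simp
      finally show ?thesis .
    qed
    have E1: "exp (r n * (A - 3 * e)) = exp (r n * (A - e)) * (exp (- r n * e) * exp (- r n * e))"
      unfolding exp_add[symmetric] by (simp add: algebra_simps)
    have E2: "exp (- r n * e) * exp (- r n * e) \<le> 1 / 4 * 1"
      using small e r1 by (intro mult_mono) auto
    have E3: "2 * exp (r n * (A - 3 * e)) \<le> exp (r n * (A - e)) / 2"
      using mult_left_mono[OF E2, of "exp (r n * (A - e))"] by (simp add: E1)
    have E4: "exp (r n * (A - 2 * e)) \<le> exp (r n * (A - e)) / 2"
    proof -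
      have "exp (r n * (A - 2 * e)) = exp (r n * (A - e)) * exp (- r n * e)"
        unfolding exp_add[symmetric] by (simp add: algebra_simps)
      also have "\<dots> \<le> exp (r n * (A - e)) * (1 / 4)" using small by (intro mult_left_mono) auto
      also have "\<dots> \<le> exp (r n * (A - e)) / 2" by simp
      finally show ?thesis .
    qed
    have "exp (r n * (A - e)) \<le> exp (r n * (2 * A + \<bar>\<theta>\<bar> * \<eta>)) * ?P + 2 * exp (r n * (A - 3 * e))"
      using window_mgf_le[OF n \<delta>(1) \<delta>' less_imp_le[OF \<kappa>], of y \<eta>] up down elim(1) A(2) by simp
    with E3 E4 have "exp (r n * (A - 2 * e)) \<le> exp (r n * (2 * A + \<bar>\<theta>\<bar> * \<eta>)) * ?P" by linarith
    then have "exp (- (r n * (2 * A + \<bar>\<theta>\<bar> * \<eta>))) * exp (r n * (A - 2 * e)) \<le>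
        exp (- (r n * (2 * A + \<bar>\<theta>\<bar> * \<eta>))) * (exp (r n * (2 * A + \<bar>\<theta>\<bar> * \<eta>)) * ?P)"
      by (intro mult_left_mono) auto
    then have "exp (- r n * (A + \<bar>\<theta>\<bar> * \<eta> + 2 * e)) \<le> ?P"
      unfolding mult.assoc[symmetric] exp_add[symmetric] by (simp add: algebra_simps)
    moreover have "exp (- r n * (A + \<bar>\<theta>\<bar> * \<eta> + \<epsilon>)) \<le> exp (- r n * (A + \<bar>\<theta>\<bar> * \<eta> + 2 * e))"
      using e r1 by simp
    ultimately show ?case unfolding A_def \<theta>_def by linarith
  qed
qed

end

subsection \<open>Lower bound\<close>

context stretched_exponential
begin

text \<open>Q reads only indices above l, so the event is an intersection from two independent
  blocks, and the block of prescribed values has a product of point masses. The hypothesis on Q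
  allows it to be evaluated on restricted sequences.\<close>

lemma prob_head_and_rest:
  fixes b :: "nat \<Rightarrow> nat" and Q :: "(nat \<Rightarrow> nat) \<Rightarrow> bool"
  assumes "l < n" "1 \<le> l"
    and Q: "\<And>f g. (\<And>i. i \<in> {l+1..n} \<Longrightarrow> f i = g i) \<Longrightarrow> Q f \<longleftrightarrow> Q g"
  shows "\<P>(\<omega> in M. (\<forall>i\<in>{1..l}. X i \<omega> = b i) \<and> Q (\<lambda>i. X i \<omega>)) =
    (\<Prod>i=1..l. c * exp (- (real (b i) powr \<alpha>))) * \<P>(\<omega> in M. Q (\<lambda>i. X i \<omega>))"
    and "{\<omega> \<in> space M. (\<forall>i\<in>{1..l}. X i \<omega> = b i) \<and> Q (\<lambda>i. X i \<omega>)} \<in> events"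
proof -
  let ?H = "{1..l}" and ?R = "{l+1..n}"
  let ?YH = "\<lambda>\<omega>. restrict (\<lambda>i. X i \<omega>) ?H" and ?YR = "\<lambda>\<omega>. restrict (\<lambda>i. X i \<omega>) ?R"
  let ?MH = "PiM ?H (\<lambda>_. count_space UNIV :: nat measure)" and ?MR = "PiM ?R (\<lambda>_. count_space UNIV :: nat measure)"
  have ind: "indep_var ?MH ?YH ?MR ?YR"
    by (rule indep_var_restrict[OF indep]) auto
  define SH where "SH = {restrict b ?H}"
  define SR where "SR = {f \<in> ?R \<rightarrow>\<^sub>E UNIV. Q f}"
  \<comment> \<open>A finite product of countable discrete spaces is discrete, so every predicate Q
    gives a measurable set.\<close>
  have MH: "?MH = count_space (?H \<rightarrow>\<^sub>E UNIV)" and MR: "?MR = count_space (?R \<rightarrow>\<^sub>E UNIV)"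
    by (intro count_space_PiM_finite; simp)+
  have sets: "SH \<in> sets ?MH" "SR \<in> sets ?MR"
    unfolding MH MR by (auto simp: SH_def SR_def)
  have eqH: "?YH -` SH \<inter> space M = {\<omega> \<in> space M. \<forall>i\<in>?H. X i \<omega> = b i}"
    by (auto simp: SH_def restrict_def fun_eq_iff) metis
  have QR: "Q (restrict f ?R) \<longleftrightarrow> Q f" for f by (rule Q) simp
  have eqR: "?YR -` SR \<inter> space M = {\<omega> \<in> space M. Q (\<lambda>i. X i \<omega>)}"
    using QR by (auto simp: SR_def)
  have eq: "(\<lambda>\<omega>. (?YH \<omega>, ?YR \<omega>)) -` (SH \<times> SR) \<inter> space M =
     {\<omega> \<in> space M. (\<forall>i\<in>?H. X i \<omega> = b i) \<and> Q (\<lambda>i. X i \<omega>)}"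
    using eqH eqR by auto
  have "\<P>(\<omega> in M. \<forall>i\<in>?H. X i \<omega> = b i) = prob (\<Inter>i\<in>?H. X i -` {b i} \<inter> space M)"
    using assms(2) by (intro arg_cong[where f = prob]) auto
  also have "\<dots> = (\<Prod>i\<in>?H. prob (X i -` {b i} \<inter> space M))"
    by (rule indep_varsD[OF indep]) (use assms(2) in auto)
  also have "\<dots> = (\<Prod>i=1..l. c * exp (- (real (b i) powr \<alpha>)))"
  proof (intro prod.cong refl)
    fix i assume "i \<in> ?H"
    moreover have "X i -` {b i} \<inter> space M = {\<omega> \<in> space M. X i \<omega> = b i}" by auto
    ultimately show "prob (X i -` {b i} \<inter> space M) = c * exp (- (real (b i) powr \<alpha>))"
      using dist[of i "b i"] by simp
  qed
  finally have H: "\<P>(\<omega> in M. \<forall>i\<in>?H. X i \<omega> = b i) = (\<Prod>i=1..l. c * exp (- (real (b i) powr \<alpha>)))" .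
  show "\<P>(\<omega> in M. (\<forall>i\<in>{1..l}. X i \<omega> = b i) \<and> Q (\<lambda>i. X i \<omega>)) =
    (\<Prod>i=1..l. c * exp (- (real (b i) powr \<alpha>))) * \<P>(\<omega> in M. Q (\<lambda>i. X i \<omega>))"
    using indep_varD[OF ind sets] unfolding eq eqH eqR H by simp
  have "?YH \<in> measurable M ?MH" "?YR \<in> measurable M ?MR"
    using indep_var_rv1[OF ind] indep_var_rv2[OF ind] by auto
  from measurable_sets[OF this(1) sets(1)] measurable_sets[OF this(2) sets(2)]
  have "{\<omega> \<in> space M. \<forall>i\<in>?H. X i \<omega> = b i} \<inter> {\<omega> \<in> space M. Q (\<lambda>i. X i \<omega>)} \<in> events"
    unfolding eqH eqR by (rule sets.Int)
  also have "{\<omega> \<in> space M. \<forall>i\<in>?H. X i \<omega> = b i} \<inter> {\<omega> \<in> space M. Q (\<lambda>i. X i \<omega>)} =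
     {\<omega> \<in> space M. (\<forall>i\<in>{1..l}. X i \<omega> = b i) \<and> Q (\<lambda>i. X i \<omega>)}" by auto
  finally show "{\<omega> \<in> space M. (\<forall>i\<in>{1..l}. X i \<omega> = b i) \<and> Q (\<lambda>i. X i \<omega>)} \<in> events" .
qed

lemma partial_sum_Suc_split:
  assumes "k + 1 \<le> n"
  shows "partial_sum X n \<omega> = (\<Sum>i=1..k. X i \<omega>) + X (k+1) \<omega> + (\<Sum>i=k+2..n. X i \<omega>)"
proof -
  have "{1..n} = {1..k} \<union> {k+1} \<union> {k+2..n}" using assms by auto
  then have "partial_sum X n \<omega> = sum (\<lambda>i. X i \<omega>) ({1..k} \<union> {k+1} \<union> {k+2..n})"
    by (simp only: partial_sum_def)
  also have "\<dots> = (\<Sum>i=1..k. X i \<omega>) + X (k+1) \<omega> + (\<Sum>i=k+2..n. X i \<omega>)"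
    by (subst sum.union_disjoint; (subst sum.union_disjoint)?) auto
  finally show ?thesis .
qed

end

context conditioned_stretched_exponential
begin

text \<open>The heads realise the profile \<open>x\<close>, the bulk fluctuates by a Gaussian amount, and one further
  variable of size \<open>O(\<eta> m)\<close> hits the lattice point exactly, so that no local limit theorem is needed.\<close>

lemma prob_profile_ge:
  fixes x :: "nat \<Rightarrow> real" and t :: nat
  assumes x: "x \<in> decseqs" and n: "k + 2 \<le> n" and \<eta>: "0 < \<eta>" and \<delta>: "0 < \<delta>"
    and t: "real t = \<mu> * real n + s_seq n * m n"
    and y: "y = s - (\<Sum>j<k. x j) - 2 * \<eta>"
    and err: "m n * \<bar>s_seq n - s\<bar> + k + \<mu> * (k + 1) \<le> \<eta> * m n"
    and U: "\<And>f. f \<in> decseqs \<Longrightarrow> (\<And>j. j < k \<Longrightarrow> \<bar>f j - x j\<bar> \<le> max (1 / m n) (max (4 * \<eta>) \<delta>)) \<Longrightarrow> f \<in> U"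
    and Um: "U \<in> sets (restrict_space borel decseqs)"
  shows "(\<Prod>j<k. c * exp (- r n * x j powr \<alpha>)) * (c * exp (- r n * (4 * \<eta>) powr \<alpha>)) *
     \<P>(\<omega> in M. window (k + 1) y \<eta> \<delta> n (\<lambda>i. X i \<omega>)) \<le> joint n U"
proof -
  have n1: "1 \<le> n" using n by simp
  have m1: "1 \<le> m n" and r1: "1 \<le> r n" using m_pos r_pos n1 by auto
  have xn: "0 \<le> x j" for j using x by (auto simp: decseqs_def)
  \<comment> \<open>Rounding down loses less than 1 per prescribed variable, hence the summand k in
    \<open>err\<close>. The index shift reconciles variables from 1 with sequences from 0.\<close>
  define b where "b i = nat \<lfloor>m n * x (i - 1)\<rfloor>" for i
  have b: "real (b i) \<le> m n * x (i - 1)" "m n * x (i - 1) - 1 \<le> real (b i)" for i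
  proof -
    have "0 \<le> m n * x (i - 1)" using m1 xn by simp
    then have "real (b i) = of_int \<lfloor>m n * x (i - 1)\<rfloor>" by (simp add: b_def)
    then show "real (b i) \<le> m n * x (i - 1)" "m n * x (i - 1) - 1 \<le> real (b i)" by linarith+
  qed
  define B where "B = (\<Sum>i=1..k. b i)"
  have sumx: "(\<Sum>i=1..k. m n * x (i - 1)) = m n * (\<Sum>j<k. x j)"
  proof -
    have "(\<Sum>i=1..k. m n * x (i - 1)) = (\<Sum>j<k. m n * x j)"
      by (rule sum.reindex_bij_witness[of _ Suc "\<lambda>i. i - 1"]) auto
    then show ?thesis by (simp add: sum_distrib_left)
  qed
  have B: "real B \<le> m n * (\<Sum>j<k. x j)" "m n * (\<Sum>j<k. x j) - k \<le> real B"
  proof -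
    have "real B \<le> (\<Sum>i=1..k. m n * x (i - 1))" unfolding B_def of_nat_sum by (intro sum_mono b)
    then show "real B \<le> m n * (\<Sum>j<k. x j)" by (simp only: sumx)
    have "(\<Sum>i=1..k. m n * x (i - 1) - 1) \<le> real B" unfolding B_def of_nat_sum by (intro sum_mono b)
    then show "m n * (\<Sum>j<k. x j) - k \<le> real B" by (simp only: sum_subtractf sumx) simp
  qed
  let ?W = "\<lambda>f. window (k + 1) y \<eta> \<delta> n f"
  \<comment> \<open>Fixing the exact bulk sum q makes the value required of variable k + 1 a
    constant, t - B - q, whose point mass is explicit.\<close>
  define Q where "Q q f \<longleftrightarrow> ?W f \<and> (\<Sum>i=k+2..n. f i) = q" for q and f :: "nat \<Rightarrow> nat"
  define D where "D = {q. q + B \<le> t \<and> real (t - B - q) \<le> 4 * \<eta> * m n}"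
  define g where "g q i = (if i = k + 1 then t - B - q else b i)" for q i
  have finD: "finite D" by (rule finite_subset[of _ "{..t}"]) (auto simp: D_def)
  have DI: "q \<in> D" if "0 \<le> real t - real B - real q \<and> real t - real B - real q \<le> 4 * (\<eta> * m n)" for q
  proof -
    have "real (q + B) \<le> real t" using that by simp
    then have le: "q + B \<le> t" by (simp only: of_nat_le_iff)
    then have "real (t - B - q) = real t - real B - real q" by (simp add: of_nat_diff)
    then show ?thesis using that le by (simp add: D_def)
  qed
  \<comment> \<open>The target y lies 2 \<eta> below what the jumps leave of s. The window errs by
    at most \<eta>, and rounding, drift of \<open>s_seq\<close> and the k + 1 missing means by at
    most another \<eta> together. So the gap is 2 \<eta> m up to 2 \<eta> m: nonnegative, as the
    variable that fills it must be, and at most 4 \<eta> m.\<close>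
  have arith: "0 \<le> t - B - q \<and> t - B - q \<le> 4 * E"
    if "\<bar>q - (mn - c1) - ym\<bar> \<le> E" "\<bar>sn - sm\<bar> + k + c1 \<le> E" "ym = sm - S - 2 * E" "t = mn + sn"
      "B \<le> S" "S - k \<le> B" "0 \<le> c1" "0 \<le> k" for q mn c1 ym E sn sm k S t B :: real
    using that by linarith
  have inD: "(\<Sum>i=k+2..n. f i) \<in> D" if W: "?W f" for f
  proof -
    let ?q = "(\<Sum>i=k+2..n. f i)"
    have "\<bar>real ?q - \<mu> * (real n - real (k + 1)) - y * m n\<bar> \<le> \<eta> * m n"
      using W by (simp add: window_def)
    then have 1: "\<bar>real ?q - (\<mu> * real n - \<mu> * real (k + 1)) - y * m n\<bar> \<le> \<eta> * m n"
      by (simp only: right_diff_distrib)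
    have "\<bar>s_seq n * m n - s * m n\<bar> = m n * \<bar>s_seq n - s\<bar>"
      using m1 by (simp add: left_diff_distrib[symmetric] abs_mult)
    then have 2: "\<bar>s_seq n * m n - s * m n\<bar> + k + \<mu> * real (k + 1) \<le> \<eta> * m n"
      using err by simp
    have 3: "y * m n = s * m n - m n * (\<Sum>j<k. x j) - 2 * (\<eta> * m n)"
      unfolding y by (simp add: algebra_simps)
    have 4: "0 \<le> \<mu> * real (k + 1)" using mean_nonneg by simp
    have "0 \<le> real t - real B - real ?q \<and> real t - real B - real ?q \<le> 4 * (\<eta> * m n)"
      by (rule arith[OF 1 2 3 t B 4]) simp
    then show ?thesis by (rule DI)
  qed
  have Qdep: "Q q f \<longleftrightarrow> Q q f'" if "\<And>i. i \<in> {k+1+1..n} \<Longrightarrow> f i = f' i" for q f f'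
  proof -
    have "(\<Sum>i=k+2..n. f i) = (\<Sum>i=k+2..n. f' i)" "(\<Sum>i=k+2..n. real (f i)) = (\<Sum>i=k+2..n. real (f' i))"
      using that by (auto intro!: sum.cong)
    then show ?thesis using that by (auto simp: Q_def window_def)
  qed
  let ?L = "\<lambda>q. {\<omega> \<in> space M. (\<forall>i\<in>{1..k+1}. X i \<omega> = g q i) \<and> Q q (\<lambda>i. X i \<omega>)}"
  have Lp: "prob (?L q) = (\<Prod>i=1..k+1. c * exp (- (real (g q i) powr \<alpha>))) * \<P>(\<omega> in M. Q q (\<lambda>i. X i \<omega>))"
    and Lm: "?L q \<in> events" for q
  proof -
    have kn: "k + 1 < n" "1 \<le> k + 1" using n by auto
    have dep: "\<And>f f'. (\<And>i. i \<in> {k+1+1..n} \<Longrightarrow> f i = f' i) \<Longrightarrow> Q q f \<longleftrightarrow> Q q f'"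
      by (rule Qdep)
    show "prob (?L q) = (\<Prod>i=1..k+1. c * exp (- (real (g q i) powr \<alpha>))) * \<P>(\<omega> in M. Q q (\<lambda>i. X i \<omega>))"
      by (rule prob_head_and_rest(1)[OF kn dep])
    show "?L q \<in> events"
      by (rule prob_head_and_rest(2)[OF kn dep])
  qed
  have head: "(\<Prod>j<k. c * exp (- r n * x j powr \<alpha>)) * (c * exp (- r n * (4 * \<eta>) powr \<alpha>))
     \<le> (\<Prod>i=1..k+1. c * exp (- (real (g q i) powr \<alpha>)))" if q: "q \<in> D" for q
  proof -
    have "(\<Prod>i=1..k+1. c * exp (- (real (g q i) powr \<alpha>))) =
        (\<Prod>i=1..k. c * exp (- (real (g q i) powr \<alpha>))) * (c * exp (- (real (g q (k+1)) powr \<alpha>)))"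
      by simp
    also have "(\<Prod>i=1..k. c * exp (- (real (g q i) powr \<alpha>))) = (\<Prod>j<k. c * exp (- (real (b (j + 1)) powr \<alpha>)))"
      by (rule prod.reindex_bij_witness[of _ Suc "\<lambda>i. i - 1"]) (auto simp: g_def)
    finally have eq: "(\<Prod>i=1..k+1. c * exp (- (real (g q i) powr \<alpha>))) =
      (\<Prod>j<k. c * exp (- (real (b (j + 1)) powr \<alpha>))) * (c * exp (- (real (t - B - q) powr \<alpha>)))"
      by (simp add: g_def)
    have "(\<Prod>j<k. c * exp (- r n * x j powr \<alpha>)) \<le> (\<Prod>j<k. c * exp (- (real (b (j + 1)) powr \<alpha>)))"
    proof (rule prod_mono, rule conjI)
      fix j
      have "real (b (j + 1)) powr \<alpha> \<le> (m n * x j) powr \<alpha>"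
        using b(1)[of "j + 1"] alpha by (intro powr_mono2) auto
      also have "\<dots> = r n * x j powr \<alpha>" using m1 xn by (simp add: powr_mult r_eq)
      finally show "c * exp (- r n * x j powr \<alpha>) \<le> c * exp (- (real (b (j + 1)) powr \<alpha>))"
        using c_pos by simp
    qed (use c_pos in auto)
    moreover have "c * exp (- r n * (4 * \<eta>) powr \<alpha>) \<le> c * exp (- (real (t - B - q) powr \<alpha>))"
    proof -
      have "real (t - B - q) powr \<alpha> \<le> (4 * \<eta> * m n) powr \<alpha>"
        using q alpha by (intro powr_mono2) (auto simp: D_def)
      also have "\<dots> = r n * (4 * \<eta>) powr \<alpha>" using m1 \<eta> by (simp add: powr_mult r_eq)
      finally show ?thesis using c_pos by simp
    qed
    ultimately show ?thesis unfolding eq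
      using c_pos by (intro mult_mono) (auto intro!: prod_nonneg)
  qed
  have Lsub: "?L q \<subseteq> {\<omega> \<in> space M. scaled_order_stats X \<gamma> n \<omega> \<in> U \<and>
     real (partial_sum X n \<omega>) = \<mu> * real n + s_seq n * real n powr \<gamma>}" if q: "q \<in> D" for q
  proof (intro subsetI, elim CollectE conjE, intro CollectI conjI)
    fix \<omega> assume \<omega>: "\<omega> \<in> space M" "\<forall>i\<in>{1..k+1}. X i \<omega> = g q i" "Q q (\<lambda>i. X i \<omega>)"
    show "\<omega> \<in> space M" by fact
    have Xb: "X i \<omega> = b i" if "i \<in> {1..k}" for i using \<omega>(2) that by (auto simp: g_def)
    have Xf: "X (k+1) \<omega> = t - B - q" using \<omega>(2) by (auto simp: g_def)
    have "partial_sum X n \<omega> = (\<Sum>i=1..k. X i \<omega>) + X (k+1) \<omega> + (\<Sum>i=k+2..n. X i \<omega>)"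
      using n by (intro partial_sum_Suc_split) simp
    also have "(\<Sum>i=1..k. X i \<omega>) = B" unfolding B_def using Xb by (intro sum.cong) auto
    also have "(\<Sum>i=k+2..n. X i \<omega>) = q" using \<omega>(3) by (simp add: Q_def)
    also have "B + X (k+1) \<omega> + q = t" using q Xf by (simp add: D_def)
    finally show "real (partial_sum X n \<omega>) = \<mu> * real n + s_seq n * real n powr \<gamma>"
      using t by (simp add: m_def)
    let ?e = "max (1 / m n) (max (4 * \<eta>) \<delta>)"
    show "scaled_order_stats X \<gamma> n \<omega> \<in> U"
    proof (rule U[OF scaled_order_stats_in_decseqs])
      fix j assume j: "j < k"
      have so: "scaled_order_stats X \<gamma> n \<omega> j = real (rev_order_stat X (j + 1) n \<omega>) / m n"
        by (simp add: scaled_order_stats_def m_def)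
      have xdec: "x j \<le> x i" if "i \<le> j" for i using x that by (auto simp: decseqs_def decseq_def)
      have xdec': "x i \<le> x j" if "j \<le> i" for i using x that by (auto simp: decseqs_def decseq_def)
      \<comment> \<open>As x decreases, so does \<open>b\<close>, and the first j + 1 prescribed
        variables all reach \<open>b (j + 1)\<close>.\<close>
      have "real (b (j + 1)) \<le> real (rev_order_stat X (j + 1) n \<omega>)"
      proof (rule rev_order_stat_geI)
        have "{1..j+1} \<subseteq> {i \<in> {1..n}. real (b (j + 1)) \<le> real (X i \<omega>)}"
        proof
          fix i assume i: "i \<in> {1..j+1}"
          have "m n * x j \<le> m n * x (i - 1)" using m1 i by (intro mult_left_mono xdec) auto
          then have "b (j + 1) \<le> b i" unfolding b_def by (intro nat_mono floor_mono) simp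
          then show "i \<in> {i \<in> {1..n}. real (b (j + 1)) \<le> real (X i \<omega>)}"
            using i j n Xb[of i] by auto
        qed
        then have "card {1..j+1} \<le> card {i \<in> {1..n}. real (b (j + 1)) \<le> real (X i \<omega>)}"
          by (intro card_mono) auto
        then show "j < card {i \<in> {1..n}. real (b (j + 1)) \<le> real (X i \<omega>)}" by simp
      qed
      with b(2)[of "j + 1"] have "m n * x j - 1 \<le> real (rev_order_stat X (j + 1) n \<omega>)" by simp
      from divide_right_mono[OF this, of "m n"]
      have lo: "x j - 1 / m n \<le> scaled_order_stats X \<gamma> n \<omega> j"
        using m1 by (simp add: so diff_divide_distrib)
      \<comment> \<open>Only the first j variables can exceed this level: later prescribed values
        are at most m n * x_j, the free variable at most 4 \<eta> * m n, the bulk at most \<delta> *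
        m n.\<close>
      have "real (rev_order_stat X (j + 1) n \<omega>) \<le> m n * (x j + ?e)"
      proof (rule rev_order_stat_leI)
        have e0: "0 \<le> ?e" using \<delta> by simp
        show "0 \<le> m n * (x j + ?e)" using m1 xn[of j] e0 by (intro mult_nonneg_nonneg add_nonneg_nonneg) auto
        have small: "real (X i \<omega>) \<le> m n * (x j + ?e)" if i: "i \<in> {j+1..n}" for i
        proof -
          consider "i \<le> k" | "i = k + 1" | "k + 2 \<le> i" by linarith
          then show ?thesis
          proof cases
            case 1
            then have "real (X i \<omega>) \<le> m n * x (i - 1)" using Xb[of i] i b(1)[of i] by simp
            also have "\<dots> \<le> m n * (x j + ?e)"
            proof -
              have "j \<le> i - 1" using i by auto
              then have "x (i - 1) \<le> x j + ?e" using xdec'[of "i - 1"] e0 by linarith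
              then show ?thesis using m1 by (intro mult_left_mono) auto
            qed
            finally show ?thesis .
          next
            case 2
            have "real (t - B - q) \<le> 4 * \<eta> * m n" using q by (simp only: D_def mem_Collect_eq)
            then have "real (X i \<omega>) \<le> 4 * \<eta> * m n" by (simp only: 2 Xf)
            also have "\<dots> = m n * (4 * \<eta>)" by (rule mult.commute)
            finally have "real (X i \<omega>) \<le> m n * (4 * \<eta>)" .
            also have "\<dots> \<le> m n * (x j + ?e)" using m1 xn[of j] by (intro mult_left_mono) auto
            finally show ?thesis .
          next
            case 3
            then have "real (X i \<omega>) \<le> m n * \<delta>" using \<omega>(3) i by (auto simp: Q_def window_def mult.commute)
            also have "\<dots> \<le> m n * (x j + ?e)" using m1 xn[of j] by (intro mult_left_mono) auto
            finally show ?thesis .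
          qed
        qed
        have "{i \<in> {1..n}. m n * (x j + ?e) < real (X i \<omega>)} \<subseteq> {1..j}"
        proof safe
          fix i assume i: "i \<in> {1..n}" "m n * (x j + ?e) < real (X i \<omega>)"
          then have "i \<notin> {j+1..n}" using small[of i] by linarith
          then show "i \<in> {1..j}" using i(1) by auto
        qed
        then have "card {i \<in> {1..n}. m n * (x j + ?e) < real (X i \<omega>)} \<le> card {1..j}"
          by (intro card_mono) auto
        then show "card {i \<in> {1..n}. m n * (x j + ?e) < real (X i \<omega>)} \<le> j" by simp
      qed
      then have "scaled_order_stats X \<gamma> n \<omega> j \<le> x j + ?e"
        using m1 by (simp add: so pos_divide_le_eq mult.commute)
      with lo show "\<bar>scaled_order_stats X \<gamma> n \<omega> j - x j\<bar> \<le> ?e" by linarith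
    qed
  qed
  have Qm: "{\<omega> \<in> space M. Q q (\<lambda>i. X i \<omega>)} \<in> events" for q
  proof -
    have [measurable]: "(\<lambda>\<omega>. real (X i \<omega>)) \<in> borel_measurable M" if "i \<in> {k+2..n}" for i
      by (rule measurable_compose[OF X_measurable]) (use that in auto)
    have "{\<omega> \<in> space M. Q q (\<lambda>i. X i \<omega>)} =
       {\<omega> \<in> space M. ?W (\<lambda>i. X i \<omega>) \<and> (\<Sum>i=k+2..n. real (X i \<omega>)) = real q}"
      unfolding Q_def of_nat_sum[symmetric] of_nat_eq_iff ..
    also have "\<dots> \<in> events" by measurable
    finally show ?thesis .
  qed
  have "\<P>(\<omega> in M. ?W (\<lambda>i. X i \<omega>)) \<le> prob (\<Union>q\<in>D. {\<omega> \<in> space M. Q q (\<lambda>i. X i \<omega>)})"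
    by (rule finite_measure_mono) (use inD Qm finD in \<open>auto simp: Q_def intro!: sets.finite_UN\<close>)
  also have "\<dots> \<le> (\<Sum>q\<in>D. \<P>(\<omega> in M. Q q (\<lambda>i. X i \<omega>)))"
    by (rule finite_measure_subadditive_finite[OF finD]) (use Qm in auto)
  finally have W: "\<P>(\<omega> in M. ?W (\<lambda>i. X i \<omega>)) \<le> (\<Sum>q\<in>D. \<P>(\<omega> in M. Q q (\<lambda>i. X i \<omega>)))" .
  let ?h = "(\<Prod>j<k. c * exp (- r n * x j powr \<alpha>)) * (c * exp (- r n * (4 * \<eta>) powr \<alpha>))"
  have h0: "0 \<le> ?h" using c_pos by (auto intro!: mult_nonneg_nonneg prod_nonneg)
  have "?h * \<P>(\<omega> in M. ?W (\<lambda>i. X i \<omega>)) \<le> ?h * (\<Sum>q\<in>D. \<P>(\<omega> in M. Q q (\<lambda>i. X i \<omega>)))"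
    by (rule mult_left_mono[OF W h0])
  also have "\<dots> = (\<Sum>q\<in>D. ?h * \<P>(\<omega> in M. Q q (\<lambda>i. X i \<omega>)))" by (rule sum_distrib_left)
  also have "\<dots> \<le> (\<Sum>q\<in>D. prob (?L q))"
    unfolding Lp by (intro sum_mono mult_right_mono head) auto
  \<comment> \<open>Different q mean different bulk sums, so the events are disjoint and the sum
    over q costs nothing.\<close>
  also have "\<dots> = prob (\<Union>q\<in>D. ?L q)"
  proof (rule finite_measure_finite_Union[symmetric, OF finD])
    show "?L ` D \<subseteq> events" using Lm by auto
    show "disjoint_family_on ?L D" by (auto simp: disjoint_family_on_def Q_def)
  qed
  also have "\<dots> \<le> joint n U"
    unfolding joint_def
  proof (rule finite_measure_mono)
    show "(\<Union>q\<in>D. ?L q) \<subseteq> {\<omega> \<in> space M. scaled_order_stats X \<gamma> n \<omega> \<in> U \<and>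
       real (partial_sum X n \<omega>) = \<mu> * real n + s_seq n * real n powr \<gamma>}"
      using Lsub by blast
    have [measurable]: "Measurable.pred M (\<lambda>\<omega>. scaled_order_stats X \<gamma> n \<omega> \<in> U)"
      by (rule measurable_compose[OF measurable_scaled_order_stats[of X M \<gamma> n, OF X_measurable]])
        (use Um in auto)
    show "{\<omega> \<in> space M. scaled_order_stats X \<gamma> n \<omega> \<in> U \<and>
       real (partial_sum X n \<omega>) = \<mu> * real n + s_seq n * real n powr \<gamma>} \<in> events"
      by measurable
  qed
  finally show ?thesis .
qed

text \<open>Only the first k coordinates of x are realised; the cost with partial sums tends to that
  of x, and k \<ge> J suffices to land in U. The choices depend on each other in the order k,
  \<eta>, \<delta>, n.\<close>

lemma lower_bound:
  assumes U: "openin (top_of_set decseqs) U" and x: "x \<in> U" and b: "F \<alpha> v s x < ereal b"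
  shows "eventually (\<lambda>n. exp (- r n * b) \<le> joint n U) sequentially"
proof -
  have xd: "x \<in> decseqs" using U x openin_imp_subset by blast
  obtain V where V: "open V" "U = decseqs \<inter> V" using U by (auto simp: openin_open)
  obtain J e where e: "0 < e" "\<And>y. (\<And>j. j < J \<Longrightarrow> \<bar>y j - x j\<bar> < e) \<Longrightarrow> y \<in> V"
    using open_fun_nhd[OF V(1), of x] x V(2) by blast
  have sx: "summable (\<lambda>j. x j powr \<alpha>)" "summable x"
    and Fx: "(\<Sum>j. x j powr \<alpha>) + (s - (\<Sum>j. x j))\<^sup>2 / (2 * v) < b"
    using b by (auto simp: F_def split: if_splits)
  have "(\<lambda>k. (\<Sum>j<k. x j powr \<alpha>) + (s - (\<Sum>j<k. x j))\<^sup>2 / (2 * v)) \<longlonglongrightarrow>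
     (\<Sum>j. x j powr \<alpha>) + (s - (\<Sum>j. x j))\<^sup>2 / (2 * v)"
    using var_pos by (intro tendsto_intros summable_LIMSEQ sx) auto
  then have "eventually (\<lambda>k. (\<Sum>j<k. x j powr \<alpha>) + (s - (\<Sum>j<k. x j))\<^sup>2 / (2 * v) < b) sequentially"
    using Fx by (rule order_tendstoD)
  from eventually_happens'[OF trivial_limit_sequentially eventually_conj[OF this eventually_ge_at_top[of J]]]
  obtain k where k: "(\<Sum>j<k. x j powr \<alpha>) + (s - (\<Sum>j<k. x j))\<^sup>2 / (2 * v) < b" "J \<le> k" by blast
  define T where "T = (\<Sum>j<k. x j powr \<alpha>)"
  define y where "y \<eta> = s - (\<Sum>j<k. x j) - 2 * \<eta>" for \<eta>
  \<comment> \<open>The total cost: the prescribed variables, the free variable of size at most 4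
    \<eta> m, and the bulk from \<open>window_lower_bound\<close> with \<epsilon> = \<eta>.\<close>
  define G where "G \<eta> = T + (4 * \<eta>) powr \<alpha> + ((y \<eta>)\<^sup>2 / (2 * v) + \<bar>y \<eta> / v\<bar> * \<eta> + \<eta>)" for \<eta>
  have "(G \<longlongrightarrow> T + (4 * 0) powr \<alpha> + ((y 0)\<^sup>2 / (2 * v) + \<bar>y 0 / v\<bar> * 0 + 0)) (at_right 0)"
    unfolding G_def y_def
    by (intro tendsto_intros tendsto_powr')
      (use alpha var_pos in \<open>auto intro!: eventually_at_rightI[of 0 1]\<close>)
  then have "eventually (\<lambda>\<eta>. G \<eta> < b) (at_right 0)"
    by (rule order_tendstoD) (use k in \<open>simp add: T_def y_def\<close>)
  moreover have "eventually (\<lambda>\<eta>. \<eta> < e / 4) (at_right 0)"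
    using e(1) by (intro eventually_at_rightI[of 0 "e / 4"]) auto
  moreover have "eventually (\<lambda>\<eta>::real. 0 < \<eta>) (at_right 0)"
    by (simp add: eventually_at_right_less)
  ultimately have "eventually (\<lambda>\<eta>. G \<eta> < b \<and> \<eta> < e / 4 \<and> 0 < \<eta>) (at_right 0)"
    by (intro eventually_conj)
  from eventually_happens'[OF trivial_limit_at_right_real this]
  obtain \<eta> where \<eta>: "G \<eta> < b" "\<eta> < e / 4" "0 < \<eta>" by blast
  \<comment> \<open>The tilts \<theta> \<plusminus> \<kappa> behind the window depend on \<eta>, so
    \<delta> is chosen after it.\<close>
  have "((\<lambda>\<delta>. (\<bar>y \<eta> / v\<bar> + \<eta> / v) * \<delta> powr (1 - \<alpha>)) \<longlongrightarrow> (\<bar>y \<eta> / v\<bar> + \<eta> / v) * 0 powr (1 - \<alpha>)) (at_right 0)"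
    by (intro tendsto_intros tendsto_powr') (use alpha in \<open>auto intro!: eventually_at_rightI[of 0 1]\<close>)
  then have "eventually (\<lambda>\<delta>. (\<bar>y \<eta> / v\<bar> + \<eta> / v) * \<delta> powr (1 - \<alpha>) < 1 / 2) (at_right 0)"
    by (rule order_tendstoD) simp
  moreover have "eventually (\<lambda>\<delta>. \<delta> < e) (at_right 0)"
    using e(1) by (intro eventually_at_rightI[of 0 e]) auto
  moreover have "eventually (\<lambda>\<delta>::real. 0 < \<delta>) (at_right 0)"
    by (simp add: eventually_at_right_less)
  ultimately have "eventually (\<lambda>\<delta>. (\<bar>y \<eta> / v\<bar> + \<eta> / v) * \<delta> powr (1 - \<alpha>) < 1 / 2 \<and> \<delta> < e \<and> 0 < \<delta>) (at_right 0)"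
    by (intro eventually_conj)
  from eventually_happens'[OF trivial_limit_at_right_real this]
  obtain \<delta> where \<delta>: "(\<bar>y \<eta> / v\<bar> + \<eta> / v) * \<delta> powr (1 - \<alpha>) < 1 / 2" "\<delta> < e" "0 < \<delta>" by blast
  note win = window_lower_bound[OF \<eta>(3) \<eta>(3) \<delta>(3) less_imp_le[OF \<delta>(1)], of "k + 1"]
  have mlim: "(\<lambda>n. inverse (m n)) \<longlonglongrightarrow> 0" by (rule tendsto_inverse_0_at_top[OF m_at_top])
  \<comment> \<open>This is hypothesis \<open>err\<close> of \<open>prob_profile_ge\<close> divided
    by m n.\<close>
  have "(\<lambda>n. \<bar>s_seq n - s\<bar> + (k + \<mu> * (k + 1)) * inverse (m n)) \<longlonglongrightarrow> \<bar>s - s\<bar> + (k + \<mu> * (k + 1)) * 0"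
    by (intro tendsto_intros lim mlim)
  then have ev1: "eventually (\<lambda>n. \<bar>s_seq n - s\<bar> + (k + \<mu> * (k + 1)) * inverse (m n) < \<eta>) sequentially"
    by (rule order_tendstoD) (use \<eta> in simp)
  have ev2: "eventually (\<lambda>n. inverse (m n) < e) sequentially"
    using mlim by (rule order_tendstoD) (use e in simp)
  have "(\<lambda>n. G \<eta> - (real k + 1) * ln c / r n) \<longlonglongrightarrow> G \<eta> - 0"
    by (intro tendsto_intros over_r)
  then have ev3: "eventually (\<lambda>n. G \<eta> - (real k + 1) * ln c / r n < b) sequentially"
    by (rule order_tendstoD) (use \<eta> in simp)
  show ?thesis
    using win ev1 ev2 ev3 eventually_ge_at_top[of "k + 2"]
  proof eventually_elim
    case (elim n)
    have n1: "1 \<le> n" using elim by simp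
    have m1: "1 \<le> m n" and r1: "1 \<le> r n" using m_pos r_pos n1 by auto
    obtain t where t: "real t = \<mu> * real n + s_seq n * m n"
      using lattice[OF n1] by (auto simp: m_def elim!: Nats_cases)
    have err: "m n * \<bar>s_seq n - s\<bar> + k + \<mu> * (k + 1) \<le> \<eta> * m n"
    proof -
      have "m n * (\<bar>s_seq n - s\<bar> + (k + \<mu> * (k + 1)) * inverse (m n)) \<le> m n * \<eta>"
        using elim(2) m1 by (intro mult_left_mono) auto
      moreover have "m n * ((k + \<mu> * (k + 1)) * inverse (m n)) = k + \<mu> * (k + 1)" using m1 by simp
      ultimately show ?thesis by (simp only: distrib_left mult.commute[of "m n" \<eta>])
    qed
    have Um: "U \<in> sets (restrict_space borel decseqs)"
      using sets_closedin_or_openin_decseqs U by blast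
    have "(\<Prod>j<k. c * exp (- r n * x j powr \<alpha>)) * (c * exp (- r n * (4 * \<eta>) powr \<alpha>)) *
      \<P>(\<omega> in M. window (k + 1) (y \<eta>) \<eta> \<delta> n (\<lambda>i. X i \<omega>)) \<le> joint n U"
    proof (rule prob_profile_ge[OF xd elim(5) \<eta>(3) \<delta>(3) t y_def err _ Um])
      fix f assume f: "f \<in> decseqs" "\<And>j. j < k \<Longrightarrow> \<bar>f j - x j\<bar> \<le> max (1 / m n) (max (4 * \<eta>) \<delta>)"
      have "max (1 / m n) (max (4 * \<eta>) \<delta>) < e" using elim(3) \<eta> \<delta> by (simp add: inverse_eq_divide)
      then have "f \<in> V" using f(2) k(2) by (intro e(2)) (meson le_less_trans less_le_trans)
      then show "f \<in> U" using f(1) V by simp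
    qed
    moreover have "(\<Prod>j<k. c * exp (- r n * x j powr \<alpha>)) * (c * exp (- r n * (4 * \<eta>) powr \<alpha>)) *
        exp (- r n * ((y \<eta>)\<^sup>2 / (2 * v) + \<bar>y \<eta> / v\<bar> * \<eta> + \<eta>))
      \<le> (\<Prod>j<k. c * exp (- r n * x j powr \<alpha>)) * (c * exp (- r n * (4 * \<eta>) powr \<alpha>)) *
        \<P>(\<omega> in M. window (k + 1) (y \<eta>) \<eta> \<delta> n (\<lambda>i. X i \<omega>))"
      using c_pos by (intro mult_left_mono elim(1)) (auto intro!: mult_nonneg_nonneg prod_nonneg)
    moreover have "(\<Prod>j<k. c * exp (- r n * x j powr \<alpha>)) * (c * exp (- r n * (4 * \<eta>) powr \<alpha>)) *
        exp (- r n * ((y \<eta>)\<^sup>2 / (2 * v) + \<bar>y \<eta> / v\<bar> * \<eta> + \<eta>)) = exp ((real k + 1) * ln c - r n * G \<eta>)"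
    proof -
      have "(\<Prod>j<k. c * exp (- r n * x j powr \<alpha>)) = c ^ k * exp (- r n * T)"
        by (simp add: prod.distrib exp_sum[symmetric] T_def sum_distrib_left sum_negf)
      moreover have "c ^ k = exp (real k * ln c)" using c_pos by (simp add: exp_of_nat_mult)
      moreover have "c = exp (ln c)" using c_pos by simp
      ultimately have "(\<Prod>j<k. c * exp (- r n * x j powr \<alpha>)) * (c * exp (- r n * (4 * \<eta>) powr \<alpha>)) *
        exp (- r n * ((y \<eta>)\<^sup>2 / (2 * v) + \<bar>y \<eta> / v\<bar> * \<eta> + \<eta>)) =
        (exp (real k * ln c) * exp (- r n * T)) * (exp (ln c) * exp (- r n * (4 * \<eta>) powr \<alpha>)) *
        exp (- r n * ((y \<eta>)\<^sup>2 / (2 * v) + \<bar>y \<eta> / v\<bar> * \<eta> + \<eta>))" by simp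
      also have "\<dots> = exp ((real k + 1) * ln c - r n * G \<eta>)"
        unfolding exp_add[symmetric] G_def by (simp add: algebra_simps)
      finally show ?thesis .
    qed
    moreover have "exp (- r n * b) \<le> exp ((real k + 1) * ln c - r n * G \<eta>)"
    proof -
      have "r n * (G \<eta> - (real k + 1) * ln c / r n) \<le> r n * b"
        using elim(4) r1 by (intro mult_left_mono) auto
      then show ?thesis using r1 by (simp add: right_diff_distrib)
    qed
    ultimately show ?case by linarith
  qed
qed

end

subsection \<open>The large deviation principle\<close>

context conditioned_stretched_exponential
begin

text \<open>The order statistics always lie in \<open>decseqs\<close>, so
  \<open>joint n decseqs\<close> is the probability of the conditioning event.\<close>

lemma measure_cond_law_eq:
  assumes "A \<in> sets (restrict_space borel decseqs)"
  shows "measure (cond_law M X \<gamma> n (\<mu> * real n + s_seq n * real n powr \<gamma>)) A = joint n A / joint n decseqs"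
  by (subst measure_cond_law[OF prob_space_axioms X_measurable assms])
    (simp_all add: cond_prob_def joint_def scaled_order_stats_in_decseqs)

text \<open>The whole space is both open and closed in itself, so both bounds apply to it. They also
  show that the conditioning event eventually has positive probability.\<close>

lemma joint_decseqs_bounds:
  assumes i: "(INF y\<in>decseqs. F \<alpha> v s y) = ereal i" and \<epsilon>: "0 < \<epsilon>"
  shows "eventually (\<lambda>n. exp (- r n * (i + \<epsilon>)) \<le> joint n decseqs) sequentially"
    and "eventually (\<lambda>n. joint n decseqs \<le> exp (- r n * (i - \<epsilon>))) sequentially"
proof -
  have "(INF y\<in>decseqs. F \<alpha> v s y) < ereal (i + \<epsilon>)" using i \<epsilon> by simp
  then obtain x where "x \<in> decseqs" "F \<alpha> v s x < ereal (i + \<epsilon>)" by (auto simp: INF_less_iff)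
  then show "eventually (\<lambda>n. exp (- r n * (i + \<epsilon>)) \<le> joint n decseqs) sequentially"
    by (intro lower_bound) auto
  show "eventually (\<lambda>n. joint n decseqs \<le> exp (- r n * (i - \<epsilon>))) sequentially"
    by (intro upper_bound) (use i \<epsilon> in auto)
qed

lemma scaled_log_prob_le:
  assumes "1 \<le> r n" "p \<le> exp (r n * z)" "0 \<le> p"
  shows "ereal (1 / r n) * log_prob p \<le> ereal z"
proof (cases "p = 0")
  case False
  then have "ln p \<le> r n * z" using assms by (metis ln_exp ln_le_cancel_iff exp_gt_zero less_eq_real_def)
  then show ?thesis using False assms(1) by (simp add: log_prob_def field_simps)
qed (use assms in \<open>simp add: log_prob_def\<close>)

lemma scaled_log_prob_ge:
  assumes "1 \<le> r n" "exp (r n * z) \<le> p"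
  shows "ereal z \<le> ereal (1 / r n) * log_prob p"
proof -
  have p: "0 < p" using assms(2) exp_gt_zero[of "r n * z"] by linarith
  then have "r n * z \<le> ln p" using assms by (simp add: ln_ge_iff)
  then show ?thesis using p assms(1) by (simp add: log_prob_def field_simps)
qed

lemma large_deviation_principle_cond_law:
  "large_deviation_principle (top_of_set decseqs)
      (\<lambda>n. cond_law M X \<gamma> n (\<mu> * real n + s_seq n * real n powr \<gamma>))
      (\<lambda>n. real n powr (\<gamma> * \<alpha>)) (rate_function \<alpha> v s)"
proof -
  obtain i where i: "(INF y\<in>decseqs. F \<alpha> v s y) = ereal i"
    using INF_F_real[OF var_pos] .
  have rate: "rate_function \<alpha> v s x = F \<alpha> v s x - ereal i" for x
    by (simp add: rate_function_def i)
  have ev_r: "eventually (\<lambda>n. 1 \<le> r n) sequentially"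
    using eventually_ge_at_top[of 1] by eventually_elim (rule r_pos)
  let ?p = "\<lambda>n A. measure (cond_law M X \<gamma> n (\<mu> * real n + s_seq n * real n powr \<gamma>)) A"
  have up: "limsup (\<lambda>n. ereal (1 / r n) * log_prob (?p n A)) \<le> - (INF x\<in>A. rate_function \<alpha> v s x)"
    if A: "closedin (top_of_set decseqs) A" for A
  \<comment> \<open>Working with z strictly above the bound leaves room for the errors and treats
    infinite infima together with finite ones.\<close>
  proof (rule dense_ge)
    fix z assume z: "- (INF x\<in>A. rate_function \<alpha> v s x) < z"
    show "limsup (\<lambda>n. ereal (1 / r n) * log_prob (?p n A)) \<le> z"
    proof (cases z)
      case (real w)
      then have "ereal (- w) < (INF x\<in>A. rate_function \<alpha> v s x)"
        using z by (simp add: ereal_uminus_less_reorder)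
      then obtain w' where w': "- w < w'" "ereal w' < (INF x\<in>A. rate_function \<alpha> v s x)"
        using ereal_dense2 by (metis less_ereal.simps(1))
      \<comment> \<open>Half of the gap: one \<epsilon> is lost to the denominator, and the other
        keeps i - w + \<epsilon> strictly below w' + i.\<close>
      define \<epsilon> where "\<epsilon> = (w' + w) / 2"
      have \<epsilon>: "0 < \<epsilon>" using w' by (simp add: \<epsilon>_def)
      have "ereal (w' + i) \<le> F \<alpha> v s x" if "x \<in> A" for x
      proof -
        have "ereal w' \<le> F \<alpha> v s x - ereal i"
          using w'(2) INF_lower[OF that, of "rate_function \<alpha> v s"] unfolding rate by (meson less_imp_le order.trans)
        then show ?thesis by (cases "F \<alpha> v s x") auto
      qed
      then have "ereal (w' + i) \<le> (INF x\<in>A. F \<alpha> v s x)" by (rule INF_greatest)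
      moreover have "ereal (i - w + \<epsilon>) < ereal (w' + i)" using w' by (simp add: \<epsilon>_def field_simps)
      ultimately have "ereal (i - w + \<epsilon>) < (INF x\<in>A. F \<alpha> v s x)" by (rule less_le_trans[rotated])
      from upper_bound[OF A this] joint_decseqs_bounds(1)[OF i \<epsilon>] ev_r
      have "eventually (\<lambda>n. ereal (1 / r n) * log_prob (?p n A) \<le> z) sequentially"
      proof eventually_elim
        case (elim n)
        have "?p n A = joint n A / joint n decseqs"
          using A sets_closedin_or_openin_decseqs by (intro measure_cond_law_eq) blast
        also have "\<dots> \<le> exp (- r n * (i - w + \<epsilon>)) / exp (- r n * (i + \<epsilon>))"
          using elim joint_nonneg by (intro frac_le) auto
        also have "\<dots> = exp (r n * w)" by (simp add: exp_diff[symmetric] algebra_simps)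
        finally show ?case using elim(3) unfolding real by (intro scaled_log_prob_le) auto
      qed
      then show ?thesis by (rule Limsup_bounded)
    qed (use z in auto)
  qed
  have low: "- (INF x\<in>U. rate_function \<alpha> v s x) \<le> liminf (\<lambda>n. ereal (1 / r n) * log_prob (?p n U))"
    if U: "openin (top_of_set decseqs) U" for U
  proof (rule dense_le)
    fix z assume z: "z < - (INF x\<in>U. rate_function \<alpha> v s x)"
    show "z \<le> liminf (\<lambda>n. ereal (1 / r n) * log_prob (?p n U))"
    proof (cases z)
      case (real w)
      then have "(INF x\<in>U. rate_function \<alpha> v s x) < ereal (- w)"
        using z ereal_less_uminus_reorder[of "ereal w" "INF x\<in>U. rate_function \<alpha> v s x"] by simp
      then obtain x where x: "x \<in> U" "F \<alpha> v s x - ereal i < ereal (- w)"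
        by (auto simp: INF_less_iff rate)
      then have "F \<alpha> v s x < ereal (i - w)" by (cases "F \<alpha> v s x") auto
      then obtain b where b: "F \<alpha> v s x < ereal b" "b < i - w"
        using ereal_dense2 by (metis less_ereal.simps(1))
      \<comment> \<open>Exactly the loss that makes numerator rate b and denominator rate i -
        \<epsilon> combine to w.\<close>
      define \<epsilon> where "\<epsilon> = i - w - b"
      have \<epsilon>: "0 < \<epsilon>" using b by (simp add: \<epsilon>_def)
      from lower_bound[OF U x(1) b(1)] joint_decseqs_bounds[OF i \<epsilon>] ev_r
      have "eventually (\<lambda>n. z \<le> ereal (1 / r n) * log_prob (?p n U)) sequentially"
      proof eventually_elim
        case (elim n)
        have pos: "0 < joint n decseqs" using elim(2) exp_gt_zero[of "- r n * (i + \<epsilon>)"] by linarith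
        have "exp (r n * w) = exp (- r n * b) / exp (- r n * (i - \<epsilon>))"
          by (simp add: exp_diff[symmetric] \<epsilon>_def algebra_simps)
        also have "\<dots> \<le> joint n U / joint n decseqs"
          using elim pos joint_nonneg by (intro frac_le) auto
        also have "\<dots> = ?p n U"
          using U sets_closedin_or_openin_decseqs by (intro measure_cond_law_eq[symmetric]) blast
        finally show ?case using elim(4) unfolding real by (intro scaled_log_prob_ge) auto
      qed
      then show ?thesis by (rule Liminf_bounded)
    qed (use z in auto)
  qed
  show ?thesis
    unfolding large_deviation_principle_def r_def[symmetric] using up low by blast
qed

end

theorem theorem2p2:
  fixes \<alpha> c \<gamma> \<mu> v s :: real
    and s_seq :: "nat \<Rightarrow> real"
    and M :: "'a measure"
    and X :: "nat \<Rightarrow> 'a \<Rightarrow> nat"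
  assumes alpha: "0 < \<alpha>" "\<alpha> < 1"
    and c: "c = 1 / (\<Sum>k. exp (- (real k powr \<alpha>)))"
    and gamma: "\<gamma> = 1 / (2 - \<alpha>)"
    and M: "prob_space M"
    and indep: "prob_space.indep_vars M (\<lambda>_. count_space UNIV) X {1..}"
    and dist: "\<And>i k. 1 \<le> i \<Longrightarrow>
        \<P>(\<omega> in M. X i \<omega> = k) = c * exp (- (real k powr \<alpha>))"
    and mean: "\<mu> = prob_space.expectation M (\<lambda>\<omega>. real (X 1 \<omega>))"
    and var: "v = prob_space.variance M (\<lambda>\<omega>. real (X 1 \<omega>))"
    and lattice: "\<And>n. 1 \<le> n \<Longrightarrow> \<mu> * real n + s_seq n * real n powr \<gamma> \<in> \<nat>"
    and lim: "s_seq \<longlonglongrightarrow> s"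
  shows "good_rate_function (top_of_set decseqs) (rate_function \<alpha> v s) \<and>
    large_deviation_principle (top_of_set decseqs)
      (\<lambda>n. cond_law M X \<gamma> n (\<mu> * real n + s_seq n * real n powr \<gamma>))
      (\<lambda>n. real n powr (\<gamma> * \<alpha>))
      (rate_function \<alpha> v s)"
proof -
  interpret conditioned_stretched_exponential M X \<alpha> c \<gamma> \<mu> v s_seq s
    unfolding conditioned_stretched_exponential_def conditioned_stretched_exponential_axioms_def
      stretched_exponential_def stretched_exponential_axioms_def
    using assms by blast
  show ?thesis
    using good_rate_function_rate_function[OF alpha var_pos] large_deviation_principle_cond_law ..
qed

end
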